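(* Let $k/\mathbb{F}_{q^d}$ be a field extension of degree $m$, and let $Q$ be a good irreducible quadratic polynomial in $k[x]$ coprime to $h_1$. If $dm\geq 23$, then there are at least $\#k/(2q^3)$ polynomials in $\mathbb{P}^1_Q$ that split completely over $k$.
   Context: Fix a prime power $q$, a positive integer $d$, and coprime $h_0,h_1\in\mathbb{F}_{q^d}[x]$ of degree at most two; $\overline{\mathbb{F}}_q$ is an algebraic closure of $\mathbb{F}_q$. An element $\tau\in\overline{\mathbb{F}}_q$ with $[\mathbb{F}_{q^d}(\tau):\mathbb{F}_{q^d}] = 2n$ even and $h_1(\tau)\neq0$ is a trap root if either $\frac{h_0}{h_1}(\tau)\in\mathbb{F}_{q^{dn}}$, or $\tau$ is a root of $h_1x^q-h_0$, or $\tau$ is a root of $h_1x^{q^{dn+1}}-h_0$; a polynomial is good if it has no trap root. $V$ is the $\overline{\mathbb{F}}_q$-span of $x^{q+1},x^q,x,1$; an element of $V$ of degree $q+1-n$ is considered to have a root of multiplicity $n$ at $\infty\in\mathbb{P}^1$, and it splits completely over $k$ if all its roots in $\mathbb{P}^1$ lie in $\mathbb{P}^1(k)$. $\varphi:V\to\overline{\mathbb{F}}_q[x][h_1^{-1}]$ is the linear map with $1\mapsto1$, $x\mapsto x$, $x^q\mapsto h_0/h_1$, $x^{q+1}\mapsto xh_0/h_1$; $\varphi_Q$ is $\varphi$ followed by reduction modulo $Q$; and $\mathbb{P}^1_Q = \mathbb{P}(\ker\varphi_Q)\subset\mathbb{P}(V)$, whose points are polynomials up to scalars. *)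

theory Defs
  imports
    "HOL-Algebra.Algebraic_Closure_Type"
    "HOL-Algebra.Generated_Fields"
    "HOL-Number_Theory.Prime_Powers"
    "HOL-Library.Cardinality"
begin

text \<open>
  The base field \<open>F_{q^d}\<close> is a finite field type \<open>'f\<close> with \<open>CARD('f) = q ^ d\<close>, and its algebraic
  closure, which is also that of \<open>F_q\<close>, is \<open>'f alg_closure\<close>. Intermediate fields are subsets of
  \<open>'f alg_closure\<close>. Since the library's subfields and vector space dimensions over a subfield are
  stated for record-based rings, they are taken in the ring \<open>closure_ring\<close>.
\<close>

abbreviation closure_ring :: "'f::field alg_closure ring" where
  "closure_ring \<equiv> ring_of_type_algebra"

abbreviation base_field :: "'f::field alg_closure set" where
  "base_field \<equiv> range to_ac"

abbreviation lift_poly :: "'f::field poly \<Rightarrow> 'f alg_closure poly" where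
  "lift_poly \<equiv> map_poly to_ac"

definition ext_degree :: "'f::field alg_closure set \<Rightarrow> nat \<Rightarrow> bool" where
  "ext_degree E n \<longleftrightarrow> ring.dimension closure_ring n base_field E"

text \<open>
  The subfield \<open>F_{q^N}\<close> of the closure. The lemmas \<open>Fq_pow_unique\<close> and \<open>Fq_pow_subfield\<close> below
  show that it is the only subfield with \<open>q ^ N\<close> elements.
\<close>

definition Fq_pow :: "nat \<Rightarrow> nat \<Rightarrow> 'f::field alg_closure set" where
  "Fq_pow q N = {x. x ^ (q ^ N) = x}"


text \<open>
  In the next definition \<open>2 * n\<close> is automatically positive, and the division by \<open>poly h1 \<tau>\<close> is
  guarded by \<open>poly h1 \<tau> \<noteq> 0\<close>.
\<close>

definition trap_root ::
    "nat \<Rightarrow> nat \<Rightarrow> 'f::field poly \<Rightarrow> 'f poly \<Rightarrow> 'f alg_closure \<Rightarrow> bool" where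
  "trap_root q d h0 h1 \<tau> \<longleftrightarrow>
     (let H0 = lift_poly h0; H1 = lift_poly h1 in
      \<exists>n. ext_degree (generate_field closure_ring (insert \<tau> base_field)) (2 * n) \<and>
          poly H1 \<tau> \<noteq> 0 \<and>
          (poly H0 \<tau> / poly H1 \<tau> \<in> Fq_pow q (d * n) \<or>
           poly (H1 * Polynomial.monom 1 q - H0) \<tau> = 0 \<or>
           poly (H1 * Polynomial.monom 1 (q ^ (d * n + 1)) - H0) \<tau> = 0))"

definition good ::
    "nat \<Rightarrow> nat \<Rightarrow> 'f::field poly \<Rightarrow> 'f poly \<Rightarrow> 'f alg_closure poly \<Rightarrow> bool" where
  "good q d h0 h1 f \<longleftrightarrow> (\<nexists>\<tau>. poly f \<tau> = 0 \<and> trap_root q d h0 h1 \<tau>)"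


definition polys_over :: "'a::zero set \<Rightarrow> 'a poly set" where
  "polys_over k = {f. \<forall>i. Polynomial.coeff f i \<in> k}"

text \<open>
  Irreducibility in \<open>k[x]\<close>, for a subfield \<open>k\<close>: the library's \<open>Factorial_Ring.irreducible\<close> with all
  polynomials restricted to \<open>k[x]\<close>. An element of \<open>k[x]\<close> is a unit there iff it is a nonzero
  constant, i.e. iff it is a unit over the ambient field.
\<close>

definition irreducible_over :: "'a::field set \<Rightarrow> 'a poly \<Rightarrow> bool" where
  "irreducible_over k f \<longleftrightarrow>
     f \<in> polys_over k \<and> f \<noteq> 0 \<and> \<not> f dvd 1 \<and>
     (\<forall>a\<in>polys_over k. \<forall>b\<in>polys_over k. f = a * b \<longrightarrow> a dvd 1 \<or> b dvd 1)"


datatype 'a proj_line = Affine 'a | Infinity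

definition proj_line_over :: "'a set \<Rightarrow> 'a proj_line set" where
  "proj_line_over k = insert Infinity (Affine ` k)"

text \<open>Multiplicity of a point as a root of a nonzero polynomial of degree at most \<open>q + 1\<close>.\<close>

fun root_mult :: "nat \<Rightarrow> 'a::idom poly \<Rightarrow> 'a proj_line \<Rightarrow> nat" where
  "root_mult q f (Affine a) = Polynomial.order a f"
| "root_mult q f Infinity = q + 1 - Polynomial.degree f"

definition splits_completely :: "nat \<Rightarrow> 'a::idom set \<Rightarrow> 'a poly \<Rightarrow> bool" where
  "splits_completely q k f \<longleftrightarrow> f \<noteq> 0 \<and> {P. root_mult q f P > 0} \<subseteq> proj_line_over k"


definition V_space :: "nat \<Rightarrow> 'a::field poly set" where
  "V_space q = module.span Polynomial.smult
     {Polynomial.monom 1 (q + 1), Polynomial.monom 1 q, Polynomial.monom 1 1, 1}"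

text \<open>The ring \<open>K[x][1/h]\<close> (for \<open>h \<noteq> 0\<close>) as a subring of the field of rational functions.\<close>

definition localization :: "'a::field poly \<Rightarrow> 'a poly fract set" where
  "localization h = {Fract a (h ^ i) | a i. True}"

text \<open>
  For \<open>q \<ge> 2\<close> the coordinates of \<open>f \<in> V_space q\<close> in the basis \<open>1, x, x^q, x^(q+1)\<close> are its coefficients,
  so this is the linear map given on that basis by \<open>1 \<mapsto> 1\<close>, \<open>x \<mapsto> x\<close>, \<open>x^q \<mapsto> H0/H1\<close>,
  \<open>x^(q+1) \<mapsto> x H0/H1\<close> (see \<open>phi_basis\<close>).
\<close>

definition phi :: "nat \<Rightarrow> 'a::field poly \<Rightarrow> 'a poly \<Rightarrow> 'a poly \<Rightarrow> 'a poly fract" where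
  "phi q H0 H1 f =
     (let c = (\<lambda>i. to_fract [:Polynomial.coeff f i:]); x = to_fract [:0, 1:] in
      c 0 + c 1 * x + c q * Fract H0 H1 + c (q + 1) * (x * Fract H0 H1))"

text \<open>Residue classes modulo \<open>Q\<close> in \<open>K[x][1/h]\<close>; the class of \<open>0\<close> is the ideal generated by \<open>Q\<close>.\<close>

definition residue_class :: "'a::field poly \<Rightarrow> 'a poly \<Rightarrow> 'a poly fract \<Rightarrow> 'a poly fract set" where
  "residue_class h Q u = {u + to_fract Q * r | r. r \<in> localization h}"

definition phi_mod ::
    "nat \<Rightarrow> 'a::field poly \<Rightarrow> 'a poly \<Rightarrow> 'a poly \<Rightarrow> 'a poly \<Rightarrow> 'a poly fract set" where
  "phi_mod q H0 H1 Q f = residue_class H1 Q (phi q H0 H1 f)"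

definition ker_phi_mod ::
    "nat \<Rightarrow> 'a::field poly \<Rightarrow> 'a poly \<Rightarrow> 'a poly \<Rightarrow> 'a poly set" where
  "ker_phi_mod q H0 H1 Q = {f \<in> V_space q. phi_mod q H0 H1 Q f = residue_class H1 Q 0}"

text \<open>The points of the projective space of a linear subspace, as one-dimensional subspaces.\<close>

definition proj_space :: "'a::field poly set \<Rightarrow> 'a poly set set" where
  "proj_space U = {module.span Polynomial.smult {f} | f. f \<in> U \<and> f \<noteq> 0}"

definition P1_Q ::
    "nat \<Rightarrow> 'f::field poly \<Rightarrow> 'f poly \<Rightarrow> 'f alg_closure poly \<Rightarrow> 'f alg_closure poly set set" where
  "P1_Q q h0 h1 Q = proj_space (ker_phi_mod q (lift_poly h0) (lift_poly h1) Q)"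

definition point_splits_completely ::
    "nat \<Rightarrow> 'a::field set \<Rightarrow> 'a poly set \<Rightarrow> bool" where
  "point_splits_completely q k L \<longleftrightarrow> (\<forall>f\<in>L - {0}. splits_completely q k f)"


lemma phi_basis:
  assumes "q \<ge> 2"
  shows "phi q H0 H1 1 = 1"
    and "phi q H0 H1 (Polynomial.monom 1 1) = to_fract [:0, 1:]"
    and "phi q H0 H1 (Polynomial.monom 1 q) = Fract H0 H1"
    and "phi q H0 H1 (Polynomial.monom 1 (q + 1)) = to_fract [:0, 1:] * Fract H0 H1"
  using assms by (simp_all add: phi_def one_pCons[symmetric])

lemma phi_linear:
  "phi q H0 H1 (f + g) = phi q H0 H1 f + phi q H0 H1 g"
  "phi q H0 H1 (Polynomial.smult c f) = to_fract [:c:] * phi q H0 H1 f"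
proof -
  have add: "to_fract [:a + b:] = to_fract [:a:] + to_fract [:b:]" for a b :: 'a
    by (simp flip: to_fract_add)
  have mult: "to_fract [:a * b:] = to_fract [:a:] * to_fract [:b:]" for a b :: 'a
    by (simp flip: to_fract_mult)
  have distr: "(a + a') + (b + b') * x + (c + c') * y + (e + e') * z =
      (a + b * x + c * y + e * z) + (a' + b' * x + c' * y + e' * z)"
    for a a' b b' c c' e e' x y z :: "'a poly fract"
    by (simp add: algebra_simps)
  show "phi q H0 H1 (f + g) = phi q H0 H1 f + phi q H0 H1 g"
    by (simp only: phi_def Let_def Polynomial.coeff_add add distr)
  show "phi q H0 H1 (Polynomial.smult c f) = to_fract [:c:] * phi q H0 H1 f"
    by (simp only: phi_def Let_def Polynomial.coeff_smult mult distrib_left mult.assoc)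
qed

lemma closure_ring_simps:
  "carrier closure_ring = UNIV" "x \<otimes>\<^bsub>closure_ring\<^esub> y = x * y" "x \<oplus>\<^bsub>closure_ring\<^esub> y = x + y"
  "\<one>\<^bsub>closure_ring\<^esub> = 1" "\<zero>\<^bsub>closure_ring\<^esub> = 0"
  by (simp_all add: ring_of_type_algebra_def)

lemma CHAR_of_card:
  assumes "primepow q" "CARD('f::finite_field) = q ^ d"
  shows "\<exists>e. e > 0 \<and> q = CHAR('f) ^ e"
proof -
  from assms(1) obtain p e where pe: "prime p" "e > 0" "q = p ^ e"
    by (auto simp: primepow_def)
  have "of_nat (CARD('f)) = (0 :: 'f)"
  proof -
    have "(\<Sum>x\<in>UNIV. x + (1 :: 'f)) = (\<Sum>x\<in>UNIV. x)"
      by (rule sum.reindex_bij_witness[of _ "\<lambda>x. x - 1" "\<lambda>x. x + 1"]) auto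
    thus ?thesis by (simp add: sum.distrib)
  qed
  hence "CHAR('f) dvd p ^ (e * d)"
    by (simp only: of_nat_eq_0_iff_char_dvd assms(2) pe(3) power_mult)
  hence "CHAR('f) = p"
    using pe(1) CHAR_prime[where ?'a = 'f] by (metis prime_dvd_power primes_dvd_imp_eq)
  thus ?thesis using pe by auto
qed

lemma Fq_pow_subfield:
  assumes "primepow q" "CARD('f::finite_field) = q ^ d" "N > 0"
  shows "subfield (Fq_pow q N :: 'f alg_closure set) closure_ring"
    and "card (Fq_pow q N :: 'f alg_closure set) = q ^ N"
proof -
  let ?F = "Fq_pow q N :: 'f alg_closure set"
  obtain e where e: "e > 0" "q = CHAR('f) ^ e"
    using CHAR_of_card[OF assms(1,2)] by blast
  define M where "M = q ^ N"
  have M: "M = CHAR('f alg_closure) ^ (e * N)"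
    by (simp add: M_def e(2) power_mult)
  have "M > 1"
    unfolding M_def using primepow_gt_Suc_0[OF assms(1)] assms(3) by (intro one_less_power) auto
  have pr: "prime CHAR('f alg_closure)" by simp
  have frob: "(x + y) ^ M = x ^ M + y ^ M" for x y :: "'f alg_closure"
    using freshmans_dream'[OF pr M] .
  have neg: "(- x) ^ M = - (x ^ M)" for x :: "'f alg_closure"
    using frob[of x "-x"] \<open>M > 1\<close> by (simp add: eq_neg_iff_add_eq_0 add.commute power_0_left)
  interpret R: field "closure_ring :: 'f alg_closure ring"
    by (rule field_from_type_algebra)
  have inv: "inv\<^bsub>closure_ring\<^esub> x = inverse x" if "x \<noteq> 0" for x :: "'f alg_closure"
    using that by (intro R.comm_inv_char) (auto simp: closure_ring_simps)
  have minus: "\<ominus>\<^bsub>closure_ring\<^esub> x = - x" for x :: "'f alg_closure"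
    by (rule R.minus_equality) (auto simp: closure_ring_simps)
  show "subfield ?F closure_ring"
  proof (rule R.subfieldI', rule R.subringI)
    fix x y assume xy: "x \<in> ?F" "y \<in> ?F"
    show "x \<otimes>\<^bsub>closure_ring\<^esub> y \<in> ?F" "x \<oplus>\<^bsub>closure_ring\<^esub> y \<in> ?F"
      "\<ominus>\<^bsub>closure_ring\<^esub> x \<in> ?F"
      using xy frob neg
      by (auto simp: Fq_pow_def closure_ring_simps minus power_mult_distrib simp flip: M_def)
  next
    fix x assume "x \<in> ?F - {\<zero>\<^bsub>closure_ring\<^esub>}"
    thus "inv\<^bsub>closure_ring\<^esub> x \<in> ?F"
      by (auto simp: Fq_pow_def closure_ring_simps inv power_inverse)
  qed (auto simp: closure_ring_simps Fq_pow_def)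
  define p where "p = Polynomial.monom 1 M - [:0, 1 :: 'f alg_closure:]"
  have coeff1: "Polynomial.coeff p M = 1"
    using \<open>M > 1\<close> by (auto simp: p_def coeff_pCons split: nat.splits)
  have "p \<noteq> 0" using coeff1 by auto
  have "Polynomial.degree p = M"
  proof (rule antisym)
    show "Polynomial.degree p \<le> M"
      unfolding p_def using \<open>M > 1\<close> by (intro degree_diff_le degree_monom_le) auto
    show "M \<le> Polynomial.degree p"
      using coeff1 by (intro le_degree) auto
  qed
  have roots: "poly p x = 0 \<longleftrightarrow> x \<in> ?F" for x
    by (simp add: p_def poly_monom Fq_pow_def M_def)
  have "of_nat M = (0 :: 'f alg_closure)"
    using e(1) assms(3) unfolding M by (simp add: of_nat_eq_0_iff_char_dvd)
  hence der: "pderiv p = [:- 1:]"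
    by (simp add: p_def pderiv_diff pderiv_monom pderiv_pCons)
  have ord: "Polynomial.order x p \<le> 1" for x
  proof (rule ccontr)
    assume "\<not> ?thesis"
    hence "[:-x, 1:] ^ 2 dvd p"
      using order_divides[of x 2 p] by simp
    then obtain r where "p = [:-x, 1:] ^ 2 * r" by (elim dvdE)
    hence "poly (pderiv p) x = 0"
      by (simp only: power2_eq_square pderiv_mult poly_add poly_mult) simp
    thus False by (simp add: der)
  qed
  obtain A where A: "size A = M" "p = Polynomial.smult (Polynomial.lead_coeff p) (\<Prod>x\<in>#A. [:-x, 1:])"
    using alg_closed_imp_factorization[OF \<open>p \<noteq> 0\<close>] \<open>Polynomial.degree p = M\<close> by auto
  have "proots p = A"
  proof -
    have "proots p = proots (\<Prod>x\<in>#A. [:-x, 1:])"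
      using A(2) \<open>p \<noteq> 0\<close> by (metis leading_coeff_0_iff proots_smult)
    also have "\<dots> = A"
    proof (induction A)
      case (add x A)
      have "(\<Prod>y\<in>#A. [:-y, 1:]) \<noteq> 0" by (auto simp: prod_mset_zero_iff)
      hence "proots ([:-x, 1:] * (\<Prod>y\<in>#A. [:-y, 1:])) = {#x#} + A"
        by (subst proots_mult) (simp_all only: proots_linear_factor add.IH, auto)
      thus ?case by (simp del: mult_pCons_left)
    qed auto
    finally show ?thesis .
  qed
  hence "M = size (proots p)" using A(1) by simp
  also have "\<dots> = (\<Sum>x\<in>?F. Polynomial.order x p)"
    using \<open>p \<noteq> 0\<close> roots by (simp add: size_multiset_overloaded_eq)
  also have "\<dots> = (\<Sum>x\<in>?F. 1)"
    using ord roots \<open>p \<noteq> 0\<close> by (intro sum.cong refl antisym) (auto simp: order_root Suc_le_eq)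
  finally show "card ?F = q ^ N" by (simp add: M_def)
qed

lemma Fq_pow_unique:
  fixes L :: "'f::finite_field alg_closure set"
  assumes "primepow q" "CARD('f) = q ^ d" "N > 0"
    and "subfield L closure_ring" "card L = q ^ N"
  shows "L = Fq_pow q N"
proof -
  interpret L: subfield L "closure_ring :: 'f alg_closure ring" by fact
  have fin: "finite L"
    using assms(5) primepow_gt_Suc_0[OF assms(1)] by (intro card_ge_0_finite) simp
  have mult: "x * y \<in> L" if "x \<in> L" "y \<in> L" for x y
    using L.m_closed[OF that] by (simp add: closure_ring_simps)
  have zero: "0 \<in> L"
    using subringE(2)[OF subcring.axioms(1)[OF L.subcring_axioms]] by (simp add: closure_ring_simps)
  have "x ^ card L = x" if x: "x \<in> L" for x
  proof (cases "x = 0")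
    case True
    thus ?thesis using fin zero by (auto simp: card_gt_0_iff)
  next
    case False
    have inj: "inj_on ((*) x) (L - {0})" using False by (auto simp: inj_on_def)
    have "(*) x ` (L - {0}) = L - {0}"
    proof (rule endo_inj_surj[OF _ _ inj])
      show "(*) x ` (L - {0}) \<subseteq> L - {0}"
      proof
        fix z assume "z \<in> (*) x ` (L - {0})"
        then obtain y where y: "y \<in> L" "y \<noteq> 0" "z = x * y" by blast
        with mult[OF x y(1)] False show "z \<in> L - {0}" by simp
      qed
    qed (use fin in simp)
    hence "(\<Prod>y\<in>L - {0}. y) = (\<Prod>y\<in>(*) x ` (L - {0}). y)"
      by simp
    also have "\<dots> = (\<Prod>y\<in>L - {0}. x * y)"
      by (subst prod.reindex[OF inj]) (simp add: o_def)
    also have "\<dots> = x ^ card (L - {0}) * (\<Prod>y\<in>L - {0}. y)"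
      by (simp add: prod.distrib)
    finally have "x ^ card (L - {0}) = 1"
      using fin by (simp add: prod_zero_iff)
    moreover have "card L = Suc (card (L - {0}))"
      using fin zero by (metis card.remove)
    ultimately show ?thesis by simp
  qed
  hence "L \<subseteq> Fq_pow q N" by (auto simp: Fq_pow_def simp flip: assms(5))
  moreover have "finite (Fq_pow q N :: 'f alg_closure set)"
    using Fq_pow_subfield(2)[OF assms(1-3)] primepow_gt_Suc_0[OF assms(1)]
    by (intro card_ge_0_finite) simp
  ultimately show ?thesis
    using Fq_pow_subfield(2)[OF assms(1-3)] assms(5) by (simp add: card_subset_eq)
qed

end

theory Submission
  imports Defs "HOL-Combinatorics.Permutations" "HOL-Analysis.Convex"
begin

text \<open>
  Let \<open>N = #k\<close>, let \<open>\<tau>\<close> be a root of \<open>Q\<close>, \<open>s = (h0/h1)(\<tau>)\<close> and \<open>s = t\<^sup>q\<close>. A Moebius transformation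
  \<open>g = (ax + b)/(cx + e)\<close> over \<open>k\<close> with \<open>g(\<tau>) = g(t)\<^sup>q\<close> yields the polynomial
  \<open>(ax + b)\<^sup>q (cx + e) - (ax + b)(cx + e)\<^sup>q\<close>, which splits completely over \<open>k\<close> (its roots are the preimages
  of the projective line over \<open>F_q\<close>) and lies in the kernel of \<open>\<phi>_Q\<close>. On the finite upper half plane
  \<open>\<Omega>\<close> (the quadratic extension of \<open>k\<close> minus \<open>k\<close>) such \<open>g\<close> correspond to the points \<open>x = g(t)\<close> whose
  hyperbolic distance to \<open>x\<^sup>q\<close> is \<open>c = d(t, \<tau>)\<close>, and goodness of \<open>Q\<close> says that \<open>s\<close> is not in \<open>k\<close> and that
  \<open>c\<close> is neither of the degenerate distances \<open>0\<close> and \<open>1\<close>.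

  The number \<open>M\<close> of these points is the trace of \<open>A_c F\<close>, where \<open>A_c\<close> is the adjacency operator of
  distance \<open>c\<close> and \<open>F\<close> the \<open>q\<close>-Frobenius. As a function of \<open>g\<close> in \<open>G = PGL_2(k)\<close>, the trace of \<open>A_c g F\<close> is
  constant on Frobenius-twisted conjugacy classes, and the class of \<open>1\<close> has density at least \<open>q\<^sup>-\<^sup>3\<close>, so
  \<open>(M - N - 1)\<^sup>2\<close> is at most \<open>q\<^sup>3\<close> times the variance over \<open>G\<close>. The invariant operators commute, so for the
  mean-free part \<open>Z\<close> of \<open>A_c\<close> the second moment of the trace of \<open>Z g F\<close> equals the correlation of the
  traces of \<open>g F\<close> and \<open>Z\<^sup>2 g F\<close>. By Cauchy-Schwarz its square is at most \<open>q\<close> (the number of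
  Frobenius-fixed distances) times the second moment of the trace of \<open>Z\<^sup>2 g F\<close>; there the twist by \<open>F\<close> can be
  dropped, and the intersection numbers of circles and bisectors in \<open>\<Omega>\<close> bound the result by \<open>O(N\<^sup>3)\<close>. Altogether
  \<open>(M - N - 1)\<^sup>4 = O(q\<^sup>7 N\<^sup>3)\<close>, which makes \<open>M \<ge> N/2\<close> when \<open>N \<ge> q\<^sup>2\<^sup>3\<close>.
\<close>

section \<open>Twisted traces of invariant kernels\<close>

text \<open>
  \<open>d\<close> labels the orbits of \<open>G\<close> on pairs of points, with label \<open>e0\<close> for the diagonal; \<open>\<sigma>\<close> normalizes \<open>G\<close>
  and therefore permutes the labels, through \<open>s\<close>.
\<close>

locale coherent_action =
  fixes \<Omega> :: "'x set" and G :: "('x \<Rightarrow> 'x) set" and d :: "'x \<Rightarrow> 'x \<Rightarrow> 'e" and e0 :: 'e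
    and \<sigma> :: "'x \<Rightarrow> 'x" and s :: "'e \<Rightarrow> 'e"
  assumes finite_\<Omega>: "finite \<Omega>" and \<Omega>_nonempty: "\<Omega> \<noteq> {}"
    and finite_G: "finite G"
    and permutes_G: "g \<in> G \<Longrightarrow> g permutes \<Omega>"
    and id_G: "id \<in> G"
    and comp_G: "g \<in> G \<Longrightarrow> h \<in> G \<Longrightarrow> g \<circ> h \<in> G"
    and inv_G: "g \<in> G \<Longrightarrow> inv_into UNIV g \<in> G"
    and d_sym: "x \<in> \<Omega> \<Longrightarrow> y \<in> \<Omega> \<Longrightarrow> d x y = d y x"
    and d_eq_e0_iff: "x \<in> \<Omega> \<Longrightarrow> y \<in> \<Omega> \<Longrightarrow> d x y = e0 \<longleftrightarrow> x = y"
    and d_invariant: "g \<in> G \<Longrightarrow> x \<in> \<Omega> \<Longrightarrow> y \<in> \<Omega> \<Longrightarrow> d (g x) (g y) = d x y"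
    and transitive: "\<lbrakk>x \<in> \<Omega>; y \<in> \<Omega>; x' \<in> \<Omega>; y' \<in> \<Omega>; d x y = d x' y'\<rbrakk> \<Longrightarrow> \<exists>g\<in>G. g x = x' \<and> g y = y'"
    and permutes_\<sigma>: "\<sigma> permutes \<Omega>"
    and d_\<sigma>: "x \<in> \<Omega> \<Longrightarrow> y \<in> \<Omega> \<Longrightarrow> d (\<sigma> x) (\<sigma> y) = s (d x y)"
    and conj_G: "g \<in> G \<Longrightarrow> \<sigma> \<circ> g \<circ> inv_into UNIV \<sigma> \<in> G"
begin

definition E :: "'e set" where "E = (\<lambda>(x, y). d x y) ` (\<Omega> \<times> \<Omega>)"

definition R :: "'e \<Rightarrow> ('x \<times> 'x) set" where "R e = {(x, y) \<in> \<Omega> \<times> \<Omega>. d x y = e}"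

definition adj :: "'e \<Rightarrow> 'x \<Rightarrow> 'x \<Rightarrow> real" where "adj e x y = of_bool (d x y = e)"

definition valency :: "'e \<Rightarrow> real" where "valency e = card (R e) / card \<Omega>"

definition kmul :: "('x \<Rightarrow> 'x \<Rightarrow> real) \<Rightarrow> ('x \<Rightarrow> 'x \<Rightarrow> real) \<Rightarrow> 'x \<Rightarrow> 'x \<Rightarrow> real" where
  "kmul Z W x y = (\<Sum>u\<in>\<Omega>. Z x u * W u y)"

definition ktrace :: "('x \<Rightarrow> 'x \<Rightarrow> real) \<Rightarrow> real" where "ktrace Z = (\<Sum>x\<in>\<Omega>. Z x x)"

definition invariant :: "('x \<Rightarrow> 'x \<Rightarrow> real) \<Rightarrow> bool" where
  "invariant Z \<longleftrightarrow> (\<forall>g\<in>G. \<forall>x\<in>\<Omega>. \<forall>y\<in>\<Omega>. Z (g x) (g y) = Z x y)"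

definition twisted_trace :: "('x \<Rightarrow> 'x \<Rightarrow> real) \<Rightarrow> ('x \<Rightarrow> 'x) \<Rightarrow> real" where
  "twisted_trace Z g = (\<Sum>x\<in>\<Omega>. Z x (g (\<sigma> x)))"

lemma G_closed [simp]: "g \<in> G \<Longrightarrow> x \<in> \<Omega> \<Longrightarrow> g x \<in> \<Omega>"
  using permutes_G permutes_in_image by metis

lemma \<sigma>_closed [simp]: "x \<in> \<Omega> \<Longrightarrow> \<sigma> x \<in> \<Omega>"
  using permutes_\<sigma> permutes_in_image by metis

lemma inv_apply: "g \<in> G \<Longrightarrow> inv_into UNIV g (g x) = x" "g \<in> G \<Longrightarrow> g (inv_into UNIV g x) = x"
  using permutes_G permutes_inverses by metis+

lemma finite_E: "finite E" unfolding E_def using finite_\<Omega> by auto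

lemma d_in_E [simp]: "x \<in> \<Omega> \<Longrightarrow> y \<in> \<Omega> \<Longrightarrow> d x y \<in> E" unfolding E_def by auto

lemma finite_R: "finite (R e)"
  unfolding R_def using finite_\<Omega> by (auto intro: finite_subset[of _ "\<Omega> \<times> \<Omega>"])

lemma card_\<Omega>_pos: "card \<Omega> > 0" using finite_\<Omega> \<Omega>_nonempty by (simp add: card_gt_0_iff)

lemma card_G_pos: "card G > 0" using finite_G id_G by (auto simp: card_gt_0_iff)

lemma card_R_pos: "e \<in> E \<Longrightarrow> card (R e) > 0"
  using finite_R by (auto simp: card_gt_0_iff E_def R_def)

lemma valency_pos: "e \<in> E \<Longrightarrow> valency e > 0"
  using card_R_pos card_\<Omega>_pos by (simp add: valency_def)

section \<open>Averaging over the group\<close>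

lemma sum_G_left: "h \<in> G \<Longrightarrow> (\<Sum>g\<in>G. F (g \<circ> h)) = (\<Sum>g\<in>G. F g)"
  by (rule sum.reindex_bij_witness[of _ "\<lambda>g. g \<circ> inv_into UNIV h" "\<lambda>g. g \<circ> h"])
     (auto simp: comp_G inv_G fun_eq_iff inv_apply)

lemma sum_\<Omega>_G: "g \<in> G \<Longrightarrow> (\<Sum>x\<in>\<Omega>. F (g x)) = (\<Sum>x\<in>\<Omega>. F x)"
  using sum.permute[OF permutes_G, of g F] by (simp add: comp_def)

lemma sum_R:
  fixes F :: "'x \<Rightarrow> 'x \<Rightarrow> real"
  shows "(\<Sum>(x, y)\<in>R e. F x y) = (\<Sum>x\<in>\<Omega>. \<Sum>y\<in>\<Omega>. adj e x y * F x y)"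
proof -
  have "(\<Sum>x\<in>\<Omega>. \<Sum>y\<in>\<Omega>. adj e x y * F x y) = (\<Sum>(x, y)\<in>\<Omega> \<times> \<Omega>. adj e x y * F x y)"
    by (simp add: sum.cartesian_product)
  also have "\<dots> = (\<Sum>(x, y)\<in>R e. F x y)"
    using finite_\<Omega> by (intro sum.mono_neutral_cong_right) (auto simp: R_def adj_def)
  finally show ?thesis by simp
qed

text \<open>By transitivity the pairs with the label of \<open>(x, y)\<close> form one
  \<open>G\<close>-orbit, so averaging \<open>F\<close> along \<open>G\<close> agrees with averaging
  it over that orbit. The proof sums the constant left side over the orbit and swaps the
  sums.\<close>

lemma average_pair:
  fixes F :: "'x \<Rightarrow> 'x \<Rightarrow> real"
  assumes "x \<in> \<Omega>" "y \<in> \<Omega>"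
  shows "card (R (d x y)) * (\<Sum>g\<in>G. F (g x) (g y)) = card G * (\<Sum>u\<in>\<Omega>. \<Sum>v\<in>\<Omega>. adj (d x y) u v * F u v)"
proof -
  have const: "(\<Sum>g\<in>G. F (g u) (g v)) = (\<Sum>g\<in>G. F (g x) (g y))" if "(u, v) \<in> R (d x y)" for u v
  proof -
    from that transitive[of x y u v] assms obtain h where h: "h \<in> G" "h x = u" "h y = v"
      by (auto simp: R_def)
    show ?thesis using sum_G_left[OF h(1), of "\<lambda>g. F (g x) (g y)"] h by simp
  qed
  have "card (R (d x y)) * (\<Sum>g\<in>G. F (g x) (g y)) = (\<Sum>(u, v)\<in>R (d x y). \<Sum>g\<in>G. F (g u) (g v))"
    using const by (simp add: case_prod_unfold)
  also have "\<dots> = (\<Sum>u\<in>\<Omega>. \<Sum>v\<in>\<Omega>. adj (d x y) u v * (\<Sum>g\<in>G. F (g u) (g v)))"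
    by (rule sum_R)
  also have "\<dots> = (\<Sum>g\<in>G. \<Sum>u\<in>\<Omega>. \<Sum>v\<in>\<Omega>. adj (d x y) u v * F (g u) (g v))"
    by (simp add: sum_distrib_left sum.swap[of _ G])
  also have "\<dots> = (\<Sum>g\<in>G. \<Sum>u\<in>\<Omega>. \<Sum>v\<in>\<Omega>. adj (d x y) u v * F u v)"
  proof (rule sum.cong[OF refl])
    fix g assume g: "g \<in> G"
    have "(\<Sum>u\<in>\<Omega>. \<Sum>v\<in>\<Omega>. adj (d x y) u v * F (g u) (g v)) =
          (\<Sum>u\<in>\<Omega>. \<Sum>v\<in>\<Omega>. adj (d x y) (g u) (g v) * F (g u) (g v))"
      using g by (auto simp: adj_def d_invariant intro!: sum.cong)
    also have "\<dots> = (\<Sum>u\<in>\<Omega>. \<Sum>v\<in>\<Omega>. adj (d x y) (g u) v * F (g u) v)"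
      by (rule sum.cong[OF refl], rule sum_\<Omega>_G[OF g])
    also have "\<dots> = (\<Sum>u\<in>\<Omega>. \<Sum>v\<in>\<Omega>. adj (d x y) u v * F u v)"
      by (rule sum_\<Omega>_G[OF g, where F = "\<lambda>u. \<Sum>v\<in>\<Omega>. adj (d x y) u v * F u v"])
    finally show "(\<Sum>u\<in>\<Omega>. \<Sum>v\<in>\<Omega>. adj (d x y) u v * F (g u) (g v)) =
      (\<Sum>u\<in>\<Omega>. \<Sum>v\<in>\<Omega>. adj (d x y) u v * F u v)" .
  qed
  finally show ?thesis by simp
qed

section \<open>Invariant kernels and their commutativity\<close>

lemma invariant_adj: "invariant (adj e)"
  by (auto simp: invariant_def adj_def d_invariant)

lemma invariant_const: "invariant (\<lambda>x y. a)"
  by (auto simp: invariant_def)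

lemma invariant_diff: "invariant Z \<Longrightarrow> invariant W \<Longrightarrow> invariant (\<lambda>x y. Z x y - W x y)"
  by (auto simp: invariant_def)

lemma invariant_kmul:
  assumes "invariant Z" "invariant W" shows "invariant (kmul Z W)"
  unfolding invariant_def
proof (intro ballI)
  fix g x y assume g: "g \<in> G" and x: "x \<in> \<Omega>" and y: "y \<in> \<Omega>"
  have "kmul Z W (g x) (g y) = (\<Sum>u\<in>\<Omega>. Z (g x) (g u) * W (g u) (g y))"
    unfolding kmul_def by (rule sum_\<Omega>_G[OF g, symmetric])
  also have "\<dots> = kmul Z W x y"
    unfolding kmul_def using assms g x y by (intro sum.cong) (auto simp: invariant_def)
  finally show "kmul Z W (g x) (g y) = kmul Z W x y" .
qed

lemma invariant_cong:
  assumes "invariant Z" "x \<in> \<Omega>" "y \<in> \<Omega>" "u \<in> \<Omega>" "v \<in> \<Omega>" "d x y = d u v"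
  shows "Z x y = Z u v"
proof -
  obtain g where "g \<in> G" "g x = u" "g y = v" using transitive[of x y u v] assms by auto
  thus ?thesis using assms(1-3) by (auto simp: invariant_def)
qed

lemma invariant_sym: "invariant Z \<Longrightarrow> x \<in> \<Omega> \<Longrightarrow> y \<in> \<Omega> \<Longrightarrow> Z x y = Z y x"
  by (rule invariant_cong) (auto simp: d_sym)

lemma invariant_diag: "invariant Z \<Longrightarrow> x \<in> \<Omega> \<Longrightarrow> y \<in> \<Omega> \<Longrightarrow> Z x x = Z y y"
  using d_eq_e0_iff[of x x] d_eq_e0_iff[of y y] by (intro invariant_cong) auto

text \<open>Gelfand's trick: invariant kernels factor through the symmetric \<open>d\<close>, so
  they and their products are symmetric, while transposition reverses a product.\<close>

lemma kmul_commute: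
  assumes "invariant Z" "invariant W" "x \<in> \<Omega>" "y \<in> \<Omega>"
  shows "kmul Z W x y = kmul W Z x y"
proof -
  have "kmul Z W x y = kmul Z W y x"
    by (rule invariant_sym[OF invariant_kmul]) fact+
  also have "\<dots> = (\<Sum>u\<in>\<Omega>. W x u * Z u y)"
    unfolding kmul_def using assms by (intro sum.cong) (auto simp: invariant_sym[of Z] invariant_sym[of W])
  finally show ?thesis by (simp add: kmul_def)
qed

lemma kmul_cong:
  "(\<And>u v. u \<in> \<Omega> \<Longrightarrow> v \<in> \<Omega> \<Longrightarrow> Z u v = Z' u v) \<Longrightarrow> (\<And>u v. u \<in> \<Omega> \<Longrightarrow> v \<in> \<Omega> \<Longrightarrow> W u v = W' u v) \<Longrightarrow>
   x \<in> \<Omega> \<Longrightarrow> y \<in> \<Omega> \<Longrightarrow> kmul Z W x y = kmul Z' W' x y"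
  unfolding kmul_def by (intro sum.cong) auto

lemma ktrace_cong:
  "(\<And>u v. u \<in> \<Omega> \<Longrightarrow> v \<in> \<Omega> \<Longrightarrow> Z u v = Z' u v) \<Longrightarrow> ktrace Z = ktrace Z'"
  unfolding ktrace_def by (intro sum.cong) auto

lemma kmul_assoc: "kmul (kmul Z W) V = kmul Z (kmul W V)"
  unfolding kmul_def fun_eq_iff sum_distrib_left sum_distrib_right
  by (subst sum.swap) (simp add: mult.assoc)

section \<open>Action of \<open>\<sigma>\<close> on the labels\<close>

lemma s_bij: "bij_betw s E E"
proof -
  have "s ` E = E"
  proof
    show "s ` E \<subseteq> E"
    proof
      fix e assume "e \<in> s ` E"
      then obtain x y where "x \<in> \<Omega>" "y \<in> \<Omega>" "e = s (d x y)" by (auto simp: E_def)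
      thus "e \<in> E" by (simp flip: d_\<sigma>)
    qed
    show "E \<subseteq> s ` E"
    proof
      fix e assume "e \<in> E"
      then obtain x y where "x \<in> \<Omega>" "y \<in> \<Omega>" "e = d x y" by (auto simp: E_def)
      moreover have "x \<in> \<sigma> ` \<Omega>" "y \<in> \<sigma> ` \<Omega>" using calculation permutes_image[OF permutes_\<sigma>] by auto
      ultimately obtain u v where "u \<in> \<Omega>" "v \<in> \<Omega>" "e = d (\<sigma> u) (\<sigma> v)" by auto
      thus "e \<in> s ` E" by (auto simp: d_\<sigma>)
    qed
  qed
  thus ?thesis using finite_E by (simp add: bij_betw_def eq_card_imp_inj_on)
qed

lemma card_R_s:
  assumes "e \<in> E" shows "card (R (s e)) = card (R e)"
proof -
  have "bij_betw (map_prod \<sigma> \<sigma>) (R e) (R (s e))"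
  proof (rule bij_betw_imageI)
    have "inj \<sigma>" using permutes_\<sigma> by (rule permutes_inj)
    thus "inj_on (map_prod \<sigma> \<sigma>) (R e)" using prod.inj_map inj_on_subset by blast
    show "map_prod \<sigma> \<sigma> ` R e = R (s e)"
    proof
      show "map_prod \<sigma> \<sigma> ` R e \<subseteq> R (s e)" by (auto simp: R_def d_\<sigma>)
      show "R (s e) \<subseteq> map_prod \<sigma> \<sigma> ` R e"
      proof
        fix p assume "p \<in> R (s e)"
        then obtain x y where xy: "p = (x, y)" "x \<in> \<Omega>" "y \<in> \<Omega>" "d x y = s e" by (auto simp: R_def)
        have "x \<in> \<sigma> ` \<Omega>" "y \<in> \<sigma> ` \<Omega>" using xy permutes_image[OF permutes_\<sigma>] by auto
        then obtain u v where uv: "u \<in> \<Omega>" "v \<in> \<Omega>" "x = \<sigma> u" "y = \<sigma> v" by auto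
        with xy have "s (d u v) = s e" by (simp add: d_\<sigma>)
        hence "d u v = e" using inj_onD[OF bij_betw_imp_inj_on[OF s_bij]] assms uv by simp
        hence "(u, v) \<in> R e" using uv by (simp add: R_def)
        moreover have "p = map_prod \<sigma> \<sigma> (u, v)" using xy uv by simp
        ultimately show "p \<in> map_prod \<sigma> \<sigma> ` R e" by (rule rev_image_eqI)
      qed
    qed
  qed
  thus ?thesis by (simp add: bij_betw_same_card)
qed

section \<open>Second moments of twisted traces\<close>

lemma sum_E_adj: "x \<in> \<Omega> \<Longrightarrow> y \<in> \<Omega> \<Longrightarrow> (\<Sum>e\<in>E. adj e x y * F e) = F (d x y)"
  using finite_E by (simp add: adj_def of_bool_def if_distrib[of "\<lambda>t. t * _"] sum.delta cong: if_cong)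

text \<open>Expand the product into pairs \<open>(x, y)\<close> and average the pair
  \<open>(\<sigma> x, \<sigma> y)\<close> over \<open>G\<close>; its label is \<open>s e\<close> if
  that of \<open>(x, y)\<close> is \<open>e\<close>. Each \<open>e\<close> then contributes closed
  walks of four steps, divided by the orbit size.\<close>

lemma sum_twisted_trace_mult:
  assumes "invariant W"
  shows "(\<Sum>g\<in>G. twisted_trace Z g * twisted_trace W g) =
     card G * (\<Sum>e\<in>E. ktrace (kmul (kmul Z (adj (s e))) (kmul W (adj e))) / card (R e))"
proof -
  have "(\<Sum>g\<in>G. twisted_trace Z g * twisted_trace W g) =
    (\<Sum>x\<in>\<Omega>. \<Sum>y\<in>\<Omega>. \<Sum>g\<in>G. Z x (g (\<sigma> x)) * W y (g (\<sigma> y)))"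
    by (simp add: twisted_trace_def sum_product sum.swap[of _ G])
  also have "\<dots> = (\<Sum>x\<in>\<Omega>. \<Sum>y\<in>\<Omega>. \<Sum>e\<in>E. adj e x y * (card G / card (R e) *
      (\<Sum>u\<in>\<Omega>. \<Sum>v\<in>\<Omega>. adj (s e) u v * (Z x u * W y v))))"
  proof (intro sum.cong refl)
    fix x y assume x: "x \<in> \<Omega>" and y: "y \<in> \<Omega>"
    have "card (R (s (d x y))) > 0" using card_R_pos[of "d x y"] card_R_s x y by simp
    thus "(\<Sum>g\<in>G. Z x (g (\<sigma> x)) * W y (g (\<sigma> y))) = (\<Sum>e\<in>E. adj e x y * (card G / card (R e) *
      (\<Sum>u\<in>\<Omega>. \<Sum>v\<in>\<Omega>. adj (s e) u v * (Z x u * W y v))))"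
      using average_pair[of "\<sigma> x" "\<sigma> y" "\<lambda>u v. Z x u * W y v"] x y
      by (subst sum_E_adj) (simp_all add: d_\<sigma> card_R_s field_simps)
  qed
  also have "\<dots> = (\<Sum>e\<in>E. card G / card (R e) * (\<Sum>x\<in>\<Omega>. \<Sum>y\<in>\<Omega>. \<Sum>u\<in>\<Omega>. \<Sum>v\<in>\<Omega>.
      Z x u * adj (s e) u v * W y v * adj e x y))"
    by (simp only: sum.swap[where B = E]) (simp only: sum_distrib_left mult_ac)
  also have "\<dots> = (\<Sum>e\<in>E. card G / card (R e) * ktrace (kmul (kmul Z (adj (s e))) (kmul W (adj e))))"
  proof (rule sum.cong[OF refl])
    fix e
    have "(\<Sum>x\<in>\<Omega>. \<Sum>y\<in>\<Omega>. \<Sum>u\<in>\<Omega>. \<Sum>v\<in>\<Omega>. Z x u * adj (s e) u v * W y v * adj e x y) =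
      (\<Sum>x\<in>\<Omega>. \<Sum>y\<in>\<Omega>. \<Sum>u\<in>\<Omega>. \<Sum>v\<in>\<Omega>. Z x u * adj (s e) u v * (W v y * adj e y x))"
      using invariant_sym[OF assms] d_sym by (intro sum.cong refl) (simp add: adj_def)
    also have "\<dots> = (\<Sum>x\<in>\<Omega>. \<Sum>v\<in>\<Omega>. (\<Sum>u\<in>\<Omega>. Z x u * adj (s e) u v) * (\<Sum>y\<in>\<Omega>. W v y * adj e y x))"
    proof (rule sum.cong[OF refl])
      fix x
      let ?f = "\<lambda>y u v. Z x u * adj (s e) u v * (W v y * adj e y x)"
      have "(\<Sum>y\<in>\<Omega>. \<Sum>u\<in>\<Omega>. \<Sum>v\<in>\<Omega>. ?f y u v) = (\<Sum>y\<in>\<Omega>. \<Sum>v\<in>\<Omega>. \<Sum>u\<in>\<Omega>. ?f y u v)"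
        by (rule sum.cong[OF refl], rule sum.swap)
      also have "\<dots> = (\<Sum>v\<in>\<Omega>. \<Sum>y\<in>\<Omega>. \<Sum>u\<in>\<Omega>. ?f y u v)"
        by (rule sum.swap)
      also have "\<dots> = (\<Sum>v\<in>\<Omega>. \<Sum>u\<in>\<Omega>. \<Sum>y\<in>\<Omega>. ?f y u v)"
        by (rule sum.cong[OF refl], rule sum.swap)
      finally show "(\<Sum>y\<in>\<Omega>. \<Sum>u\<in>\<Omega>. \<Sum>v\<in>\<Omega>. ?f y u v) =
        (\<Sum>v\<in>\<Omega>. (\<Sum>u\<in>\<Omega>. Z x u * adj (s e) u v) * (\<Sum>y\<in>\<Omega>. W v y * adj e y x))"
        by (simp add: sum_product)
    qed
    also have "\<dots> = ktrace (kmul (kmul Z (adj (s e))) (kmul W (adj e)))"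
      by (simp only: ktrace_def kmul_def)
    finally show "card G / card (R e) * (\<Sum>x\<in>\<Omega>. \<Sum>y\<in>\<Omega>. \<Sum>u\<in>\<Omega>. \<Sum>v\<in>\<Omega>. Z x u * adj (s e) u v * W y v * adj e x y) =
      card G / card (R e) * ktrace (kmul (kmul Z (adj (s e))) (kmul W (adj e)))"
      by (simp only:)
  qed
  also have "\<dots> = card G * (\<Sum>e\<in>E. ktrace (kmul (kmul Z (adj (s e))) (kmul W (adj e))) / card (R e))"
    by (simp add: sum_distrib_left)
  finally show ?thesis .
qed


lemma adj_e0: "x \<in> \<Omega> \<Longrightarrow> y \<in> \<Omega> \<Longrightarrow> adj e0 x y = of_bool (x = y)"
  by (simp add: adj_def d_eq_e0_iff)

lemma kmul_adj_e0: "x \<in> \<Omega> \<Longrightarrow> y \<in> \<Omega> \<Longrightarrow> kmul (adj e0) Z x y = Z x y"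
  using finite_\<Omega>
  by (simp add: kmul_def adj_e0 of_bool_def if_distrib[of "\<lambda>t. t * _"] cong: if_cong)

lemma ktrace_rearrange:
  assumes "invariant W" "invariant A"
  shows "ktrace (kmul (kmul Z A) (kmul W B)) = ktrace (kmul (kmul Z W) (kmul A B))"
proof -
  have "ktrace (kmul Z (kmul (kmul A W) B)) = ktrace (kmul Z (kmul (kmul W A) B))"
    by (intro ktrace_cong kmul_cong refl kmul_commute assms)
  thus ?thesis by (simp only: kmul_assoc)
qed

text \<open>Commutativity of the invariant kernels allows moving one factor to the other trace.\<close>

lemma twisted_trace_mult_shift:
  assumes "invariant Z" "invariant W"
  shows "(\<Sum>g\<in>G. twisted_trace Z g * twisted_trace W g) =
         (\<Sum>g\<in>G. twisted_trace (adj e0) g * twisted_trace (kmul Z W) g)"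
proof -
  have "ktrace (kmul (kmul Z (adj (s e))) (kmul W (adj e))) =
        ktrace (kmul (kmul (adj e0) (adj (s e))) (kmul (kmul Z W) (adj e)))" for e
  proof -
    have "ktrace (kmul (kmul Z (adj (s e))) (kmul W (adj e))) =
          ktrace (kmul (kmul Z W) (kmul (adj (s e)) (adj e)))"
      by (rule ktrace_rearrange[OF assms(2) invariant_adj])
    also have "\<dots> = ktrace (kmul (adj e0) (kmul (kmul Z W) (kmul (adj (s e)) (adj e))))"
      by (rule ktrace_cong) (simp add: kmul_adj_e0)
    also have "\<dots> = ktrace (kmul (kmul (adj e0) (kmul Z W)) (kmul (adj (s e)) (adj e)))"
      by (simp only: kmul_assoc)
    also have "\<dots> = ktrace (kmul (kmul (adj e0) (adj (s e))) (kmul (kmul Z W) (adj e)))"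
      by (rule ktrace_rearrange[OF invariant_kmul[OF assms] invariant_adj, symmetric])
    finally show ?thesis .
  qed
  thus ?thesis
    by (simp only: sum_twisted_trace_mult[OF assms(2)] sum_twisted_trace_mult[OF invariant_kmul[OF assms]])
qed

lemma sum_adj_adj: "(\<Sum>x\<in>\<Omega>. \<Sum>y\<in>\<Omega>. adj e x y) = card (R e)"
  using sum_R[of "\<lambda>_ _. 1" e] by simp

text \<open>For the identity kernel only the trace of \<open>adj (s e)\<close> times
  \<open>adj e\<close> remains. It vanishes unless \<open>s e = e\<close>, since distinct labels
  share no pair, and is then the orbit size.\<close>

lemma sum_twisted_trace_id_squared:
  "(\<Sum>g\<in>G. twisted_trace (adj e0) g * twisted_trace (adj e0) g) = card G * card {e\<in>E. s e = e}"
proof -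
  have "ktrace (kmul (kmul (adj e0) (adj (s e))) (kmul (adj e0) (adj e))) / card (R e) = of_bool (s e = e)"
    if e: "e \<in> E" for e
  proof -
    have "ktrace (kmul (kmul (adj e0) (adj (s e))) (kmul (adj e0) (adj e))) = ktrace (kmul (adj (s e)) (adj e))"
      by (intro ktrace_cong kmul_cong kmul_adj_e0)
    also have "\<dots> = (\<Sum>x\<in>\<Omega>. \<Sum>u\<in>\<Omega>. of_bool (s e = e) * adj e x u)"
      unfolding ktrace_def kmul_def by (intro sum.cong refl) (auto simp: adj_def d_sym)
    also have "\<dots> = of_bool (s e = e) * card (R e)"
      by (simp add: sum_adj_adj flip: sum_distrib_left)
    finally show ?thesis using card_R_pos[OF e] by simp
  qed
  hence "(\<Sum>g\<in>G. twisted_trace (adj e0) g * twisted_trace (adj e0) g) = card G * (\<Sum>e\<in>E. of_bool (s e = e) :: real)"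
    by (simp add: sum_twisted_trace_mult[OF invariant_adj])
  also have "(\<Sum>e\<in>E. of_bool (s e = e) :: real) = real (card {e\<in>E. s e = e})"
    using finite_E by (simp add: of_bool_def sum.If_cases Int_def)
  finally show ?thesis by (simp only: of_nat_mult)
qed

section \<open>Valencies and bisector weights\<close>

lemma row_sum_adj:
  assumes x: "x \<in> \<Omega>" shows "(\<Sum>y\<in>\<Omega>. adj e x y) = valency e"
proof -
  \<comment> \<open>Row sums are the diagonal entries of the product with the constant kernel
    \<open>1\<close>, and the diagonal of an invariant kernel is constant.\<close>
  have "(\<Sum>y\<in>\<Omega>. adj e z y) = (\<Sum>y\<in>\<Omega>. adj e x y)" if "z \<in> \<Omega>" for z
    using invariant_diag[OF invariant_kmul[OF invariant_adj invariant_const[of 1]] that x]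
    by (simp add: kmul_def)
  hence "card (R e) = card \<Omega> * (\<Sum>y\<in>\<Omega>. adj e x y)"
    using sum_adj_adj[of e, symmetric] by simp
  thus ?thesis using card_\<Omega>_pos by (simp add: valency_def)
qed

lemma col_sum_adj: "y \<in> \<Omega> \<Longrightarrow> (\<Sum>x\<in>\<Omega>. adj e x y) = valency e"
  using row_sum_adj[of y e] by (simp add: adj_def d_sym cong: sum.cong)

lemma sum_valency: "(\<Sum>e\<in>E. valency e) = card \<Omega>"
proof -
  obtain x where x: "x \<in> \<Omega>" using \<Omega>_nonempty by auto
  have "(\<Sum>e\<in>E. valency e) = (\<Sum>y\<in>\<Omega>. \<Sum>e\<in>E. adj e x y * 1)"
    by (simp add: row_sum_adj[OF x, symmetric] sum.swap[where B = E])
  also have "\<dots> = (\<Sum>y\<in>\<Omega>. 1)" using x by (intro sum.cong refl sum_E_adj)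
  finally show ?thesis by simp
qed

text \<open>The number of points equidistant from \<open>z\<close> and \<open>x\<close>, each weighted by the inverse of the size of
  the circle on which it lies.\<close>

definition bisector :: "'x \<Rightarrow> 'x \<Rightarrow> real" where
  "bisector z x = (\<Sum>e\<in>E. kmul (adj e) (adj e) z x / valency e)"

lemma sum_bisector:
  assumes x: "x \<in> \<Omega>" shows "(\<Sum>z\<in>\<Omega>. bisector z x) = card \<Omega>"
proof -
  have "(\<Sum>z\<in>\<Omega>. kmul (adj e) (adj e) z x) = valency e * valency e" for e
  proof -
    have "(\<Sum>z\<in>\<Omega>. kmul (adj e) (adj e) z x) = (\<Sum>u\<in>\<Omega>. \<Sum>z\<in>\<Omega>. adj e z u * adj e u x)"
      unfolding kmul_def by (rule sum.swap)
    also have "\<dots> = (\<Sum>u\<in>\<Omega>. valency e * adj e u x)"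
      by (intro sum.cong refl) (simp add: col_sum_adj flip: sum_distrib_right)
    also have "\<dots> = valency e * valency e"
      using x by (simp add: col_sum_adj flip: sum_distrib_left)
    finally show ?thesis .
  qed
  hence "(\<Sum>z\<in>\<Omega>. bisector z x) = (\<Sum>e\<in>E. valency e * valency e / valency e)"
    unfolding bisector_def by (subst sum.swap) (simp flip: sum_divide_distrib)
  also have "\<dots> = (\<Sum>e\<in>E. valency e)" using valency_pos by (intro sum.cong) force+
  finally show ?thesis by (simp add: sum_valency)
qed

lemma bisector_self:
  assumes x: "x \<in> \<Omega>" shows "bisector x x = card E"
proof -
  have "kmul (adj e) (adj e) x x / valency e = 1" if "e \<in> E" for e
  proof -
    have "kmul (adj e) (adj e) x x = (\<Sum>u\<in>\<Omega>. adj e x u)"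
    proof (unfold kmul_def, rule sum.cong[OF refl])
      fix u assume "u \<in> \<Omega>"
      hence "d u x = d x u" using x by (rule d_sym)
      thus "adj e x u * adj e u x = adj e x u" by (simp add: adj_def)
    qed
    thus ?thesis using row_sum_adj[OF x] valency_pos[OF that] by simp
  qed
  hence "bisector x x = (\<Sum>e\<in>E. 1)" unfolding bisector_def by (rule sum.cong[OF refl])
  thus ?thesis by simp
qed

text \<open>The bound no longer involves \<open>\<sigma>\<close>: up to the positive factor, its right-hand side is the value of the
  left-hand side for trivial \<open>\<sigma>\<close>, and the arithmetic-geometric mean inequality compares the two.\<close>

lemma sum_twisted_trace_squared_le:
  assumes Y: "invariant Y"
  shows "(\<Sum>g\<in>G. twisted_trace Y g * twisted_trace Y g) \<le>
     card G / card \<Omega> * (\<Sum>x\<in>\<Omega>. \<Sum>z\<in>\<Omega>. kmul Y Y x z * bisector z x)"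
proof -
  define h where "h e = ktrace (kmul (kmul Y (adj e)) (kmul Y (adj e)))" for e
  have YA: "invariant (kmul Y (adj e))" for e by (intro invariant_kmul Y invariant_adj)
  have "2 * ktrace (kmul (kmul Y (adj f)) (kmul Y (adj e))) \<le> h f + h e" for e f
  proof -
    have "2 * ktrace (kmul (kmul Y (adj f)) (kmul Y (adj e))) =
      (\<Sum>x\<in>\<Omega>. \<Sum>u\<in>\<Omega>. 2 * (kmul Y (adj f) x u * kmul Y (adj e) x u))"
      unfolding ktrace_def kmul_def[of "kmul _ _"] sum_distrib_left
      by (intro sum.cong refl) (simp add: invariant_sym[OF YA])
    also have "\<dots> \<le> (\<Sum>x\<in>\<Omega>. \<Sum>u\<in>\<Omega>. kmul Y (adj f) x u * kmul Y (adj f) x u + kmul Y (adj e) x u * kmul Y (adj e) x u)"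
      by (intro sum_mono) (use sum_squares_bound in \<open>simp add: power2_eq_square mult.assoc\<close>)
    also have "\<dots> = h f + h e"
      unfolding h_def ktrace_def kmul_def[of "kmul _ _"] sum.distrib
      by (intro arg_cong2[where f = "(+)"] sum.cong refl) (simp_all add: invariant_sym[OF YA])
    finally show ?thesis .
  qed
  hence "2 * (\<Sum>e\<in>E. ktrace (kmul (kmul Y (adj (s e))) (kmul Y (adj e))) / card (R e)) \<le>
     (\<Sum>e\<in>E. (h (s e) + h e) / card (R e))"
    unfolding sum_distrib_left by (intro sum_mono) (simp add: divide_right_mono)
  also have "\<dots> = (\<Sum>e\<in>E. h (s e) / card (R (s e))) + (\<Sum>e\<in>E. h e / card (R e))"
    by (simp add: add_divide_distrib sum.distrib card_R_s)
  \<comment> \<open>\<open>s\<close> permutes the labels and preserves orbit sizes, so the twist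
    disappears here.\<close>
  also have "(\<Sum>e\<in>E. h (s e) / card (R (s e))) = (\<Sum>e\<in>E. h e / card (R e))"
    by (rule sum.reindex_bij_betw[OF s_bij])
  finally have "(\<Sum>e\<in>E. ktrace (kmul (kmul Y (adj (s e))) (kmul Y (adj e))) / card (R e)) \<le> (\<Sum>e\<in>E. h e / card (R e))"
    by simp
  also have "\<dots> = (\<Sum>e\<in>E. \<Sum>x\<in>\<Omega>. \<Sum>z\<in>\<Omega>. kmul Y Y x z * kmul (adj e) (adj e) z x / valency e / card \<Omega>)"
  proof (rule sum.cong[OF refl])
    fix e
    \<comment> \<open>Commuting the factors brings the two copies of \<open>adj e\<close> together,
      so that summing over \<open>e\<close> produces \<open>bisector\<close>.\<close>
    have "h e = ktrace (kmul (kmul Y Y) (kmul (adj e) (adj e)))"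
      unfolding h_def by (rule ktrace_rearrange[OF Y invariant_adj])
    also have "\<dots> = (\<Sum>x\<in>\<Omega>. \<Sum>z\<in>\<Omega>. kmul Y Y x z * kmul (adj e) (adj e) z x)"
      by (simp only: ktrace_def kmul_def[of "kmul Y Y"])
    finally show "h e / card (R e) =
        (\<Sum>x\<in>\<Omega>. \<Sum>z\<in>\<Omega>. kmul Y Y x z * kmul (adj e) (adj e) z x / valency e / card \<Omega>)"
      using card_\<Omega>_pos by (simp add: valency_def flip: sum_divide_distrib)
  qed
  also have "\<dots> = (\<Sum>x\<in>\<Omega>. \<Sum>z\<in>\<Omega>. \<Sum>e\<in>E. kmul Y Y x z * kmul (adj e) (adj e) z x / valency e / card \<Omega>)"
    by (simp only: sum.swap[where B = E])
  also have "\<dots> = (\<Sum>x\<in>\<Omega>. \<Sum>z\<in>\<Omega>. kmul Y Y x z * bisector z x) / card \<Omega>"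
    by (simp add: bisector_def sum_divide_distrib sum_distrib_left)
  finally have "(\<Sum>e\<in>E. ktrace (kmul (kmul Y (adj (s e))) (kmul Y (adj e))) / card (R e)) \<le>
    (\<Sum>x\<in>\<Omega>. \<Sum>z\<in>\<Omega>. kmul Y Y x z * bisector z x) / card \<Omega>" .
  from mult_left_mono[OF this, of "real (card G)"] show ?thesis
    by (simp add: sum_twisted_trace_mult[OF Y])
qed

text \<open>By symmetry \<open>kmul Y Y\<close> is the Gram matrix of the rows of \<open>Y\<close>.
  All rows have the same norm by transitivity, so the arithmetic-geometric mean inequality bounds
  every entry by the diagonal one.\<close>

lemma kmul_square_le_diag:
  assumes "invariant Y" "x \<in> \<Omega>" "z \<in> \<Omega>"
  shows "\<bar>kmul Y Y x z\<bar> \<le> kmul Y Y x x"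
proof -
  have diag: "kmul Y Y y y = (\<Sum>u\<in>\<Omega>. Y y u * Y y u)" if "y \<in> \<Omega>" for y
    unfolding kmul_def using invariant_sym[OF assms(1)] that by (intro sum.cong) auto
  have "2 * \<bar>kmul Y Y x z\<bar> \<le> (\<Sum>u\<in>\<Omega>. 2 * \<bar>Y x u * Y u z\<bar>)"
    unfolding kmul_def sum_distrib_left[symmetric] by (simp add: sum_abs)
  also have "\<dots> \<le> (\<Sum>u\<in>\<Omega>. Y x u * Y x u + Y z u * Y z u)"
  proof (rule sum_mono)
    fix u assume "u \<in> \<Omega>"
    thus "2 * \<bar>Y x u * Y u z\<bar> \<le> Y x u * Y x u + Y z u * Y z u"
      using sum_squares_bound[of "\<bar>Y x u\<bar>" "\<bar>Y z u\<bar>"] invariant_sym[OF assms(1), of u z] assms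
      by (simp add: abs_mult power2_eq_square)
  qed
  also have "\<dots> = kmul Y Y x x + kmul Y Y z z"
    using assms by (simp add: diag sum.distrib)
  also have "kmul Y Y z z = kmul Y Y x x"
    using invariant_diag[OF invariant_kmul] assms by blast
  finally show ?thesis by simp
qed

text \<open>Since the weights \<open>bisector z x\<close> have mean \<open>1\<close>, an upper bound for those with \<open>z \<noteq> x\<close> already controls
  \<open>\<Sum>z. \<bar>bisector z x - 1\<bar>\<close>.\<close>

lemma sum_kmul_bisector_le:
  assumes Y: "invariant Y" and x: "x \<in> \<Omega>"
    and mean: "(\<Sum>z\<in>\<Omega>. kmul Y Y x z) = 0"
    and bis: "\<And>z. z \<in> \<Omega> \<Longrightarrow> z \<noteq> x \<Longrightarrow> bisector z x \<le> 1"
  shows "(\<Sum>z\<in>\<Omega>. kmul Y Y x z * bisector z x) \<le> 2 * (real (card E) - 1) * kmul Y Y x x"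
proof -
  define K where "K z = kmul Y Y x z" for z
  define T where "T = (\<Sum>z\<in>\<Omega> - {x}. K z * (bisector z x - 1))"
  \<comment> \<open>Since \<open>K\<close> sums to zero, the weights may be shifted by their mean
    \<open>1\<close>.\<close>
  have "(\<Sum>z\<in>\<Omega>. K z * bisector z x) = (\<Sum>z\<in>\<Omega>. K z * (bisector z x - 1))"
    using mean by (simp add: K_def right_diff_distrib sum_subtractf)
  also have "\<dots> = K x * (real (card E) - 1) + T"
    unfolding T_def by (subst sum.remove[OF finite_\<Omega> x]) (simp only: bisector_self[OF x])
  finally have split: "(\<Sum>z\<in>\<Omega>. K z * bisector z x) = K x * (real (card E) - 1) + T" .
  have "T \<le> (\<Sum>z\<in>\<Omega> - {x}. K x * (1 - bisector z x))"
    unfolding T_def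
  proof (rule sum_mono)
    fix z assume z: "z \<in> \<Omega> - {x}"
    have "- K z * (1 - bisector z x) \<le> K x * (1 - bisector z x)"
      using kmul_square_le_diag[OF Y x, of z] bis[of z] z unfolding K_def
      by (intro mult_right_mono) auto
    thus "K z * (bisector z x - 1) \<le> K x * (1 - bisector z x)"
      by (simp add: algebra_simps)
  qed
  also have "\<dots> = K x * (\<Sum>z\<in>\<Omega> - {x}. 1 - bisector z x)"
    by (rule sum_distrib_left[symmetric])
  \<comment> \<open>The shifted weights sum to zero, so the deficit away from \<open>x\<close>
    equals the excess at \<open>x\<close>.\<close>
  also have "(\<Sum>z\<in>\<Omega> - {x}. 1 - bisector z x) = real (card E) - 1"
  proof -
    have "(\<Sum>z\<in>\<Omega>. 1 - bisector z x) = 0" by (simp add: sum_subtractf sum_bisector[OF x])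
    thus ?thesis by (subst (asm) sum.remove[OF finite_\<Omega> x]) (simp add: bisector_self[OF x])
  qed
  finally show ?thesis using split unfolding K_def by (simp add: algebra_simps)
qed

text \<open>\<open>twisted_trace Z\<close> is constant on the twisted conjugacy class of the identity, whose size is \<open>card G\<close>
  divided by the size of the centralizer of \<open>\<sigma>\<close>.\<close>

lemma twisted_trace_id_le:
  assumes Z: "invariant Z"
  shows "card G * (twisted_trace Z id * twisted_trace Z id) \<le>
    card {g\<in>G. \<sigma> \<circ> g = g \<circ> \<sigma>} * (\<Sum>g\<in>G. twisted_trace Z g * twisted_trace Z g)"
proof -
  define C where "C = {g\<in>G. \<sigma> \<circ> g = g \<circ> \<sigma>}"
  \<comment> \<open>\<open>c h \<circ> \<sigma>\<close> is the conjugate of \<open>\<sigma>\<close>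
    by \<open>h\<close>, so the values of \<open>c\<close> form the twisted conjugacy class of the
    identity.\<close>
  define c where "c h = h \<circ> (\<sigma> \<circ> inv_into UNIV h \<circ> inv_into UNIV \<sigma>)" for h
  note inv\<sigma> = permutes_inverses[OF permutes_\<sigma>]
  have c_G: "c h \<in> G" if "h \<in> G" for h
    unfolding c_def using that by (intro comp_G conj_G inv_G)
  have c_trace: "twisted_trace Z (c h) = twisted_trace Z id" if h: "h \<in> G" for h
  proof -
    have "twisted_trace Z (c h) = (\<Sum>x\<in>\<Omega>. Z x (h (\<sigma> (inv_into UNIV h x))))"
      by (simp add: twisted_trace_def c_def inv\<sigma>)
    also have "\<dots> = (\<Sum>x\<in>\<Omega>. Z (h x) (h (\<sigma> (inv_into UNIV h (h x)))))"
      by (rule sum_\<Omega>_G[OF h, symmetric])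
    also have "\<dots> = twisted_trace Z id"
      using Z h by (simp add: twisted_trace_def inv_apply invariant_def)
    finally show ?thesis .
  qed
  \<comment> \<open>If \<open>c h = c h0\<close>, then \<open>inv_into UNIV h0 \<circ> h\<close>
    commutes with \<open>\<sigma>\<close>; hence each fibre of \<open>c\<close> injects into
    \<open>C\<close>.\<close>
  have fibre: "card {h\<in>G. c h = g} \<le> card C" for g
  proof (cases "{h\<in>G. c h = g} = {}")
    case False
    then obtain h0 where h0: "h0 \<in> G" "c h0 = g" by auto
    have "inj_on (\<lambda>h. inv_into UNIV h0 \<circ> h) {h\<in>G. c h = g}"
    proof (rule inj_onI)
      fix h h' assume "inv_into UNIV h0 \<circ> h = inv_into UNIV h0 \<circ> h'"
      hence "h0 (inv_into UNIV h0 (h x)) = h0 (inv_into UNIV h0 (h' x))" for x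
        by (simp add: fun_eq_iff)
      thus "h = h'" using h0(1) by (simp add: inv_apply fun_eq_iff)
    qed
    moreover have "(\<lambda>h. inv_into UNIV h0 \<circ> h) ` {h\<in>G. c h = g} \<subseteq> C"
    proof clarify
      fix h assume h: "h \<in> G" "g = c h"
      have "\<sigma> (inv_into UNIV h0 (h y)) = inv_into UNIV h0 (h (\<sigma> y))" for y
      proof -
        have "c h0 (\<sigma> (h y)) = c h (\<sigma> (h y))" using h h0 by simp
        hence "h0 (\<sigma> (inv_into UNIV h0 (h y))) = h (\<sigma> y)"
          using h h0 by (simp add: c_def inv\<sigma> inv_apply)
        hence "inv_into UNIV h0 (h0 (\<sigma> (inv_into UNIV h0 (h y)))) = inv_into UNIV h0 (h (\<sigma> y))"
          by (rule arg_cong)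
        thus ?thesis using h0 by (simp add: inv_apply)
      qed
      thus "inv_into UNIV h0 \<circ> h \<in> C"
        using h h0 by (auto simp: C_def comp_G inv_G)
    qed
    moreover have "finite C" using finite_G by (simp add: C_def)
    ultimately show ?thesis by (meson card_inj_on_le)
  next
    case True
    thus ?thesis by (simp only: card.empty)
  qed
  have "card G * (twisted_trace Z id * twisted_trace Z id) = (\<Sum>h\<in>G. twisted_trace Z (c h) * twisted_trace Z (c h))"
    by (simp add: c_trace)
  also have "\<dots> = (\<Sum>g\<in>G. \<Sum>h\<in>{h\<in>G. c h = g}. twisted_trace Z (c h) * twisted_trace Z (c h))"
    by (rule sum.group[symmetric]) (use finite_G c_G in auto)
  also have "\<dots> = (\<Sum>g\<in>G. card {h\<in>G. c h = g} * (twisted_trace Z g * twisted_trace Z g))"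
    by (intro sum.cong refl) simp
  also have "\<dots> \<le> (\<Sum>g\<in>G. card C * (twisted_trace Z g * twisted_trace Z g))"
    using fibre by (intro sum_mono mult_right_mono) auto
  finally show ?thesis by (simp add: C_def sum_distrib_left)
qed

text \<open>The factors on the right come from the fibres of twisted conjugation, from the second
  moment for the identity kernel, and from the second moment for the square \<open>Y\<close> of the
  mean-free kernel \<open>Z\<close>. The assumptions \<open>bis\<close> and \<open>codeg\<close> are
  the geometric inputs.\<close>

theorem card_twisted_pairs_bound:
  assumes c: "c \<in> E"
    and bis: "\<And>x z. x \<in> \<Omega> \<Longrightarrow> z \<in> \<Omega> \<Longrightarrow> z \<noteq> x \<Longrightarrow> bisector z x \<le> 1"
    and codeg: "\<And>x. x \<in> \<Omega> \<Longrightarrow> (\<Sum>u\<in>\<Omega>. kmul (adj c) (adj c) x u ^ 2) \<le> B"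
  shows "(card {x\<in>\<Omega>. d x (\<sigma> x) = c} - valency c) ^ 4 \<le>
     real (card {g\<in>G. \<sigma> \<circ> g = g \<circ> \<sigma>}) ^ 2 * card {e\<in>E. s e = e} * (2 * (real (card E) - 1) * B)"
proof -
  define n where "n = real (card \<Omega>)"
  define L where "L = real (card {g\<in>G. \<sigma> \<circ> g = g \<circ> \<sigma>})"
  define v where "v = valency c"
  \<comment> \<open>Subtracting \<open>v / n\<close> makes all rows sum to zero and turns the
    twisted trace at \<open>id\<close> into the deviation to be bounded.\<close>
  define Z where "Z x y = adj c x y - v / n" for x y
  define Y where "Y = kmul Z Z"
  define S where "S = (\<Sum>g\<in>G. twisted_trace Z g * twisted_trace Z g)"
  have n: "n > 0" using card_\<Omega>_pos by (simp add: n_def)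
  have Z: "invariant Z" unfolding Z_def by (intro invariant_diff invariant_adj invariant_const)
  have Y: "invariant Y" unfolding Y_def by (intro invariant_kmul Z)
  have Z_row: "(\<Sum>y\<in>\<Omega>. Z x y) = 0" if "x \<in> \<Omega>" for x
    using that n by (simp add: Z_def sum_subtractf row_sum_adj v_def n_def)
  have kmul_row: "(\<Sum>y\<in>\<Omega>. kmul V W x y) = 0" if "\<And>u. u \<in> \<Omega> \<Longrightarrow> (\<Sum>y\<in>\<Omega>. W u y) = 0" for V W x
    unfolding kmul_def by (subst sum.swap) (simp add: that flip: sum_distrib_left)
  have Y_eq: "Y x u = kmul (adj c) (adj c) x u - v\<^sup>2 / n" if "x \<in> \<Omega>" "u \<in> \<Omega>" for x u
  proof -
    have "Y x u = kmul (adj c) (adj c) x u - v / n * (\<Sum>w\<in>\<Omega>. adj c x w) - v / n * (\<Sum>w\<in>\<Omega>. adj c w u)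
       + (\<Sum>w\<in>\<Omega>. v / n * (v / n))"
      unfolding Y_def kmul_def Z_def sum_distrib_left sum.distrib[symmetric] sum_subtractf[symmetric]
      by (intro sum.cong refl) (simp add: algebra_simps)
    also have "\<dots> = kmul (adj c) (adj c) x u - v / n * v - v / n * v + n * (v / n * (v / n))"
      using that by (simp add: row_sum_adj col_sum_adj v_def n_def)
    also have "\<dots> = kmul (adj c) (adj c) x u - v\<^sup>2 / n"
      using n by (simp add: power2_eq_square)
    finally show ?thesis .
  qed
  have Y_diag: "kmul Y Y x x \<le> B" if x: "x \<in> \<Omega>" for x
  proof -
    have row: "(\<Sum>u\<in>\<Omega>. kmul (adj c) (adj c) x u) = v * v"
    proof -
      have "(\<Sum>u\<in>\<Omega>. kmul (adj c) (adj c) x u) = (\<Sum>w\<in>\<Omega>. \<Sum>u\<in>\<Omega>. adj c x w * adj c w u)"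
        unfolding kmul_def by (rule sum.swap)
      also have "\<dots> = (\<Sum>w\<in>\<Omega>. adj c x w * v)"
        by (intro sum.cong refl) (simp add: row_sum_adj v_def flip: sum_distrib_left)
      also have "\<dots> = v * v" using x by (simp add: row_sum_adj v_def flip: sum_distrib_right)
      finally show ?thesis .
    qed
    have "kmul Y Y x x = (\<Sum>u\<in>\<Omega>. Y x u * Y x u)"
      unfolding kmul_def[of Y] using invariant_sym[OF Y] x by (intro sum.cong) auto
    also have "\<dots> = (\<Sum>u\<in>\<Omega>. (kmul (adj c) (adj c) x u)\<^sup>2 - 2 * (v\<^sup>2 / n) * kmul (adj c) (adj c) x u + (v\<^sup>2 / n)\<^sup>2)"
      using x by (intro sum.cong refl) (simp add: Y_eq power2_eq_square algebra_simps)
    also have "\<dots> = (\<Sum>u\<in>\<Omega>. (kmul (adj c) (adj c) x u)\<^sup>2) - 2 * (v\<^sup>2 / n) * (v * v) + n * (v\<^sup>2 / n)\<^sup>2"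
      by (simp only: sum.distrib sum_subtractf sum_distrib_left[symmetric] row) (simp add: n_def)
    also have "\<dots> = (\<Sum>u\<in>\<Omega>. (kmul (adj c) (adj c) x u)\<^sup>2) - v ^ 4 / n"
      using n by (simp add: field_simps power2_eq_square eval_nat_numeral)
    also have "\<dots> \<le> B"
    proof -
      have "v ^ 4 / n \<ge> 0" using n by (intro divide_nonneg_pos) simp_all
      thus ?thesis using codeg[OF x] by simp
    qed
    finally show ?thesis .
  qed
  have E1: "real (card E) \<ge> 1" using c finite_E by (simp add: Suc_le_eq card_gt_0_iff) auto
  have trace_Z: "twisted_trace Z id = card {x\<in>\<Omega>. d x (\<sigma> x) = c} - v"
  proof -
    have "(\<Sum>x\<in>\<Omega>. adj c x (\<sigma> x)) = card {x\<in>\<Omega>. d x (\<sigma> x) = c}"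
      using finite_\<Omega> by (simp add: adj_def of_bool_def sum.If_cases Int_def)
    thus ?thesis using n by (simp add: twisted_trace_def Z_def sum_subtractf n_def)
  qed
  have "(\<Sum>g\<in>G. twisted_trace Y g * twisted_trace Y g) \<le> card G / n * (\<Sum>x\<in>\<Omega>. \<Sum>z\<in>\<Omega>. kmul Y Y x z * bisector z x)"
    unfolding n_def by (rule sum_twisted_trace_squared_le[OF Y])
  also have "\<dots> \<le> card G / n * (\<Sum>x\<in>\<Omega>. 2 * (real (card E) - 1) * B)"
  proof (intro mult_left_mono sum_mono)
    fix x assume x: "x \<in> \<Omega>"
    have "(\<Sum>z\<in>\<Omega>. kmul Y Y x z) = 0"
      by (rule kmul_row) (simp add: Y_def kmul_row Z_row)
    hence "(\<Sum>z\<in>\<Omega>. kmul Y Y x z * bisector z x) \<le> 2 * (real (card E) - 1) * kmul Y Y x x"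
      using bis x by (intro sum_kmul_bisector_le Y) auto
    also have "\<dots> \<le> 2 * (real (card E) - 1) * B"
      using Y_diag[OF x] E1 by (intro mult_left_mono) auto
    finally show "(\<Sum>z\<in>\<Omega>. kmul Y Y x z * bisector z x) \<le> 2 * (real (card E) - 1) * B" .
  qed (use n in auto)
  also have "\<dots> = card G * (2 * (real (card E) - 1) * B)"
    using n by (simp add: n_def)
  finally have YY: "(\<Sum>g\<in>G. twisted_trace Y g * twisted_trace Y g) \<le> card G * (2 * (real (card E) - 1) * B)" .
  have "S\<^sup>2 = (\<Sum>g\<in>G. twisted_trace (adj e0) g * twisted_trace Y g)\<^sup>2"
    by (simp only: S_def twisted_trace_mult_shift[OF Z Z] Y_def)
  also have "\<dots> \<le> (\<Sum>g\<in>G. (twisted_trace (adj e0) g)\<^sup>2) * (\<Sum>g\<in>G. (twisted_trace Y g)\<^sup>2)"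
    by (rule Cauchy_Schwarz_ineq_sum)
  also have "\<dots> \<le> (card G * card {e\<in>E. s e = e}) * (card G * (2 * (real (card E) - 1) * B))"
    using YY by (intro mult_mono) (auto simp: power2_eq_square sum_twisted_trace_id_squared intro!: sum_nonneg)
  finally have S2: "S\<^sup>2 \<le> (card G * card {e\<in>E. s e = e}) * (card G * (2 * (real (card E) - 1) * B))" .
  have "(card G * (twisted_trace Z id)\<^sup>2)\<^sup>2 \<le> (L * S)\<^sup>2"
    using twisted_trace_id_le[OF Z] by (intro power_mono) (auto simp: L_def S_def power2_eq_square)
  also have "\<dots> \<le> L\<^sup>2 * ((card G * card {e\<in>E. s e = e}) * (card G * (2 * (real (card E) - 1) * B)))"
    unfolding power_mult_distrib using S2 by (intro mult_left_mono) auto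
  finally have "(real (card G))\<^sup>2 * (twisted_trace Z id) ^ 4 \<le>
      (real (card G))\<^sup>2 * (L\<^sup>2 * card {e\<in>E. s e = e} * (2 * (real (card E) - 1) * B))"
    by (simp add: power2_eq_square eval_nat_numeral mult_ac)
  thus ?thesis using card_G_pos by (simp add: trace_Z L_def v_def)
qed

end

section \<open>The finite upper half plane\<close>

text \<open>A relation bilinear in \<open>y\<close> and its conjugate \<open>y ^ N\<close> is a
  polynomial equation of this shape; circles and bisectors in the plane are of this kind. For
  \<open>N \<ge> 2\<close> the two top terms do not meet the linear ones.\<close>

lemma card_roots_sparse_le:
  fixes A B C D :: "'a::field"
  assumes "A \<noteq> 0 \<or> B \<noteq> 0" "N \<ge> 2"
  shows "finite {y. A * y ^ (N + 1) + B * y ^ N + C * y + D = 0}"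
    and "card {y. A * y ^ (N + 1) + B * y ^ N + C * y + D = 0} \<le> N + 1"
proof -
  define p where "p = Polynomial.monom A (N + 1) + Polynomial.monom B N + [:D, C:]"
  have "Polynomial.coeff p (N + 1) = A" "Polynomial.coeff p N = B"
    using assms(2) by (auto simp: p_def coeff_pCons split: nat.splits)
  hence p: "p \<noteq> 0" using assms(1) by auto
  have "Polynomial.degree p \<le> N + 1"
    unfolding p_def using assms(2)
    by (intro degree_add_le degree_monom_le order_trans[OF degree_monom_le] order_trans[OF degree_pCons_le]) auto
  moreover have eq: "{y. A * y ^ (N + 1) + B * y ^ N + C * y + D = 0} = {y. poly p y = 0}"
    by (simp add: p_def poly_monom algebra_simps)
  ultimately show "card {y. A * y ^ (N + 1) + B * y ^ N + C * y + D = 0} \<le> N + 1"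
    using card_poly_roots_bound[OF p] by (simp only: order_trans)
  show "finite {y. A * y ^ (N + 1) + B * y ^ N + C * y + D = 0}"
    unfolding eq by (rule poly_roots_finite[OF p])
qed

lemma card_fixed_power_le:
  fixes n :: nat
  assumes "n \<ge> 2"
  shows "finite {x::'a::field. x ^ n = x}" "card {x::'a::field. x ^ n = x} \<le> n"
proof -
  define p where "p = Polynomial.monom (1::'a) n - [:0, 1:]"
  have "Polynomial.coeff p n = 1"
    using assms by (auto simp: p_def coeff_pCons split: nat.splits)
  hence p: "p \<noteq> 0" by auto
  have deg: "Polynomial.degree p \<le> n"
    unfolding p_def using assms by (intro degree_diff_le degree_monom_le) auto
  have eq: "{x::'a. x ^ n = x} = {x. poly p x = 0}" by (simp add: p_def poly_monom)
  show "finite {x::'a. x ^ n = x}" unfolding eq by (rule poly_roots_finite[OF p])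
  show "card {x::'a. x ^ n = x} \<le> n"
    unfolding eq using card_poly_roots_bound[OF p] deg by (rule order_trans)
qed

text \<open>Fields are given as fixed points of power maps in an ambient field, so that membership
  is an equation. \<open>card_k2\<close> ensures that the whole quadratic extension of
  \<open>k\<close> is present.\<close>

locale frobenius_plane =
  fixes k :: "'a::field set" and q N r :: nat
  assumes q_ge_2: "q \<ge> 2" and r_pos: "r > 0" and N_eq: "N = q ^ r"
    and frob_add: "\<And>x y :: 'a. (x + y) ^ q = x ^ q + y ^ q"
    and k_eq: "k = {x. x ^ N = x}" and card_k: "card k = N"
    and card_k2: "card {x :: 'a. x ^ (N * N) = x} = N * N"
begin

definition cj :: "'a \<Rightarrow> 'a" where "cj x = x ^ N"

definition \<Omega> :: "'a set" where "\<Omega> = {x. cj (cj x) = x \<and> cj x \<noteq> x}"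

text \<open>The invariant of pairs of points under \<open>PGL_2(k)\<close>. It takes values in \<open>k\<close>; the degenerate values are
  \<open>0\<close> (equal points) and \<open>1\<close> (conjugate points).\<close>

definition pdist :: "'a \<Rightarrow> 'a \<Rightarrow> 'a" where
  "pdist x y = (x - y) * (cj x - cj y) / ((x - cj x) * (y - cj y))"

text \<open>Set to be the identity outside \<open>\<Omega>\<close>, so that the Moebius transformations over \<open>k\<close> permute the whole
  type and no pole has to be considered.\<close>

definition mob :: "'a \<Rightarrow> 'a \<Rightarrow> 'a \<Rightarrow> 'a \<Rightarrow> 'a \<Rightarrow> 'a" where
  "mob a b c e x = (if x \<in> \<Omega> then (a * x + b) / (c * x + e) else x)"

definition PGL :: "'a set \<Rightarrow> ('a \<Rightarrow> 'a) set" where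
  "PGL F = {mob a b c e | a b c e. a \<in> F \<and> b \<in> F \<and> c \<in> F \<and> e \<in> F \<and> a * e - b * c \<noteq> 0}"

definition frob :: "'a \<Rightarrow> 'a" where "frob x = (if x \<in> \<Omega> then x ^ q else x)"

section \<open>The \<open>q\<close>-Frobenius and conjugation over \<open>k\<close>\<close>

lemma frob_0: "(0::'a) ^ q = 0" using q_ge_2 by simp

lemma frob_minus: "(- x :: 'a) ^ q = - (x ^ q)"
  using frob_add[of x "-x"] frob_0 by (simp add: eq_neg_iff_add_eq_0 add.commute)

lemma frob_diff: "(x - y :: 'a) ^ q = x ^ q - y ^ q"
  using frob_add[of x "-y"] by (simp add: frob_minus)

lemma frob_inj: "(x :: 'a) ^ q = y ^ q \<longleftrightarrow> x = y"
  using frob_diff[of x y] q_ge_2 by auto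

lemma N_ge_2: "N \<ge> 2"
  using q_ge_2 r_pos self_le_power[of q r] unfolding N_eq by linarith

lemma cj_add: "cj (x + y) = cj x + cj y"
proof -
  have "(x + y) ^ (q ^ i) = x ^ (q ^ i) + y ^ (q ^ i)" for i
    by (induction i) (simp_all add: power_mult frob_add mult.commute[of q])
  thus ?thesis unfolding cj_def by (subst (1 2 3) N_eq) simp
qed

lemma cj_0 [simp]: "cj 0 = 0" and cj_1 [simp]: "cj 1 = 1"
  using N_ge_2 by (simp_all add: cj_def)

lemma cj_minus: "cj (- x) = - cj x"
  using cj_add[of x "-x"] by (simp add: eq_neg_iff_add_eq_0 add.commute)

lemma cj_diff: "cj (x - y) = cj x - cj y"
  using cj_add[of x "-y"] by (simp add: cj_minus)

lemma cj_mult: "cj (x * y) = cj x * cj y" by (simp add: cj_def power_mult_distrib)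

lemma cj_divide: "cj (x / y) = cj x / cj y" by (simp add: cj_def power_divide)

lemma cj_power: "cj (x ^ n) = cj x ^ n" by (simp add: cj_def flip: power_mult) (simp add: mult.commute)

lemmas cj_simps = cj_add cj_diff cj_minus cj_mult cj_divide

lemma cj_eq_0_iff [simp]: "cj x = 0 \<longleftrightarrow> x = 0"
  using N_ge_2 by (simp add: cj_def)

lemma cj_inj: "cj x = cj y \<longleftrightarrow> x = y"
  using cj_diff[of x y] by (metis cj_eq_0_iff eq_iff_diff_eq_0)

lemma k_iff: "x \<in> k \<longleftrightarrow> cj x = x" by (simp add: k_eq cj_def)

lemma \<Omega>_iff: "x \<in> \<Omega> \<longleftrightarrow> cj (cj x) = x \<and> cj x \<noteq> x" by (simp add: \<Omega>_def)

lemma \<Omega>_D: "x \<in> \<Omega> \<Longrightarrow> cj (cj x) = x" "x \<in> \<Omega> \<Longrightarrow> x - cj x \<noteq> 0"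
  by (auto simp: \<Omega>_iff)

lemma cj_\<Omega>: "x \<in> \<Omega> \<Longrightarrow> cj x \<in> \<Omega>" by (auto simp: \<Omega>_iff)

lemma cj_cj_eq: "cj (cj x) = x ^ (N * N)" by (simp add: cj_def power_mult)

lemma finite_\<Omega>: "finite \<Omega>" and card_\<Omega>: "card \<Omega> = N * N - N"
proof -
  have fin: "finite {x :: 'a. x ^ (N * N) = x}"
    using card_k2 N_ge_2 by (intro card_ge_0_finite) simp
  have "\<Omega> = {x. x ^ (N * N) = x} - k"
    by (auto simp: \<Omega>_iff k_iff cj_cj_eq)
  moreover have "k \<subseteq> {x. x ^ (N * N) = x}" by (auto simp: k_iff simp flip: cj_cj_eq)
  ultimately show "finite \<Omega>" "card \<Omega> = N * N - N"
    using fin card_k card_k2 by (auto simp: card_Diff_subset finite_subset)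
qed

lemma finite_k: "finite k" using card_k N_ge_2 by (intro card_ge_0_finite) simp

lemma \<Omega>_nonempty: "\<Omega> \<noteq> {}"
proof -
  have "card \<Omega> > 0" using N_ge_2 by (simp add: card_\<Omega>)
  thus ?thesis by auto
qed

section \<open>Moebius transformations over \<open>k\<close>\<close>

lemma denominator_nonzero:
  assumes "c \<in> k" "e \<in> k" "c \<noteq> 0 \<or> e \<noteq> 0" "x \<in> \<Omega>" shows "c * x + e \<noteq> 0"
proof
  assume 0: "c * x + e = 0"
  hence "cj (c * x + e) = 0" by simp
  hence "c * cj x + e = 0" using assms by (simp add: cj_simps k_iff)
  with 0 have "c * x = c * cj x" by (metis add_right_cancel)
  thus False using 0 assms by (auto simp: \<Omega>_iff)
qed

lemma mob_denominator:
  assumes "c \<in> k" "e \<in> k" "a * e - b * c \<noteq> 0" "x \<in> \<Omega>" shows "c * x + e \<noteq> 0"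
proof (rule denominator_nonzero[OF assms(1,2) _ assms(4)])
  show "c \<noteq> 0 \<or> e \<noteq> 0" using assms(3) by auto
qed

text \<open>Applied to a point and its conjugate, this keeps images off \<open>k\<close>; applied to
  the four differences in \<open>pdist\<close>, it makes the determinant and the denominators
  cancel.\<close>

lemma mob_diff:
  assumes "a \<in> k" "b \<in> k" "c \<in> k" "e \<in> k" "a * e - b * c \<noteq> 0" "x \<in> \<Omega>" "y \<in> \<Omega>"
  shows "(a * x + b) / (c * x + e) - (a * y + b) / (c * y + e) =
     (a * e - b * c) * (x - y) / ((c * x + e) * (c * y + e))"
proof -
  have "c * x + e \<noteq> 0" "c * y + e \<noteq> 0"
    using assms mob_denominator by blast+
  thus ?thesis by (simp add: divide_simps) (simp add: algebra_simps)
qed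

lemma cj_mob:
  assumes "a \<in> k" "b \<in> k" "c \<in> k" "e \<in> k"
  shows "cj ((a * x + b) / (c * x + e)) = (a * cj x + b) / (c * cj x + e)"
  using assms by (simp add: cj_simps k_iff)

lemma mob_\<Omega>:
  assumes "a \<in> k" "b \<in> k" "c \<in> k" "e \<in> k" "a * e - b * c \<noteq> 0" "x \<in> \<Omega>"
  shows "(a * x + b) / (c * x + e) \<in> \<Omega>"
proof -
  have "c * x + e \<noteq> 0" "c * cj x + e \<noteq> 0"
    using assms cj_\<Omega> mob_denominator by blast+
  moreover have "(a * x + b) / (c * x + e) - (a * cj x + b) / (c * cj x + e) \<noteq> 0"
    using calculation assms \<Omega>_D[OF assms(6)] by (simp add: mob_diff cj_\<Omega>)
  ultimately show ?thesis
    using assms by (auto simp: \<Omega>_iff cj_mob)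
qed

lemma pdist_mob:
  assumes "a \<in> k" "b \<in> k" "c \<in> k" "e \<in> k" "a * e - b * c \<noteq> 0" "x \<in> \<Omega>" "y \<in> \<Omega>"
  shows "pdist ((a * x + b) / (c * x + e)) ((a * y + b) / (c * y + e)) = pdist x y"
proof -
  have nz: "c * x + e \<noteq> 0" "c * cj x + e \<noteq> 0" "c * y + e \<noteq> 0" "c * cj y + e \<noteq> 0"
    using assms cj_\<Omega> mob_denominator by blast+
  have "x - cj x \<noteq> 0" "y - cj y \<noteq> 0" using assms \<Omega>_D by auto
  \<comment> \<open>Here \<open>D\<close> stands for the determinant, \<open>A\<close> and
    \<open>B\<close> for the denominators at \<open>x\<close> and \<open>y\<close>, and
    \<open>A'\<close> and \<open>B'\<close> for their conjugates.\<close>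
  moreover have "D * s / (A * B) * (D * t / (A' * B')) / (D * u / (A * A') * (D * v / (B * B'))) = s * t / (u * v)"
    if "A \<noteq> 0" "B \<noteq> 0" "A' \<noteq> 0" "B' \<noteq> 0" "D \<noteq> 0" "u \<noteq> 0" "v \<noteq> 0" for A B A' B' D s t u v :: 'a
    using that by (simp add: divide_simps)
  ultimately show ?thesis
    using assms nz by (simp add: pdist_def cj_mob mob_diff cj_\<Omega>)
qed

lemma mob_comp:
  assumes "a \<in> k" "b \<in> k" "c \<in> k" "e \<in> k" "a * e - b * c \<noteq> 0"
    and "a' \<in> k" "b' \<in> k" "c' \<in> k" "e' \<in> k" "a' * e' - b' * c' \<noteq> 0"
  shows "mob a b c e \<circ> mob a' b' c' e' = mob (a * a' + b * c') (a * b' + b * e') (c * a' + e * c') (c * b' + e * e')"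
proof
  fix x
  show "(mob a b c e \<circ> mob a' b' c' e') x = mob (a * a' + b * c') (a * b' + b * e') (c * a' + e * c') (c * b' + e * e') x"
  proof (cases "x \<in> \<Omega>")
    case True
    define D where "D = c' * x + e'"
    have D: "D \<noteq> 0" unfolding D_def using assms True mob_denominator by blast
    define y where "y = (a' * x + b') / D"
    have yx: "a' * x + b' = y * D" using D by (simp add: y_def)
    have y: "y \<in> \<Omega>" unfolding y_def D_def using assms True by (intro mob_\<Omega>) auto
    have "(a * y + b) / (c * y + e) = ((a * y + b) * D) / ((c * y + e) * D)" using D by simp
    also have "(a * y + b) * D = a * (y * D) + b * D" by (simp add: algebra_simps)
    also have "(c * y + e) * D = c * (y * D) + e * D" by (simp add: algebra_simps)
    finally have "(a * y + b) / (c * y + e) = (a * (a' * x + b') + b * D) / (c * (a' * x + b') + e * D)"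
      by (simp only: yx)
    thus ?thesis using True y by (simp add: mob_def D_def y_def) (simp add: algebra_simps)
  qed (simp add: mob_def)
qed

lemma mob_id: "a \<noteq> 0 \<Longrightarrow> mob a 0 0 a = id"
  by (auto simp: mob_def fun_eq_iff)

lemma k_closed: "a \<in> k \<Longrightarrow> b \<in> k \<Longrightarrow> a + b \<in> k" "a \<in> k \<Longrightarrow> b \<in> k \<Longrightarrow> a - b \<in> k"
  "a \<in> k \<Longrightarrow> - a \<in> k" "a \<in> k \<Longrightarrow> b \<in> k \<Longrightarrow> a * b \<in> k" "a \<in> k \<Longrightarrow> b \<in> k \<Longrightarrow> a / b \<in> k"
  "0 \<in> k" "1 \<in> k" "a \<in> k \<Longrightarrow> a ^ n \<in> k"
  by (simp_all add: k_iff cj_simps cj_power)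

lemma PGL_I: "a \<in> F \<Longrightarrow> b \<in> F \<Longrightarrow> c \<in> F \<Longrightarrow> e \<in> F \<Longrightarrow> a * e - b * c \<noteq> 0 \<Longrightarrow> mob a b c e \<in> PGL F"
  unfolding PGL_def by blast

lemma PGL_E:
  assumes "g \<in> PGL F"
  obtains a b c e where "g = mob a b c e" "a \<in> F" "b \<in> F" "c \<in> F" "e \<in> F" "a * e - b * c \<noteq> 0"
  using assms unfolding PGL_def by blast

lemma PGL_comp:
  assumes "g \<in> PGL k" "h \<in> PGL k" shows "g \<circ> h \<in> PGL k"
proof -
  obtain a b c e where g: "g = mob a b c e" "a \<in> k" "b \<in> k" "c \<in> k" "e \<in> k" "a * e - b * c \<noteq> 0"
    using assms(1) by (rule PGL_E)
  obtain a' b' c' e' where h: "h = mob a' b' c' e'" "a' \<in> k" "b' \<in> k" "c' \<in> k" "e' \<in> k" "a' * e' - b' * c' \<noteq> 0"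
    using assms(2) by (rule PGL_E)
  have "(a * a' + b * c') * (c * b' + e * e') - (a * b' + b * e') * (c * a' + e * c') =
        (a * e - b * c) * (a' * e' - b' * c')"
    by (simp add: algebra_simps)
  thus ?thesis using g h by (auto simp: mob_comp intro!: PGL_I k_closed)
qed

lemma PGL_inverse:
  assumes "g \<in> PGL k" obtains h where "h \<in> PGL k" "g \<circ> h = id" "h \<circ> g = id"
proof -
  obtain a b c e where g: "g = mob a b c e" "a \<in> k" "b \<in> k" "c \<in> k" "e \<in> k" "a * e - b * c \<noteq> 0"
    using assms(1) by (rule PGL_E)
  \<comment> \<open>The inverse is given by the adjugate matrix, whose products with the original
    matrix are scalar.\<close>
  have "e * a - - b * - c \<noteq> 0" using g(6) by (simp add: mult.commute)
  hence "mob e (- b) (- c) a \<in> PGL k" "g \<circ> mob e (- b) (- c) a = id" "mob e (- b) (- c) a \<circ> g = id"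
    using g by (auto intro!: PGL_I k_closed simp: mob_comp k_closed mult.commute mob_id)
  thus ?thesis by (rule that)
qed

lemma PGL_permutes:
  assumes "g \<in> PGL k" shows "g permutes \<Omega>"
proof -
  obtain h where h: "g \<circ> h = id" "h \<circ> g = id" using PGL_inverse[OF assms] by metis
  hence "bij g" using o_bij by blast
  moreover have "g x = x" if "x \<notin> \<Omega>" for x using assms that by (auto elim!: PGL_E simp: mob_def)
  ultimately show ?thesis unfolding permutes_def bij_iff by blast
qed

lemma PGL_inv:
  assumes "g \<in> PGL k" shows "inv_into UNIV g \<in> PGL k"
proof -
  obtain h where "h \<in> PGL k" "g \<circ> h = id" "h \<circ> g = id" using PGL_inverse[OF assms] by metis
  thus ?thesis using inv_unique_comp by metis
qed

lemma finite_PGL: "finite (PGL k)"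
proof -
  have "PGL k \<subseteq> (\<lambda>(a, b, c, e). mob a b c e) ` (k \<times> k \<times> k \<times> k)"
    by (force elim!: PGL_E)
  thus ?thesis using finite_k by (auto intro: finite_subset)
qed

lemma PGL_pdist:
  assumes "g \<in> PGL k" "x \<in> \<Omega>" "y \<in> \<Omega>" shows "pdist (g x) (g y) = pdist x y"
  using assms by (auto elim!: PGL_E simp: mob_def pdist_mob)

section \<open>The invariant distance\<close>

lemma pdist_sym: "pdist x y = pdist y x"
proof -
  have "(x - y) * (cj x - cj y) = (y - x) * (cj y - cj x)" by (simp add: algebra_simps)
  thus ?thesis by (simp add: pdist_def mult.commute)
qed

lemma pdist_eq_0_iff: "x \<in> \<Omega> \<Longrightarrow> y \<in> \<Omega> \<Longrightarrow> pdist x y = 0 \<longleftrightarrow> x = y"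
  by (auto simp: pdist_def \<Omega>_iff cj_inj)

lemma pdist_eq_iff:
  assumes "x \<in> \<Omega>" "y \<in> \<Omega>"
  shows "pdist x y = e \<longleftrightarrow> (x - y) * (cj x - cj y) = e * ((x - cj x) * (y - cj y))"
  using assms \<Omega>_D by (simp add: pdist_def divide_eq_eq)

lemma pdist_eq_1_iff:
  assumes "x \<in> \<Omega>" "y \<in> \<Omega>" shows "pdist x y = 1 \<longleftrightarrow> y = cj x"
proof -
  \<comment> \<open>After clearing denominators \<open>pdist x y - 1\<close> factors, and each
    factor vanishes exactly when the points are conjugate.\<close>
  have "(x - y) * (cj x - cj y) - 1 * ((x - cj x) * (y - cj y)) = (x - cj y) * (cj x - y)"
    by (simp add: algebra_simps)
  hence "pdist x y = 1 \<longleftrightarrow> x = cj y \<or> cj x = y"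
    by (subst pdist_eq_iff[OF assms]) (metis eq_iff_diff_eq_0 mult_eq_0_iff)
  thus ?thesis using assms by (auto simp: \<Omega>_iff)
qed

lemma pdist_k: "x \<in> \<Omega> \<Longrightarrow> y \<in> \<Omega> \<Longrightarrow> pdist x y \<in> k"
proof -
  assume "x \<in> \<Omega>" "y \<in> \<Omega>"
  moreover have "(cj x - x) * (cj y - y) = (x - cj x) * (y - cj y)" by (simp add: algebra_simps)
  ultimately show ?thesis by (simp add: k_iff pdist_def cj_simps \<Omega>_D mult.commute)
qed

lemma frob_\<Omega>: "x \<in> \<Omega> \<Longrightarrow> x ^ q \<in> \<Omega>"
  by (simp add: \<Omega>_iff cj_power frob_inj)

lemma frob_permutes: "frob permutes \<Omega>"
proof -
  have "inj_on frob \<Omega>" by (auto simp: inj_on_def frob_def frob_inj)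
  moreover have "frob ` \<Omega> \<subseteq> \<Omega>" by (auto simp: frob_def frob_\<Omega>)
  ultimately have "bij_betw frob \<Omega> \<Omega>" using finite_\<Omega> by (simp add: bij_betw_def endo_inj_surj)
  thus ?thesis by (rule bij_imp_permutes) (simp add: frob_def)
qed

lemma pdist_frob: "x \<in> \<Omega> \<Longrightarrow> y \<in> \<Omega> \<Longrightarrow> pdist (frob x) (frob y) = pdist x y ^ q"
  by (simp add: pdist_def frob_def frob_diff power_divide power_mult_distrib cj_power)

lemma frob_mob:
  fixes a b c e x :: 'a
  shows "((a * x + b) / (c * x + e)) ^ q = (a ^ q * x ^ q + b ^ q) / (c ^ q * x ^ q + e ^ q)"
  by (simp add: power_divide frob_add power_mult_distrib)

text \<open>Conjugation by the Frobenius map raises the coefficients to their \<open>q\<close>-th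
  powers.\<close>

lemma PGL_conj:
  assumes "g \<in> PGL k" shows "frob \<circ> g \<circ> inv_into UNIV frob \<in> PGL k"
proof -
  obtain a b c e where g: "g = mob a b c e" "a \<in> k" "b \<in> k" "c \<in> k" "e \<in> k" "a * e - b * c \<noteq> 0"
    using assms(1) by (rule PGL_E)
  have "a ^ q * e ^ q - b ^ q * c ^ q = (a * e - b * c) ^ q" by (simp add: frob_diff power_mult_distrib)
  hence "mob (a ^ q) (b ^ q) (c ^ q) (e ^ q) \<in> PGL k"
    using g by (intro PGL_I k_closed) auto
  moreover have "frob \<circ> g \<circ> inv_into UNIV frob = mob (a ^ q) (b ^ q) (c ^ q) (e ^ q)"
  proof
    fix y
    obtain x where y: "y = frob x" using permutes_surj[OF frob_permutes] by (metis surjD)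
    have "(frob \<circ> g \<circ> inv_into UNIV frob) y = frob (g x)"
      using permutes_inverses(2)[OF frob_permutes] y by simp
    also have "\<dots> = mob (a ^ q) (b ^ q) (c ^ q) (e ^ q) y"
      using g y mob_\<Omega>[of a b c e x] by (auto simp: frob_def mob_def frob_mob frob_\<Omega>)
    finally show "(frob \<circ> g \<circ> inv_into UNIV frob) y = mob (a ^ q) (b ^ q) (c ^ q) (e ^ q) y" .
  qed
  ultimately show ?thesis by simp
qed

text \<open>\<open>A / B\<close> has norm \<open>1\<close> and is therefore a quotient
  \<open>cj w / w\<close>. The form without division includes \<open>A = B = 0\<close>, which occurs
  in \<open>PGL_transitive\<close> for \<open>x = y\<close>.\<close>

lemma hilbert_90:
  assumes "cj (cj A) = A" "cj (cj B) = B" "A * cj A = B * cj B"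
  obtains w where "w \<noteq> 0" "cj (cj w) = w" "w * A = cj w * B"
proof (cases "B = 0")
  case True
  hence "A = 0" using assms by simp
  thus ?thesis using that[of 1] True by simp
next
  case B: False
  define \<rho> where "\<rho> = A / B"
  have \<rho>: "\<rho> * cj \<rho> = 1" "cj (cj \<rho>) = \<rho>" using B assms by (simp_all add: \<rho>_def cj_simps)
  have "\<exists>w. w \<noteq> 0 \<and> cj (cj w) = w \<and> cj w = \<rho> * w"
  \<comment> \<open>The witness \<open>1 + cj \<rho>\<close> works since
    \<open>\<rho> * cj \<rho> = 1\<close>, unless it is zero. Then \<open>\<rho> = -1\<close>, and a
    difference \<open>x - cj x\<close> changes sign under \<open>cj\<close>.\<close>
  proof (cases "1 + cj \<rho> = 0")
    case True
    hence "cj \<rho> = cj (- 1)" by (simp add: cj_minus eq_neg_iff_add_eq_0 add.commute)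
    hence "\<rho> = - 1" by (simp only: cj_inj)
    moreover obtain x where "x \<in> \<Omega>" using \<Omega>_nonempty by blast
    ultimately show ?thesis by (intro exI[of _ "x - cj x"]) (auto simp: cj_simps \<Omega>_D dest: \<Omega>_D(2))
  next
    case False
    thus ?thesis using \<rho> by (intro exI[of _ "1 + cj \<rho>"]) (simp add: cj_simps algebra_simps)
  qed
  then obtain w where "w \<noteq> 0" "cj (cj w) = w" "cj w = \<rho> * w" by blast
  thus ?thesis using that[of w] B by (simp add: \<rho>_def)
qed

text \<open>The transformation is determined up to scalars by \<open>w = c * x + e\<close>, and the condition \<open>g y = v\<close> turns into
  \<open>w * A = cj w * B\<close> with \<open>A\<close> and \<open>B\<close> of equal norm.\<close>

lemma PGL_transitive:
  assumes "x \<in> \<Omega>" "y \<in> \<Omega>" "u \<in> \<Omega>" "v \<in> \<Omega>" "pdist x y = pdist u v"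
  shows "\<exists>g\<in>PGL k. g x = u \<and> g y = v"
proof -
  note cc = assms(1-4)[THEN \<Omega>_D(1)] and nz = assms(1-4)[THEN \<Omega>_D(2)]
  define A where "A = (u - v) * (y - cj x)"
  define B where "B = (y - x) * (cj u - v)"
  define p where "p = (x - y) * (cj x - cj y)"
  define P where "P = (u - v) * (cj u - cj v)"
  define D where "D = (x - cj x) * (y - cj y)"
  define D1 where "D1 = (u - cj u) * (v - cj v)"
  have D: "D \<noteq> 0" "D1 \<noteq> 0" using nz by (auto simp: D_def D1_def)
  have "p / D = P / D1" using assms(5) by (simp add: pdist_def p_def P_def D_def D1_def)
  hence pD: "p * D1 = P * D" using D by (simp add: frac_eq_eq)
  \<comment> \<open>\<open>p - D\<close> and \<open>P - D1\<close> factor as in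
    \<open>pdist_eq_1_iff\<close>; the equality of distances then makes the two norms agree.\<close>
  have "A * cj A = P * (p - D)" "B * cj B = p * (P - D1)"
    by (simp_all add: A_def B_def p_def P_def D_def D1_def cj_simps cc) (simp_all add: algebra_simps)
  moreover have "P * (p - D) = p * (P - D1)"
    by (simp only: right_diff_distrib pD mult.commute[of P p])
  ultimately have "A * cj A = B * cj B" by (simp only:)
  moreover have "cj (cj A) = A" "cj (cj B) = B" by (simp_all add: A_def B_def cj_simps cc)
  ultimately obtain w where w: "w \<noteq> 0" "cj (cj w) = w" "w * A = cj w * B"
    using hilbert_90 by blast
  define \<Delta> where "\<Delta> = x - cj x"
  have \<Delta>: "\<Delta> \<noteq> 0" "cj \<Delta> = - \<Delta>" using nz by (simp_all add: \<Delta>_def cj_simps cc)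
  \<comment> \<open>\<open>c\<close> and \<open>a\<close> come from solving
    \<open>c * x + e = w\<close> and \<open>a * x + b = u * w\<close> together with their
    conjugates, the coefficients being fixed by \<open>cj\<close>.\<close>
  define c where "c = (w - cj w) / \<Delta>"
  define a where "a = (u * w - cj u * cj w) / \<Delta>"
  define e where "e = w - c * x"
  define b where "b = u * w - a * x"
  have c: "c * (x - cj x) = w - cj w" and a: "a * (x - cj x) = u * w - cj u * cj w"
    using \<Delta> by (simp_all add: c_def a_def \<Delta>_def)
  have ck: "c \<in> k"
  proof -
    have "cj c = (cj w - w) / (- \<Delta>)" by (simp add: c_def cj_simps w \<Delta>)
    thus ?thesis by (simp add: k_iff c_def minus_divide_left)
  qed
  have ak: "a \<in> k"
  proof -
    have "cj a = (cj u * cj w - u * w) / (- \<Delta>)" by (simp add: a_def cj_simps w \<Delta> cc)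
    thus ?thesis by (simp add: k_iff a_def minus_divide_left)
  qed
  have ek: "e \<in> k" using c ck by (simp add: k_iff e_def cj_simps algebra_simps)
  have bk: "b \<in> k" using a ak by (simp add: k_iff b_def cj_simps algebra_simps)
  have "(a * e - b * c) * (x - cj x) = w * (a * (x - cj x)) - u * w * (c * (x - cj x))"
    by (simp add: e_def b_def algebra_simps)
  also have "\<dots> = w * cj w * (u - cj u)" unfolding a c by (simp add: algebra_simps)
  finally have det: "a * e - b * c \<noteq> 0" using w nz by auto
  have den: "c * x + e = w" "a * x + b = u * w" by (simp_all add: e_def b_def)
  have gx: "(a * x + b) / (c * x + e) = u" using w by (simp add: den)
  \<comment> \<open>The condition \<open>g y = v\<close>, cleared of denominators, is the equation
    solved by \<open>w\<close>.\<close>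
  have "(a * y + b - v * (c * y + e)) * (x - cj x) =
      (u - v) * w * (x - cj x) + (y - x) * (a * (x - cj x)) - v * (y - x) * (c * (x - cj x))"
    by (simp add: e_def b_def algebra_simps)
  also have "\<dots> = w * A - cj w * B" unfolding a c A_def B_def by (simp add: algebra_simps)
  also have "\<dots> = 0" using w by simp
  finally have "a * y + b = v * (c * y + e)" using nz by simp
  moreover have "c * y + e \<noteq> 0" using det ck ek assms mob_denominator by blast
  ultimately have gy: "(a * y + b) / (c * y + e) = v" by simp
  have "mob a b c e \<in> PGL k" using ak bk ck ek det by (rule PGL_I)
  moreover have "mob a b c e x = u" "mob a b c e y = v" using gx gy assms by (simp_all add: mob_def)
  ultimately show ?thesis by blast
qed

sublocale coherent_action \<Omega> "PGL k" pdist 0 frob "\<lambda>e. e ^ q"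
proof
  show "id \<in> PGL k" using PGL_I[of 1 k 0 0 1] by (simp add: mob_id k_closed)
qed (use finite_\<Omega> \<Omega>_nonempty finite_PGL PGL_permutes PGL_comp PGL_inv pdist_sym pdist_eq_0_iff PGL_pdist
  PGL_transitive frob_permutes pdist_frob PGL_conj in auto)

section \<open>Circles, bisectors and their intersection numbers\<close>

lemma card_circle_le:
  assumes x: "x \<in> \<Omega>" shows "card {y \<in> \<Omega>. pdist x y = e} \<le> N + 1"
proof -
  define B where "B = - x + e * (x - cj x)"
  define C where "C = - cj x - e * (x - cj x)"
  have "{y \<in> \<Omega>. pdist x y = e} \<subseteq> {y. 1 * y ^ (N + 1) + B * y ^ N + C * y + x * cj x = 0}"
  proof
    fix y assume "y \<in> {y \<in> \<Omega>. pdist x y = e}"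
    hence "(x - y) * (cj x - cj y) = e * ((x - cj x) * (y - cj y))"
      using pdist_eq_iff[OF x] by blast
    hence "y * cj y + B * cj y + C * y + x * cj x = 0"
      by (simp add: B_def C_def algebra_simps)
    thus "y \<in> {y. 1 * y ^ (N + 1) + B * y ^ N + C * y + x * cj x = 0}"
      by (simp add: cj_def)
  qed
  from card_mono[OF card_roots_sparse_le(1) this] card_roots_sparse_le(2)[of 1 B N C "x * cj x"]
  show ?thesis using N_ge_2 by simp
qed

lemma valency_eq_card: "x \<in> \<Omega> \<Longrightarrow> valency e = card {y \<in> \<Omega>. pdist x y = e}"
  using finite_\<Omega> by (simp add: adj_def Int_def flip: row_sum_adj)

lemma E_subset: "E \<subseteq> k" unfolding E_def using pdist_k by auto

text \<open>Each circle has at most \<open>N + 1\<close> points, and the size of \<open>\<Omega>\<close> forces equality.\<close>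

lemma valency_eq:
  assumes "c \<in> k" "c \<noteq> 0" "c \<noteq> 1" shows "valency c = real N + 1"
proof -
  obtain x where x: "x \<in> \<Omega>" using \<Omega>_nonempty by blast
  define f where "f e = card {y \<in> \<Omega>. pdist x y = e}" for e
  have f0: "f 0 = 1"
  proof -
    have "{y \<in> \<Omega>. pdist x y = 0} = {x}" using x by (auto simp: pdist_eq_0_iff)
    thus ?thesis by (simp add: f_def)
  qed
  have f1: "f 1 = 1"
  proof -
    have "{y \<in> \<Omega>. pdist x y = 1} = {cj x}" using x cj_\<Omega> by (auto simp: pdist_eq_1_iff)
    thus ?thesis by (simp add: f_def)
  qed
  have "(\<Sum>e\<in>k. f e) = (\<Sum>e\<in>k. \<Sum>y\<in>{y \<in> \<Omega>. pdist x y = e}. 1)" by (simp add: f_def)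
  also have "\<dots> = (\<Sum>y\<in>\<Omega>. 1)"
    by (rule sum.group) (use finite_\<Omega> finite_k pdist_k x in auto)
  finally have "N * N - N = (\<Sum>e\<in>k. f e)" by (simp add: card_\<Omega>)
  \<comment> \<open>The count is tight: \<open>N * N - N = 2 + (N - 2) * (N + 1)\<close>, with one
    point at each of the distances \<open>0\<close> and \<open>1\<close> and \<open>N - 2\<close>
    further circles.\<close>
  also have "\<dots> = (\<Sum>e\<in>{0, 1, c}. f e) + (\<Sum>e\<in>k - {0, 1, c}. f e)"
    using assms finite_k k_closed sum.subset_diff[of "{0, 1, c}" k f] by (simp add: add.commute)
  also have "(\<Sum>e\<in>{0, 1, c}. f e) = 2 + f c" using assms f0 f1 by simp
  also have "(\<Sum>e\<in>k - {0, 1, c}. f e) \<le> (\<Sum>e\<in>k - {0, 1, c}. N + 1)"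
    using card_circle_le[OF x] by (intro sum_mono) (simp add: f_def)
  also have "\<dots> = (N - 3) * (N + 1)"
    using assms finite_k card_k k_closed by (simp add: card_Diff_subset eval_nat_numeral)
  finally have le: "N * N - N \<le> 2 + f c + (N - 3) * (N + 1)" by simp
  have "card {0, 1, c} \<le> card k" using assms finite_k k_closed by (intro card_mono) auto
  hence "N \<ge> 3" using assms card_k by simp
  then obtain n where "N = n + 3" by (metis add.commute le_Suc_ex)
  moreover have "(n + 3) * (n + 3) = (n + 3) + (n * (n + 4) + n + 6)" by (simp add: algebra_simps)
  ultimately have "N * N - N = n * (n + 4) + n + 6" "(N - 3) * (N + 1) = n * (n + 4)" by simp_all
  with le have "n * (n + 4) + n + 6 \<le> 2 + f c + n * (n + 4)" by (simp only:)
  hence "f c \<ge> N + 1" using \<open>N = n + 3\<close> by linarith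
  hence "f c = N + 1" using card_circle_le[OF x, of c] by (simp add: f_def)
  thus ?thesis using valency_eq_card[OF x] by (simp add: f_def)
qed

text \<open>A point equidistant from \<open>z\<close> and \<open>x\<close> is at no degenerate
  distance, as that would give \<open>z = x\<close>. So all circles involved have
  \<open>N + 1\<close> points, and it remains to see that the bisector, a zero set of a sparse
  polynomial, has at most \<open>N + 1\<close> points.\<close>

lemma bisector_le_1:
  assumes x: "x \<in> \<Omega>" and z: "z \<in> \<Omega>" and "z \<noteq> x" shows "bisector z x \<le> 1"
proof -
  define S where "S = {u \<in> \<Omega>. pdist z u = pdist x u}"
  have "bisector z x = (\<Sum>u\<in>\<Omega>. \<Sum>e\<in>E. adj e z u * (adj e u x / valency e))"
    unfolding bisector_def kmul_def sum_divide_distrib by (subst sum.swap) simp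
  also have "\<dots> = (\<Sum>u\<in>\<Omega>. adj (pdist z u) u x / valency (pdist z u))"
    using z by (intro sum.cong refl sum_E_adj)
  also have "\<dots> = (\<Sum>u\<in>\<Omega>. if pdist z u = pdist x u then 1 / (real N + 1) else 0)"
  proof (rule sum.cong[OF refl])
    fix u assume u: "u \<in> \<Omega>"
    show "adj (pdist z u) u x / valency (pdist z u) = (if pdist z u = pdist x u then 1 / (real N + 1) else 0)"
    proof (cases "pdist z u = pdist x u")
      case True
      have "pdist z u \<noteq> 0"
        using True x z u \<open>z \<noteq> x\<close> by (metis pdist_eq_0_iff)
      moreover have "pdist z u \<noteq> 1"
        using True x z u \<open>z \<noteq> x\<close> by (metis pdist_eq_1_iff cj_inj)
      ultimately have "valency (pdist z u) = real N + 1"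
        using z u by (intro valency_eq pdist_k)
      thus ?thesis using True by (simp add: adj_def pdist_sym[of u x])
    qed (simp add: adj_def pdist_sym[of u x])
  qed
  also have "\<dots> = card S / (real N + 1)"
    using finite_\<Omega> by (simp add: S_def sum.If_cases Int_def)
  also have "\<dots> \<le> 1"
  proof -
    define \<alpha> where "\<alpha> = z - cj z"
    define \<beta> where "\<beta> = x - cj x"
    have nz: "\<alpha> \<noteq> 0" "\<beta> \<noteq> 0" using x z \<Omega>_D by (auto simp: \<alpha>_def \<beta>_def)
    \<comment> \<open>Coefficients of the equation left after cancelling \<open>y - cj y\<close>
      from both distances. The top two cannot both vanish since \<open>z \<noteq> x\<close>.\<close>
    define B where "B = - \<alpha> * x + \<beta> * z"
    define C where "C = - \<alpha> * cj x + \<beta> * cj z"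
    define D where "D = \<alpha> * x * cj x - \<beta> * z * cj z"
    have "\<alpha> - \<beta> \<noteq> 0 \<or> B \<noteq> 0"
    proof (rule ccontr)
      assume "\<not> ?thesis"
      hence "\<alpha> = \<beta>" "\<beta> * z = \<alpha> * x" by (simp_all add: B_def)
      thus False using nz \<open>z \<noteq> x\<close> by simp
    qed
    moreover have "S \<subseteq> {y. (\<alpha> - \<beta>) * y ^ (N + 1) + B * y ^ N + C * y + D = 0}"
    proof
      fix y assume "y \<in> S"
      hence y: "y \<in> \<Omega>" "pdist z y = pdist x y" by (auto simp: S_def)
      hence "(z - y) * (cj z - cj y) / (\<alpha> * (y - cj y)) = (x - y) * (cj x - cj y) / (\<beta> * (y - cj y))"
        by (simp add: pdist_def \<alpha>_def \<beta>_def)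
      hence "(z - y) * (cj z - cj y) * \<beta> = (x - y) * (cj x - cj y) * \<alpha>"
        using nz \<Omega>_D(2)[OF y(1)] by (simp add: frac_eq_eq mult_ac)
      thus "y \<in> {y. (\<alpha> - \<beta>) * y ^ (N + 1) + B * y ^ N + C * y + D = 0}"
        by (simp add: B_def C_def D_def) (simp add: cj_def algebra_simps)
    qed
    ultimately have "card S \<le> N + 1"
      using card_mono[OF card_roots_sparse_le(1), of "\<alpha> - \<beta>" B N S C D]
        card_roots_sparse_le(2)[of "\<alpha> - \<beta>" B N C D] N_ge_2 by simp
    thus ?thesis by simp
  qed
  finally show ?thesis .
qed

text \<open>Completing the product turns the circle into a norm equation: for
  \<open>c \<in> k\<close> the second factor is the conjugate of the first, and the centre is
  \<open>x - c * (x - cj x)\<close>.\<close>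

lemma circle_eq:
  assumes "x \<in> \<Omega>" "w \<in> \<Omega>" "pdist x w = c"
  shows "(w - (x - c * (x - cj x))) * (cj w - (cj x + c * (x - cj x))) = c * (1 - c) * (x - cj x)\<^sup>2"
proof -
  define \<Delta> where "\<Delta> = x - cj x"
  have "(x - w) * (cj x - cj w) = c * (\<Delta> * (w - cj w))"
    using assms by (simp add: pdist_eq_iff \<Delta>_def)
  moreover have "(w - (x - c * \<Delta>)) * (cj w - (cj x + c * \<Delta>)) =
     (x - w) * (cj x - cj w) - c * (\<Delta> * (w - cj w)) + c * \<Delta> * (x - cj x) - (c * \<Delta>)\<^sup>2"
    by (simp add: algebra_simps power2_eq_square)
  ultimately have "(w - (x - c * \<Delta>)) * (cj w - (cj x + c * \<Delta>)) = c * \<Delta> * (x - cj x) - (c * \<Delta>)\<^sup>2"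
    by simp
  thus ?thesis by (simp add: \<Delta>_def algebra_simps power2_eq_square)
qed

text \<open>For different centres, subtracting the two norm equations leaves a relation linear in
  \<open>w\<close> and \<open>cj w\<close>, which combines with one of them into a quadratic for
  \<open>w\<close>. Concentric circles meet only if their radii agree, which forces
  \<open>u = x\<close> or \<open>u = cj x\<close>.\<close>

lemma codegree_le_2:
  assumes x: "x \<in> \<Omega>" and u: "u \<in> \<Omega>" and "u \<noteq> x" "u \<noteq> cj x"
    and c: "c \<in> k" "c \<noteq> 0" "c \<noteq> 1"
  shows "card {w \<in> \<Omega>. pdist x w = c \<and> pdist w u = c} \<le> 2"
proof -
  let ?W = "{w \<in> \<Omega>. pdist x w = c \<and> pdist w u = c}"
  define \<Delta> where "\<Delta> = x - cj x"
  define \<Delta>' where "\<Delta>' = u - cj u"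
  define p where "p = x - c * \<Delta>"
  define p' where "p' = u - c * \<Delta>'"
  define m where "m = c * (1 - c) * \<Delta>\<^sup>2"
  define m' where "m' = c * (1 - c) * \<Delta>'\<^sup>2"
  have cj\<Delta>: "cj \<Delta> = - \<Delta>" "cj \<Delta>' = - \<Delta>'"
    using x u by (simp_all add: \<Delta>_def \<Delta>'_def cj_simps \<Omega>_D)
  have cjp: "cj p = cj x + c * \<Delta>" "cj p' = cj u + c * \<Delta>'"
    using c by (simp_all add: p_def p'_def cj_simps cj\<Delta> k_iff)
  have W: "(w - p) * (cj w - cj p) = m" "(w - p') * (cj w - cj p') = m'" if "w \<in> ?W" for w
    using circle_eq[OF x, of w c] circle_eq[OF u, of w c] that pdist_sym[of w u]
    unfolding cjp by (simp_all add: p_def p'_def m_def m'_def \<Delta>_def \<Delta>'_def)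
  show ?thesis
  proof (cases "p = p'")
    case True
    have "?W = {}"
    proof (rule ccontr)
      assume "?W \<noteq> {}"
      then obtain w where "w \<in> ?W" by blast
      hence "m = m'" using W[of w] True by metis
      hence "\<Delta>\<^sup>2 = \<Delta>'\<^sup>2" using c by (simp add: m_def m'_def)
      hence sgn: "\<Delta> = \<Delta>' \<or> \<Delta>' = - \<Delta>" by (auto simp: power2_eq_iff)
      have "p - cj p = p' - cj p'" using True by simp
      hence "\<Delta> - 2 * c * \<Delta> = \<Delta>' - 2 * c * \<Delta>'"
        unfolding cjp by (simp add: p_def p'_def \<Delta>_def \<Delta>'_def algebra_simps)
      hence "(1 - 2 * c) * (\<Delta> - \<Delta>') = 0" by (simp add: algebra_simps)
      moreover have "\<Delta> \<noteq> \<Delta>'"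
        using True \<open>u \<noteq> x\<close> by (auto simp: p_def p'_def)
      ultimately have "1 - 2 * c = 0" by simp
      hence "2 * c = 1" by simp
      moreover have "u = x - 2 * c * \<Delta>"
        using True sgn \<open>\<Delta> \<noteq> \<Delta>'\<close> by (simp add: p_def p'_def algebra_simps)
      ultimately show False using \<open>u \<noteq> cj x\<close> by (simp add: \<Delta>_def)
    qed
    thus ?thesis by (simp only: card.empty)
  next
    case False
    define \<delta> where "\<delta> = p - p'"
    define \<rho> where "\<rho> = m' - m - \<delta> * cj \<delta>"
    have "cj \<delta> \<noteq> 0" using False by (simp add: \<delta>_def)
    \<comment> \<open>Multiplying the linear relation by \<open>s\<close> and replacing
      \<open>s * cj s\<close> by \<open>m\<close> gives this quadratic; its top coefficient is
      nonzero because the centres differ.\<close>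
    define P where "P = [:m * \<delta>, - \<rho>, cj \<delta>:]"
    have P: "P \<noteq> 0" using \<open>cj \<delta> \<noteq> 0\<close> by (simp add: P_def)
    have "(\<lambda>w. w - p) ` ?W \<subseteq> {s. poly P s = 0}"
    proof
      fix s assume "s \<in> (\<lambda>w. w - p) ` ?W"
      then obtain w where w: "w \<in> ?W" "s = w - p" by blast
      have 1: "s * cj s = m" using W(1)[OF w(1)] w(2) by (simp add: cj_simps)
      have "(s + \<delta>) * (cj s + cj \<delta>) = m'" using W(2)[OF w(1)] w(2) by (simp add: cj_simps \<delta>_def)
      hence "s * cj \<delta> + cj s * \<delta> = m' - s * cj s - \<delta> * cj \<delta>" by (simp add: algebra_simps)
      hence 2: "s * cj \<delta> + cj s * \<delta> = \<rho>" by (simp add: 1 \<rho>_def)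
      have "poly P s = s * (s * cj \<delta> + cj s * \<delta>) - \<rho> * s + (m - s * cj s) * \<delta>"
        by (simp add: P_def algebra_simps)
      thus "s \<in> {s. poly P s = 0}" by (simp add: 1 2)
    qed
    hence "card ((\<lambda>w. w - p) ` ?W) \<le> card {s. poly P s = 0}"
      using poly_roots_finite[OF P] by (rule card_mono[rotated])
    also have "\<dots> \<le> Polynomial.degree P" using P by (rule card_poly_roots_bound)
    also have "\<dots> \<le> 2" by (simp add: P_def)
    finally show ?thesis by (simp add: card_image inj_on_def)
  qed
qed

lemma kmul_adj_eq_card:
  assumes "x \<in> \<Omega>" "u \<in> \<Omega>"
  shows "kmul (adj c) (adj c) x u = card {w \<in> \<Omega>. pdist x w = c \<and> pdist w u = c}"
proof -
  have "kmul (adj c) (adj c) x u = (\<Sum>w\<in>\<Omega>. of_bool (pdist x w = c \<and> pdist w u = c))"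
    by (simp add: kmul_def adj_def of_bool_conj)
  thus ?thesis using finite_\<Omega> by (simp add: Int_def)
qed

text \<open>The codegrees sum to the squared valency and are at most \<open>2\<close> except at
  \<open>x\<close> and \<open>cj x\<close>, where they are at most the valency. Either source
  contributes at most twice the squared valency.\<close>

lemma sum_codegree_squared_le:
  assumes x: "x \<in> \<Omega>" and c: "c \<in> k" "c \<noteq> 0" "c \<noteq> 1"
  shows "(\<Sum>u\<in>\<Omega>. (kmul (adj c) (adj c) x u)\<^sup>2) \<le> 4 * (real N + 1)\<^sup>2"
proof -
  define v where "v = real N + 1"
  define m where "m u = kmul (adj c) (adj c) x u" for u
  have m0: "m u \<ge> 0" for u by (auto simp: m_def kmul_def adj_def intro!: sum_nonneg)
  have mv: "m u \<le> v" if u: "u \<in> \<Omega>" for u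
  proof -
    have "m u \<le> (\<Sum>w\<in>\<Omega>. adj c x w)"
      unfolding m_def kmul_def by (intro sum_mono) (simp add: adj_def)
    thus ?thesis using row_sum_adj[OF x] valency_eq[OF c] by (simp add: v_def)
  qed
  have "(\<Sum>u\<in>\<Omega>. m u) = (\<Sum>w\<in>\<Omega>. \<Sum>u\<in>\<Omega>. adj c x w * adj c w u)"
    unfolding m_def kmul_def by (rule sum.swap)
  also have "\<dots> = (\<Sum>w\<in>\<Omega>. adj c x w * v)"
    by (intro sum.cong refl) (simp add: row_sum_adj valency_eq[OF c] v_def flip: sum_distrib_left)
  also have "\<dots> = v * v"
    by (simp add: row_sum_adj[OF x] valency_eq[OF c] v_def flip: sum_distrib_right)
  finally have sum_m: "(\<Sum>u\<in>\<Omega>. m u) = v * v" .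
  have "(\<Sum>u\<in>\<Omega>. (m u)\<^sup>2) \<le> (\<Sum>u\<in>\<Omega>. 2 * m u + (if u \<in> {x, cj x} then v * v else 0))"
  proof (rule sum_mono)
    fix u assume u: "u \<in> \<Omega>"
    show "(m u)\<^sup>2 \<le> 2 * m u + (if u \<in> {x, cj x} then v * v else 0)"
    proof (cases "u \<in> {x, cj x}")
      case True
      have "m u * m u \<le> v * v" using mv[OF u] m0[of u] by (intro mult_mono) auto
      thus ?thesis using True m0[of u] by (simp add: power2_eq_square)
    next
      case False
      hence "m u \<le> 2"
        using codegree_le_2[OF x u _ _ c] unfolding m_def kmul_adj_eq_card[OF x u] by simp
      hence "m u * m u \<le> 2 * m u" using m0[of u] by (intro mult_right_mono)
      thus ?thesis using False by (simp add: power2_eq_square)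
    qed
  qed
  also have "\<dots> = 2 * (v * v) + (\<Sum>u\<in>\<Omega> \<inter> {x, cj x}. v * v)"
    using finite_\<Omega> by (simp add: sum.distrib sum_m sum.If_cases Int_def flip: sum_distrib_left)
  also have "\<dots> \<le> 2 * (v * v) + 2 * (v * v)"
  proof -
    have "card (\<Omega> \<inter> {x, cj x}) \<le> card {x, cj x}" by (intro card_mono) auto
    also have "\<dots> \<le> 2" by (simp add: card_insert_if)
    finally show ?thesis by (auto intro!: mult_right_mono)
  qed
  finally show ?thesis by (simp add: m_def v_def power2_eq_square)
qed

section \<open>The centralizer of the Frobenius map\<close>

definition centralizer :: "('a \<Rightarrow> 'a) set" where
  "centralizer = {g \<in> PGL k. frob \<circ> g = g \<circ> frob}"

lemma mob_scale: "t \<noteq> 0 \<Longrightarrow> mob (a / t) (b / t) (c / t) (e / t) = mob a b c e"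
  by (auto simp: mob_def fun_eq_iff add_divide_distrib[symmetric])

text \<open>Cross-multiplied, commutation is a quadratic equation that holds at every point of
  \<open>\<Omega>\<close>. For \<open>N \<ge> 3\<close> there are more than two points, so its
  coefficients vanish.\<close>

lemma centralizer_coeffs:
  assumes "N \<ge> 3" and k: "a \<in> k" "b \<in> k" "c \<in> k" "e \<in> k" and det: "a * e - b * c \<noteq> 0"
    and comm: "frob \<circ> mob a b c e = mob a b c e \<circ> frob"
  shows "a ^ q * c = a * c ^ q" "b ^ q * e = b * e ^ q" "a ^ q * e + b ^ q * c = a * e ^ q + b * c ^ q"
proof -
  define P where "P = [:b ^ q * e - b * e ^ q, a ^ q * e + b ^ q * c - a * e ^ q - b * c ^ q, a ^ q * c - a * c ^ q:]"
  have detq: "a ^ q * e ^ q - b ^ q * c ^ q \<noteq> 0"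
    using det by (simp add: frob_inj flip: power_mult_distrib)
  have "\<Omega> \<subseteq> {y. poly P y = 0}"
  proof
    fix y assume y: "y \<in> \<Omega>"
    then obtain x where x: "x \<in> \<Omega>" "y = x ^ q"
      using permutes_image[OF frob_permutes] by (force simp: frob_def)
    have "(frob \<circ> mob a b c e) x = (mob a b c e \<circ> frob) x" using comm by simp
    hence "((a * x + b) / (c * x + e)) ^ q = (a * y + b) / (c * y + e)"
      using x y mob_\<Omega>[OF k det x(1)] by (simp add: frob_def mob_def)
    hence "(a ^ q * y + b ^ q) / (c ^ q * y + e ^ q) = (a * y + b) / (c * y + e)"
      by (simp add: frob_mob x(2))
    moreover have "c * y + e \<noteq> 0" "c ^ q * y + e ^ q \<noteq> 0"
      using mob_denominator[OF k(3,4) det y]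
        mob_denominator[OF k_closed(8)[OF k(3)] k_closed(8)[OF k(4)] detq y] by simp_all
    ultimately have "(a ^ q * y + b ^ q) * (c * y + e) = (a * y + b) * (c ^ q * y + e ^ q)"
      by (simp add: frac_eq_eq)
    thus "y \<in> {y. poly P y = 0}" by (simp add: P_def algebra_simps)
  qed
  have "P = 0"
  proof (rule ccontr)
    assume P: "P \<noteq> 0"
    have "card \<Omega> \<le> card {y. poly P y = 0}"
      using \<open>\<Omega> \<subseteq> _\<close> poly_roots_finite[OF P] by (rule card_mono[rotated])
    also have "\<dots> \<le> Polynomial.degree P" using P by (rule card_poly_roots_bound)
    also have "\<dots> \<le> 2" by (simp add: P_def)
    finally have "N * N - N \<le> 2" by (simp add: card_\<Omega>)
    moreover have "N * N \<ge> 3 * N" using assms(1) by simp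
    ultimately show False using assms(1) by linarith
  qed
  thus "a ^ q * c = a * c ^ q" "b ^ q * e = b * e ^ q" "a ^ q * e + b ^ q * c = a * e ^ q + b * c ^ q"
    by (simp_all add: P_def algebra_simps)
qed

text \<open>After normalizing to \<open>c = 0\<close>, \<open>e = 1\<close> or to
  \<open>c = 1\<close>, all coefficients are fixed by the \<open>q\<close>-th power map. The two
  families have at most \<open>(q - 1) * q\<close> and \<open>q * (q - 1) * q\<close>
  members.\<close>

lemma card_centralizer_le:
  assumes "N \<ge> 3" shows "card centralizer \<le> q ^ 3"
proof -
  define F where "F = {x :: 'a. x ^ q = x}"
  have F: "finite F" "card F \<le> q" unfolding F_def using q_ge_2 by (rule card_fixed_power_le)+
  have "0 \<in> F" using frob_0 by (simp add: F_def)
  define S where "S = (\<lambda>(a, b). mob a b 0 1) ` ((F - {0}) \<times> F)"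
  \<comment> \<open>Using the determinant \<open>u\<close> as parameter in place of \<open>b\<close>
    turns invertibility into \<open>u \<noteq> 0\<close>.\<close>
  define T where "T = (\<lambda>(a, u, e). mob a (a * e - u) 1 e) ` (F \<times> (F - {0}) \<times> F)"
  have "centralizer \<subseteq> S \<union> T"
  proof
    fix g assume "g \<in> centralizer"
    hence "g \<in> PGL k" and comm: "frob \<circ> g = g \<circ> frob" by (auto simp: centralizer_def)
    then obtain a b c e where g: "g = mob a b c e" "a \<in> k" "b \<in> k" "c \<in> k" "e \<in> k" "a * e - b * c \<noteq> 0"
      by (metis PGL_E)
    note co = centralizer_coeffs[OF assms]
    show "g \<in> S \<union> T"
    proof (cases "c = 0")
      case True
      hence e: "e \<noteq> 0" "a \<noteq> 0" using g by auto
      have "g = mob (a / e) (b / e) 0 1" using g(1) True e mob_scale[of e a b c e] by simp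
      moreover have "a ^ q * e = a * e ^ q" "b ^ q * e = b * e ^ q"
        using co[of a b c e] g comm True frob_0 by auto
      hence "a / e \<in> F - {0}" "b / e \<in> F"
        using e by (auto simp: F_def power_divide frac_eq_eq mult.commute)
      ultimately show ?thesis by (auto simp: S_def)
    next
      case False
      define a1 b1 e1 where "a1 = a / c" and "b1 = b / c" and "e1 = e / c"
      have g1: "g = mob a1 b1 1 e1" "a1 \<in> k" "b1 \<in> k" "e1 \<in> k"
        using g False mob_scale[of c a b c e] by (simp_all add: a1_def b1_def e1_def k_closed)
      have "(a1 * e1 - b1 * 1) * (c * c) = a * e - b * c"
        using False by (simp add: a1_def b1_def e1_def field_simps)
      hence det: "a1 * e1 - b1 * 1 \<noteq> 0" using g by auto
      have eqs: "a1 ^ q = a1" "b1 ^ q * e1 = b1 * e1 ^ q" "a1 * e1 + b1 ^ q = a1 * e1 ^ q + b1"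
        using co[of a1 b1 1 e1] g1 det comm k_closed by auto
      \<comment> \<open>\<open>\<epsilon>\<close> measures the failure of \<open>e1\<close> to be
        fixed; the commutation equations make its product with the determinant zero.\<close>
      define \<epsilon> where "\<epsilon> = e1 ^ q - e1"
      have b: "b1 ^ q = b1 + a1 * \<epsilon>" using eqs(3) by (simp add: \<epsilon>_def algebra_simps)
      have "\<epsilon> * (a1 * e1 - b1 * 1) = (b1 + a1 * \<epsilon>) * e1 - b1 * (e1 + \<epsilon>)" by (simp add: algebra_simps)
      also have "\<dots> = 0" using eqs(2) b by (simp add: \<epsilon>_def)
      finally have "\<epsilon> = 0" using det by simp
      hence "e1 ^ q = e1" "b1 ^ q = b1" using b by (simp_all add: \<epsilon>_def)
      hence "a1 \<in> F" "e1 \<in> F" "a1 * e1 - b1 \<in> F - {0}"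
        using eqs det by (simp_all add: F_def frob_diff power_mult_distrib)
      moreover have "g = mob a1 (a1 * e1 - (a1 * e1 - b1)) 1 e1" using g1 by simp
      ultimately have "g \<in> T" unfolding T_def by (intro image_eqI[of _ _ "(a1, a1 * e1 - b1, e1)"]) auto
      thus ?thesis by simp
    qed
  qed
  hence "card centralizer \<le> card (S \<union> T)"
    by (rule card_mono[rotated]) (use F in \<open>auto simp: S_def T_def\<close>)
  also have "\<dots> \<le> card S + card T" by (rule card_Un_le)
  also have "card S \<le> (card F - 1) * card F"
    unfolding S_def using F \<open>0 \<in> F\<close>
    by (intro order_trans[OF card_image_le]) (auto simp: card_cartesian_product)
  also have "card T \<le> card F * ((card F - 1) * card F)"
    unfolding T_def using F \<open>0 \<in> F\<close>
    by (intro order_trans[OF card_image_le]) (auto simp: card_cartesian_product)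
  also have "(card F - 1) * card F + card F * ((card F - 1) * card F) \<le> card F ^ 3"
    by (cases "card F") (auto simp: power3_eq_cube algebra_simps)
  also have "\<dots> \<le> q ^ 3" using F by (intro power_mono) auto
  finally show ?thesis by simp
qed

text \<open>A count below \<open>N / 2\<close> deviates from the valency \<open>N + 1\<close> by
  more than \<open>N / 2\<close>, whereas the general bound limits the fourth power of the deviation
  to \<open>32 * q ^ 7 * N ^ 3\<close>. The constant is \<open>512 = 16 * 32\<close>.\<close>

theorem card_frob_pairs_ge:
  assumes c: "c \<in> k" "c \<noteq> 0" "c \<noteq> 1" and N: "N \<ge> 512 * q ^ 7"
  shows "real N / 2 \<le> card {x \<in> \<Omega>. pdist x (frob x) = c}"
proof (rule ccontr)
  define M where "M = real (card {x \<in> \<Omega>. pdist x (frob x) = c})"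
  assume "\<not> ?thesis"
  hence M: "M < N / 2" by (simp add: M_def)
  have "512 * q ^ 7 \<ge> 512" using q_ge_2 by simp
  hence N512: "N \<ge> 512" using N by linarith
  have "c \<in> E"
  proof -
    obtain x where x: "x \<in> \<Omega>" using \<Omega>_nonempty by blast
    have "real (card {y \<in> \<Omega>. pdist x y = c}) = real N + 1"
      using valency_eq[OF c] valency_eq_card[OF x] by simp
    hence "{y \<in> \<Omega>. pdist x y = c} \<noteq> {}" by (intro notI) simp
    thus ?thesis using x d_in_E by blast
  qed
  have "(N / 2) ^ 4 < (N + 1 - M) ^ 4"
    using M N512 by (intro power_strict_mono) auto
  also have "\<dots> = (M - valency c) ^ 4"
  proof -
    have "(a - b) ^ 4 = ((a - b)\<^sup>2)\<^sup>2" for a b :: real by (simp flip: power_mult)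
    hence "(a - b) ^ 4 = (b - a) ^ 4" for a b :: real by (simp only: power2_commute[of a b])
    thus ?thesis by (simp add: valency_eq[OF c] add.commute)
  qed
  also have "\<dots> \<le> real (card centralizer) ^ 2 * card {e \<in> E. e ^ q = e} * (2 * (real (card E) - 1) * (4 * (real N + 1)\<^sup>2))"
    unfolding M_def centralizer_def
    by (rule card_twisted_pairs_bound[OF \<open>c \<in> E\<close> bisector_le_1 sum_codegree_squared_le]) (use c in auto)
  also have "\<dots> \<le> real (q ^ 3) ^ 2 * q * (2 * (real N - 1) * (4 * (real N + 1)\<^sup>2))"
  proof -
    have 1: "card centralizer \<le> q ^ 3" using N512 by (intro card_centralizer_le) simp
    have "card {e \<in> E. e ^ q = e} \<le> card {e :: 'a. e ^ q = e}"
      using card_fixed_power_le[OF q_ge_2] by (intro card_mono) auto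
    also have "\<dots> \<le> q" by (rule card_fixed_power_le[OF q_ge_2])
    finally have 2: "card {e \<in> E. e ^ q = e} \<le> q" .
    have 3: "card E \<le> N" using card_mono[OF finite_k E_subset] card_k by simp
    have "card E \<ge> 1" using \<open>c \<in> E\<close> finite_E by (auto simp: Suc_le_eq card_gt_0_iff)
    thus ?thesis using 1 2 3 by (intro mult_mono power_mono) (auto simp del: of_nat_power)
  qed
  also have "\<dots> \<le> real q ^ 7 * (2 * real N * (4 * (2 * real N)\<^sup>2))"
  proof -
    have q7: "real (q ^ 3) ^ 2 * q = real q ^ 7" by (simp add: eval_nat_numeral)
    have "2 * (real N - 1) * (4 * (real N + 1)\<^sup>2) \<le> 2 * real N * (4 * (2 * real N)\<^sup>2)"
      using N512 by (intro mult_mono power_mono) auto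
    thus ?thesis unfolding q7 by (rule mult_left_mono) simp
  qed
  also have "\<dots> = (512 * real q ^ 7) * real N ^ 3 / 16" by (simp add: eval_nat_numeral)
  also have "\<dots> \<le> real N * real N ^ 3 / 16"
  proof -
    have "real (512 * q ^ 7) \<le> real N" using N by (simp only: of_nat_le_iff)
    thus ?thesis by (intro divide_right_mono mult_right_mono) simp_all
  qed
  also have "\<dots> = (N / 2) ^ 4" by (simp add: eval_nat_numeral)
  finally show False by simp
qed

end

section \<open>Polynomials from Moebius transformations\<close>

lemma card_le_card_image_times:
  assumes "finite A" "\<And>y. y \<in> f ` A \<Longrightarrow> card {x \<in> A. f x = y} \<le> K"
  shows "card A \<le> card (f ` A) * K"
proof -
  have "card A = (\<Sum>x\<in>A. 1)" by simp
  also have "\<dots> = (\<Sum>y\<in>f ` A. \<Sum>x\<in>{x \<in> A. f x = y}. 1)"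
    by (rule sum.group[symmetric]) (use assms in auto)
  also have "\<dots> \<le> (\<Sum>y\<in>f ` A. K)"
    using assms(2) by (intro sum_mono) simp
  finally show ?thesis by simp
qed

context frobenius_plane
begin

text \<open>\<open>split_poly\<close> is \<open>(ax + b)\<^sup>q (cx + e) - (ax + b)(cx + e)\<^sup>q\<close> written in the basis of \<open>V\<close>, and
  \<open>bilin\<close> is the same polynomial with \<open>x\<^sup>q\<close> replaced by an independent variable \<open>y\<close>.\<close>

definition bilin :: "'a \<Rightarrow> 'a \<Rightarrow> 'a \<Rightarrow> 'a \<Rightarrow> 'a \<Rightarrow> 'a \<Rightarrow> 'a" where
  "bilin a b c e x y = (a ^ q * y + b ^ q) * (c * x + e) - (a * x + b) * (c ^ q * y + e ^ q)"

definition split_poly :: "'a \<Rightarrow> 'a \<Rightarrow> 'a \<Rightarrow> 'a \<Rightarrow> 'a poly" where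
  "split_poly a b c e = Polynomial.monom (a ^ q * c - a * c ^ q) (q + 1) + Polynomial.monom (a ^ q * e - b * c ^ q) q
     + Polynomial.monom (b ^ q * c - a * e ^ q) 1 + Polynomial.monom (b ^ q * e - b * e ^ q) 0"

lemma coeff_split_poly:
  "Polynomial.coeff (split_poly a b c e) (q + 1) = a ^ q * c - a * c ^ q"
  "Polynomial.coeff (split_poly a b c e) q = a ^ q * e - b * c ^ q"
  "Polynomial.coeff (split_poly a b c e) 1 = b ^ q * c - a * e ^ q"
  "Polynomial.coeff (split_poly a b c e) 0 = b ^ q * e - b * e ^ q"
  using q_ge_2 by (simp_all add: split_poly_def)

lemma bilin_eq:
  fixes a b c e
  defines "f \<equiv> split_poly a b c e"
  shows "bilin a b c e x y = Polynomial.coeff f (q + 1) * x * y + Polynomial.coeff f q * y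
    + Polynomial.coeff f 1 * x + Polynomial.coeff f 0"
  unfolding f_def coeff_split_poly bilin_def by (simp add: algebra_simps)

lemma poly_split_poly: "poly (split_poly a b c e) x = bilin a b c e x (x ^ q)"
  by (simp add: split_poly_def bilin_def poly_monom algebra_simps)

lemma bilin_frob: "bilin a b c e x (z ^ q) = (a * z + b) ^ q * (c * x + e) - (a * x + b) * (c * z + e) ^ q"
  by (simp add: bilin_def frob_add power_mult_distrib)

text \<open>Through this cross-multiplication, membership in the kernel becomes a Frobenius relation
  between two image points.\<close>

lemma bilin_eq_0_iff:
  assumes "a \<in> k" "b \<in> k" "c \<in> k" "e \<in> k" "a * e - b * c \<noteq> 0" "x \<in> \<Omega>" "z \<in> \<Omega>"
  shows "bilin a b c e x (z ^ q) = 0 \<longleftrightarrow> frob (mob a b c e z) = mob a b c e x"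
proof -
  have nz: "c * x + e \<noteq> 0" "c * z + e \<noteq> 0" using assms mob_denominator by blast+
  have "frob (mob a b c e z) = mob a b c e x \<longleftrightarrow> (a * z + b) ^ q / (c * z + e) ^ q = (a * x + b) / (c * x + e)"
    using assms mob_\<Omega>[of a b c e z] by (simp add: frob_def mob_def power_divide)
  also have "\<dots> \<longleftrightarrow> bilin a b c e x (z ^ q) = 0"
    using nz by (simp add: frac_eq_eq bilin_frob)
  finally show ?thesis by simp
qed

lemma frob_fixed_k: "z ^ q = z \<Longrightarrow> z \<in> k"
proof -
  assume z: "z ^ q = z"
  have "z ^ (q ^ i) = z" for i by (induction i) (simp_all add: power_mult z)
  thus ?thesis by (simp add: k_eq N_eq)
qed

text \<open>A root in \<open>\<Omega>\<close> would be sent to a point of \<open>\<Omega>\<close>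
  fixed by the \<open>q\<close>-th power map, but such fixed points lie in \<open>k\<close>.\<close>

lemma split_poly_nonroot:
  assumes "a \<in> k" "b \<in> k" "c \<in> k" "e \<in> k" "a * e - b * c \<noteq> 0" "x \<in> \<Omega>"
  shows "poly (split_poly a b c e) x \<noteq> 0"
proof
  assume "poly (split_poly a b c e) x = 0"
  moreover define z where "z = mob a b c e x"
  ultimately have "frob z = z" using assms by (simp add: poly_split_poly bilin_eq_0_iff)
  moreover have "z \<in> \<Omega>" using assms mob_\<Omega> by (simp add: z_def mob_def)
  ultimately show False using frob_fixed_k[of z] by (auto simp: frob_def \<Omega>_iff k_iff)
qed

lemma split_poly_nonzero:
  assumes "a \<in> k" "b \<in> k" "c \<in> k" "e \<in> k" "a * e - b * c \<noteq> 0"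
  shows "split_poly a b c e \<noteq> 0"
  using \<Omega>_nonempty split_poly_nonroot[OF assms] by auto

text \<open>A root is either the pole or is sent to some \<open>z\<close> with
  \<open>z ^ q = z\<close>, hence in \<open>k\<close>; the inverse transformation also has
  coefficients in \<open>k\<close>.\<close>

lemma split_poly_root_k:
  assumes k: "a \<in> k" "b \<in> k" "c \<in> k" "e \<in> k" and det: "a * e - b * c \<noteq> 0"
    and "poly (split_poly a b c e) x = 0"
  shows "x \<in> k"
proof -
  have eq: "(a * x + b) ^ q * (c * x + e) = (a * x + b) * (c * x + e) ^ q"
    using assms(6) by (simp add: poly_split_poly bilin_frob)
  show ?thesis
  proof (cases "c * x + e = 0")
    case True
    have "c \<noteq> 0" using True det by auto
    hence "x = (- e) / c" using True by (simp add: field_simps eq_neg_iff_add_eq_0)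
    thus ?thesis using k by (auto intro!: k_closed)
  next
    case False
    define z where "z = (a * x + b) / (c * x + e)"
    have "z ^ q = z" using eq False by (simp add: z_def power_divide frac_eq_eq)
    hence z: "z \<in> k" by (rule frob_fixed_k)
    have zx: "z * (c * x + e) = a * x + b" using False by (simp add: z_def)
    hence lin: "x * (a - z * c) = z * e - b" by (simp add: algebra_simps)
    have "a - z * c \<noteq> 0"
    proof
      assume 0: "a - z * c = 0"
      hence "z * e - b = 0" using lin by simp
      hence "a = z * c" "b = z * e" using 0 by simp_all
      thus False using det by (simp add: algebra_simps)
    qed
    hence "x = (z * e - b) / (a - z * c)" using lin by (simp add: eq_divide_eq)
    thus ?thesis using k z by (auto intro!: k_closed)
  qed
qed

text \<open>For \<open>t\<close> and \<open>\<tau>\<close> in \<open>\<Omega>\<close> the last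
  condition says that the transformation sends \<open>\<tau>\<close> to the \<open>q\<close>-th
  power of the image of \<open>t\<close>.\<close>

definition split_polys :: "'a \<Rightarrow> 'a \<Rightarrow> 'a poly set" where
  "split_polys t \<tau> = {split_poly a b c e | a b c e. a \<in> k \<and> b \<in> k \<and> c \<in> k \<and> e \<in> k \<and> a * e - b * c \<noteq> 0 \<and>
     bilin a b c e \<tau> (t ^ q) = 0}"

text \<open>Each \<open>x\<close> counted in \<open>card_frob_pairs_ge\<close> is the image of
  \<open>t\<close> under a transformation sending \<open>\<tau>\<close> to \<open>frob x\<close>.
  The line of its polynomial determines the transformation up to the centralizer, so at most
  \<open>q ^ 3\<close> points share a line.\<close>

theorem card_split_polys_ge:
  assumes t: "t \<in> \<Omega>" and \<tau>: "\<tau> \<in> \<Omega>" and "\<tau> \<noteq> t" "\<tau> \<noteq> cj t" and N: "N \<ge> 512 * q ^ 7"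
  shows "real N / (2 * real q ^ 3) \<le> card ((\<lambda>f. range (\<lambda>\<kappa>. Polynomial.smult \<kappa> f)) ` split_polys t \<tau>)"
proof -
  define A where "A = {x \<in> \<Omega>. pdist x (frob x) = pdist t \<tau>}"
  define line where "line = (\<lambda>f :: 'a poly. range (\<lambda>\<kappa>. Polynomial.smult \<kappa> f))"
  have "finite A" using finite_\<Omega> by (simp add: A_def)
  have "512 * q ^ 7 \<ge> 512" using q_ge_2 by simp
  hence N512: "N \<ge> 512" using N by linarith
  have "pdist t \<tau> \<in> k" "pdist t \<tau> \<noteq> 0" "pdist t \<tau> \<noteq> 1"
    using assms by (auto simp: pdist_k pdist_eq_0_iff pdist_eq_1_iff)
  hence cardA: "real N / 2 \<le> card A" unfolding A_def using N by (rule card_frob_pairs_ge)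
  have "\<forall>x\<in>A. \<exists>(a, b, c, e)\<in>k \<times> k \<times> k \<times> k. a * e - b * c \<noteq> 0 \<and> mob a b c e t = x \<and> mob a b c e \<tau> = frob x"
  proof
    fix x assume "x \<in> A"
    hence x: "x \<in> \<Omega>" "frob x \<in> \<Omega>" "pdist t \<tau> = pdist x (frob x)" by (simp_all add: A_def)
    then obtain g where "g \<in> PGL k" "g t = x" "g \<tau> = frob x" using PGL_transitive[OF t \<tau>] by blast
    then obtain a b c e where "a \<in> k" "b \<in> k" "c \<in> k" "e \<in> k" "a * e - b * c \<noteq> 0"
      "mob a b c e t = x" "mob a b c e \<tau> = frob x" by (metis PGL_E)
    thus "\<exists>(a, b, c, e)\<in>k \<times> k \<times> k \<times> k. a * e - b * c \<noteq> 0 \<and> mob a b c e t = x \<and> mob a b c e \<tau> = frob x"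
      by (intro bexI[of _ "(a, b, c, e)"]) auto
  qed
  hence "\<exists>m. \<forall>x\<in>A. m x \<in> k \<times> k \<times> k \<times> k \<and> (case m x of (a, b, c, e) \<Rightarrow>
      a * e - b * c \<noteq> 0 \<and> mob a b c e t = x \<and> mob a b c e \<tau> = frob x)"
    unfolding Bex_def by (rule bchoice)
  then obtain m where m: "\<forall>x\<in>A. m x \<in> k \<times> k \<times> k \<times> k \<and> (case m x of (a, b, c, e) \<Rightarrow>
      a * e - b * c \<noteq> 0 \<and> mob a b c e t = x \<and> mob a b c e \<tau> = frob x)"
    by (rule exE)
  define g where "g x = (case m x of (a, b, c, e) \<Rightarrow> mob a b c e)" for x
  define f where "f x = (case m x of (a, b, c, e) \<Rightarrow> split_poly a b c e)" for x
  have f_mem: "f x \<in> split_polys t \<tau>" and g_mem: "g x \<in> PGL k" and g_t: "g x t = x" if "x \<in> A" for x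
  proof -
    obtain a b c e where ab: "m x = (a, b, c, e)" by (cases "m x")
    with m that have *: "a \<in> k" "b \<in> k" "c \<in> k" "e \<in> k" "a * e - b * c \<noteq> 0" "mob a b c e t = x"
      "mob a b c e \<tau> = frob x" by auto
    show "g x \<in> PGL k" using * ab by (auto simp: g_def intro!: PGL_I)
    show "g x t = x" using * ab by (simp add: g_def)
    have "bilin a b c e \<tau> (t ^ q) = 0"
      using * t \<tau> by (simp add: bilin_eq_0_iff)
    thus "f x \<in> split_polys t \<tau>"
      unfolding split_polys_def f_def ab using * by auto
  qed
  \<comment> \<open>The line determines the coefficients, hence \<open>bilin\<close>, up to a
    nonzero scalar, and so the pullback of the graph of \<open>frob\<close> under the
    transformation.\<close>
  have same: "frob (g x u) = g x v \<longleftrightarrow> frob (g y u) = g y v"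
    if xy: "x \<in> A" "y \<in> A" "line (f x) = line (f y)" and u: "u \<in> \<Omega>" and v: "v \<in> \<Omega>" for x y u v
  proof -
    obtain a b c e where ab: "m x = (a, b, c, e)" by (cases "m x")
    with m xy have k1: "a \<in> k" "b \<in> k" "c \<in> k" "e \<in> k" "a * e - b * c \<noteq> 0" by auto
    obtain a' b' c' e' where ab': "m y = (a', b', c', e')" by (cases "m y")
    with m xy have k2: "a' \<in> k" "b' \<in> k" "c' \<in> k" "e' \<in> k" "a' * e' - b' * c' \<noteq> 0" by auto
    have fx: "f x = split_poly a b c e" "f y = split_poly a' b' c' e'" by (simp_all add: f_def ab ab')
    have "f x \<in> line (f x)" unfolding line_def by (rule range_eqI[of _ _ 1]) simp
    then obtain \<kappa> where \<kappa>: "f x = Polynomial.smult \<kappa> (f y)" using xy(3) unfolding line_def by auto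
    have "\<kappa> \<noteq> 0" using \<kappa> fx split_poly_nonzero[OF k1] by auto
    have "bilin a b c e v (u ^ q) = \<kappa> * bilin a' b' c' e' v (u ^ q)"
      unfolding bilin_eq fx[symmetric] \<kappa> by (simp add: algebra_simps)
    hence "bilin a b c e v (u ^ q) = 0 \<longleftrightarrow> bilin a' b' c' e' v (u ^ q) = 0" using \<open>\<kappa> \<noteq> 0\<close> by simp
    thus ?thesis
      by (simp add: g_def ab ab' bilin_eq_0_iff[OF k1 v u] bilin_eq_0_iff[OF k2 v u])
  qed
  have fibre: "card {x \<in> A. (line \<circ> f) x = L} \<le> q ^ 3" if "L \<in> (line \<circ> f) ` A" for L
  proof -
    from that obtain x where x: "x \<in> A" "L = line (f x)" by auto
    have xO: "x \<in> \<Omega>" using x by (simp add: A_def)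
    have "{y \<in> A. (line \<circ> f) y = L} \<subseteq> (\<lambda>\<gamma>. \<gamma> x) ` centralizer"
    proof
      fix y assume "y \<in> {y \<in> A. (line \<circ> f) y = L}"
      hence y: "y \<in> A" "line (f x) = line (f y)" using x by auto
      \<comment> \<open>Both transformations pull the graph of \<open>frob\<close> back to the same
        relation, so \<open>\<gamma>\<close> commutes with \<open>frob\<close>; it sends
        \<open>x\<close> to \<open>y\<close> since both are images of \<open>t\<close>.\<close>
      define \<gamma> where "\<gamma> = g y \<circ> inv_into UNIV (g x)"
      have G: "g x \<in> PGL k" "g y \<in> PGL k" "inv_into UNIV (g x) \<in> PGL k" using x y g_mem PGL_inv by auto
      have \<gamma>: "\<gamma> \<in> PGL k" unfolding \<gamma>_def using G by (intro PGL_comp)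
      have "frob (\<gamma> w) = \<gamma> (frob w)" for w
      proof (cases "w \<in> \<Omega>")
        case True
        define u where "u = inv_into UNIV (g x) w"
        define v where "v = inv_into UNIV (g x) (frob w)"
        have "u \<in> \<Omega>" "v \<in> \<Omega>" using True G by (simp_all add: u_def v_def)
        moreover have "frob (g x u) = g x v" using G by (simp add: u_def v_def inv_apply)
        ultimately have "frob (g y u) = g y v" using same[OF x(1) y(1,2)] by blast
        thus ?thesis by (simp add: \<gamma>_def u_def v_def)
      next
        case False
        have "\<gamma> w = w" using PGL_permutes[OF \<gamma>] False by (rule permutes_not_in)
        thus ?thesis using False by (simp add: frob_def)
      qed
      hence "\<gamma> \<in> centralizer" using \<gamma> by (auto simp: centralizer_def)
      moreover have "inv_into UNIV (g x) x = t" using inv_apply(1)[OF G(1), of t] g_t[OF x(1)] by simp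
      hence "y = \<gamma> x" using g_t[OF y(1)] by (simp add: \<gamma>_def)
      ultimately show "y \<in> (\<lambda>\<gamma>. \<gamma> x) ` centralizer" by blast
    qed
    moreover have "finite centralizer" using finite_PGL by (simp add: centralizer_def)
    ultimately have "card {y \<in> A. (line \<circ> f) y = L} \<le> card centralizer"
      by (meson card_image_le card_mono finite_imageI order_trans)
    also have "\<dots> \<le> q ^ 3" using N512 by (intro card_centralizer_le) simp
    finally show ?thesis .
  qed
  have "finite (split_polys t \<tau>)"
  proof -
    have "split_polys t \<tau> \<subseteq> (\<lambda>(a, b, c, e). split_poly a b c e) ` (k \<times> k \<times> k \<times> k)"
      unfolding split_polys_def by force
    thus ?thesis using finite_k by (auto intro: finite_subset)
  qed
  have "card A \<le> card ((line \<circ> f) ` A) * q ^ 3"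
    using \<open>finite A\<close> fibre by (rule card_le_card_image_times)
  also have "\<dots> \<le> card (line ` split_polys t \<tau>) * q ^ 3"
    using \<open>finite (split_polys t \<tau>)\<close> f_mem by (intro mult_right_mono card_mono) auto
  finally have "real (card A) \<le> real (card (line ` split_polys t \<tau>) * q ^ 3)" by (simp only: of_nat_le_iff)
  hence "real N / 2 \<le> real (card (line ` split_polys t \<tau>)) * real q ^ 3" using cardA by simp
  thus ?thesis using q_ge_2 by (simp add: line_def field_simps)
qed

end

section \<open>Degrees of finite subfields of the closure\<close>

lemma closure_field: "Ring.field (closure_ring :: 'f::field alg_closure ring)"
  by (rule field_from_type_algebra)

text \<open>A vector \<open>v\<close> outside \<open>E\<close> multiplies the cardinality by
  \<open>card K\<close>: two representations of one sum would put a nonzero multiple of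
  \<open>v\<close>, hence \<open>v\<close> itself, into \<open>E\<close>.\<close>

lemma card_dimension:
  fixes K E :: "'f::field alg_closure set"
  assumes "ring.dimension closure_ring n K E" "subfield K closure_ring" "finite K"
  shows "finite E \<and> card E = card K ^ n"
proof -
  interpret R: Ring.field "closure_ring :: 'f alg_closure ring" by (rule closure_field)
  show ?thesis using assms
  proof (induction rule: R.dimension.induct)
    case (zero_dim K)
    show ?case by (simp add: closure_ring_simps)
  next
    case (Suc_dim v E n K)
    hence IH: "finite E" "card E = card K ^ n" by auto
    note props = R.space_subgroup_props[OF Suc_dim.prems(1) Suc_dim.hyps(3), unfolded closure_ring_simps]
    note Kprops = subringE[OF subfieldE(1)[OF Suc_dim.prems(1)], unfolded closure_ring_simps]
    have minus: "\<ominus>\<^bsub>closure_ring\<^esub> x = - x" for x :: "'f alg_closure"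
      by (rule R.minus_equality) (auto simp: closure_ring_simps)
    define f where "f = (\<lambda>(a, e). a * v + e)"
    have "R.line_extension K v E = f ` (K \<times> E)"
      unfolding set_eq_iff R.line_extension_mem_iff by (auto simp: closure_ring_simps f_def)
    moreover have "inj_on f (K \<times> E)"
    proof (rule inj_onI, clarify)
      fix a e b e' assume ab: "a \<in> K" "e \<in> E" "b \<in> K" "e' \<in> E" "f (a, e) = f (b, e')"
      hence eq: "(a - b) * v = e' - e" by (simp add: f_def algebra_simps)
      have "e' + (- e) \<in> E" using props(3)[of e' "- e"] props(4)[of e] ab by (simp add: minus)
      hence "(a - b) * v \<in> E" using eq by simp
      moreover have "a + (- b) \<in> K" using Kprops(7)[of a "- b"] Kprops(5)[of b] ab by (simp add: minus)
      ultimately have "a - b = 0" using props(6)[of "a - b" v] Suc_dim.hyps(2) by auto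
      thus "a = b \<and> e = e'" using eq by simp
    qed
    ultimately show ?case
      using IH Suc_dim.prems by (simp add: card_image card_cartesian_product)
  qed
qed

lemma power_fixed_iterate: "(x :: 'a::monoid_mult) ^ Q = x \<Longrightarrow> x ^ (Q ^ i) = x"
  by (induction i) (simp_all add: power_mult)

lemma poly_power_additive:
  fixes p :: "'a::comm_ring_1 poly"
  assumes "\<And>x y :: 'a. (x + y) ^ Q = x ^ Q + y ^ Q" "\<And>i. Polynomial.coeff p i ^ Q = Polynomial.coeff p i" "Q > 0"
  shows "poly p x ^ Q = poly p (x ^ Q)"
  using assms(2)
proof (induction p)
  case 0
  show ?case using assms(3) by (simp add: zero_power)
next
  case (pCons a p)
  have "a ^ Q = a" using pCons.prems[of 0] by simp
  moreover have "Polynomial.coeff p i ^ Q = Polynomial.coeff p i" for i using pCons.prems[of "Suc i"] by simp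
  ultimately show ?case using pCons.IH by (simp add: assms(1) power_mult_distrib)
qed

context
  fixes q d :: nat
  assumes pp: "primepow q" and d_pos: "d > 0" and card_f: "CARD('f::finite_field) = q ^ d"
begin

lemma two_le_q: "q \<ge> 2" using primepow_gt_Suc_0[OF pp] by simp

lemma frob_add_closure: "(x + y :: 'f alg_closure) ^ (q ^ i) = x ^ (q ^ i) + y ^ (q ^ i)"
proof -
  obtain e where e: "e > 0" "q = CHAR('f) ^ e" using CHAR_of_card[OF pp card_f] by blast
  have "prime CHAR('f alg_closure)" "q ^ i = CHAR('f alg_closure) ^ (e * i)"
    by (simp_all add: e(2) power_mult)
  thus ?thesis by (rule freshmans_dream')
qed

lemma base_field_eq: "(base_field :: 'f alg_closure set) = Fq_pow q d"
proof (rule card_subset_eq)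
  show "finite (Fq_pow q d :: 'f alg_closure set)"
    using Fq_pow_subfield(2)[OF pp card_f d_pos] two_le_q by (intro card_ge_0_finite) simp
  show "(base_field :: 'f alg_closure set) \<subseteq> Fq_pow q d"
  proof
    fix x :: "'f alg_closure" assume "x \<in> base_field"
    then obtain y where y: "x = to_ac y" by blast
    have "x ^ (q ^ d) = to_ac (y ^ CARD('f))" by (simp add: y card_f)
    thus "x \<in> Fq_pow q d" by (simp add: Fq_pow_def y finite_field_power_card_eq_same)
  qed
  show "card (base_field :: 'f alg_closure set) = card (Fq_pow q d :: 'f alg_closure set)"
    by (simp add: card_image inj_to_ac Fq_pow_subfield(2)[OF pp card_f d_pos] card_f)
qed

lemma base_field_subfield: "subfield (base_field :: 'f alg_closure set) closure_ring"
  unfolding base_field_eq by (rule Fq_pow_subfield(1)[OF pp card_f d_pos])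

lemma ext_degree_imp_Fq_pow:
  fixes E :: "'f alg_closure set"
  assumes E: "subfield E closure_ring" and deg: "ext_degree E n"
  shows "E = Fq_pow q (d * n)" "n > 0"
proof -
  have base: "finite (base_field :: 'f alg_closure set)" "card (base_field :: 'f alg_closure set) = q ^ d"
    by (simp_all add: card_image inj_to_ac card_f)
  have "finite E \<and> card E = card (base_field :: 'f alg_closure set) ^ n"
    using deg base_field_subfield base(1) unfolding ext_degree_def by (rule card_dimension)
  hence card: "finite E" "card E = q ^ (d * n)" by (simp_all only: base(2) power_mult)
  have "{0, 1} \<subseteq> E"
    using subringE(2,3)[OF subfieldE(1)[OF E]] by (simp add: closure_ring_simps)
  hence "card {0, 1 :: 'f alg_closure} \<le> card E" using card by (intro card_mono)
  hence "2 \<le> q ^ (d * n)" by (simp add: card)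
  thus "n > 0" by (cases n) auto
  thus "E = Fq_pow q (d * n)" using d_pos by (intro Fq_pow_unique[OF pp card_f _ E]) (simp_all add: card)
qed

text \<open>The list of all its elements spans a finite field.\<close>

lemma finite_subfield_ext_degree:
  fixes E :: "'f alg_closure set"
  assumes E: "subfield E closure_ring" and "base_field \<subseteq> E" and "finite E"
  shows "\<exists>n. ext_degree E n"
proof -
  interpret R: Ring.field "closure_ring :: 'f alg_closure ring" by (rule closure_field)
  note props = subringE[OF subfieldE(1)[OF E], unfolded closure_ring_simps]
  obtain L where L: "set L = E" using finite_list[OF assms(3)] by blast
  have "subalgebra base_field E closure_ring"
  proof (intro subalgebra.intro subalgebra_axioms.intro)
    show "subgroup E (add_monoid closure_ring)"
      using subring.axioms(1)[OF subfieldE(1)[OF E]] .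
    show "a \<otimes>\<^bsub>closure_ring\<^esub> v \<in> E" if "a \<in> base_field" "v \<in> E" for a v
      using props(6)[of a v] that assms(2) by (auto simp: closure_ring_simps)
  qed
  hence "R.Span base_field L \<subseteq> E"
    using R.subalgebra_Span_incl[OF base_field_subfield] L by blast
  moreover have "E \<subseteq> R.Span base_field L"
    using R.Span_base_incl[OF base_field_subfield, of L] L by (simp add: closure_ring_simps)
  ultimately have "E = R.Span base_field L" by blast
  moreover have "R.finite_dimension base_field (R.Span base_field L)"
    by (rule R.Span_finite_dimension[OF base_field_subfield]) (simp add: closure_ring_simps)
  ultimately show ?thesis unfolding ext_degree_def R.finite_dimension_def by simp
qed

text \<open>Trap roots refer to the degree of \<open>\<tau>\<close> over the base field, the plane
  to conjugation over \<open>k\<close>. This degree divides \<open>2 * m\<close> but not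
  \<open>m\<close>, so it is even and \<open>2 * m\<close> is an odd multiple of it.\<close>

lemma ext_degree_of_quadratic:
  fixes \<tau> :: "'f alg_closure"
  assumes m: "m > 0" and \<tau>2: "\<tau> ^ (q ^ (2 * (d * m))) = \<tau>" and \<tau>: "\<tau> ^ (q ^ (d * m)) \<noteq> \<tau>"
  obtains n j where "ext_degree (generate_field closure_ring (insert \<tau> base_field)) (2 * n)"
    "m = n * (2 * j + 1)" "\<tau> ^ (q ^ (d * (2 * n))) = \<tau>"
proof -
  interpret R: Ring.field "closure_ring :: 'f alg_closure ring" by (rule closure_field)
  define E where "E = generate_field closure_ring (insert \<tau> base_field)"
  let ?M = "2 * (d * m)"
  have M: "?M > 0" using m d_pos by simp
  have E: "subfield E closure_ring"
    unfolding E_def by (rule R.generate_field_is_subfield) (simp add: closure_ring_simps)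
  have incl: "insert \<tau> base_field \<subseteq> E" unfolding E_def by (auto intro: generate_field.incl)
  have "x ^ (q ^ ?M) = x" if "x ^ (q ^ d) = x" for x :: "'f alg_closure"
    using power_fixed_iterate[OF that, of "2 * m"] by (simp add: mult.left_commute flip: power_mult)
  hence "insert \<tau> base_field \<subseteq> Fq_pow q ?M"
    using \<tau>2 unfolding base_field_eq by (auto simp: Fq_pow_def)
  hence EM: "E \<subseteq> Fq_pow q ?M"
    unfolding E_def using Fq_pow_subfield(1)[OF pp card_f M]
    by (intro R.generate_field_min_subfield1) (auto simp: closure_ring_simps)
  have "finite (Fq_pow q ?M :: 'f alg_closure set)"
    using Fq_pow_subfield(2)[OF pp card_f M] two_le_q by (intro card_ge_0_finite) simp
  hence "finite E" using EM finite_subset by blast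
  then obtain r where deg: "ext_degree E r" using finite_subfield_ext_degree[OF E] incl by blast
  note Er = ext_degree_imp_Fq_pow[OF E deg]
  have dr: "d * r > 0" using d_pos Er(2) by simp
  \<comment> \<open>A nonzero remainder \<open>j\<close> would put \<open>E\<close> into the
    solutions of \<open>x ^ (q ^ j) = x\<close>, which are too few.\<close>
  have "?M mod (d * r) = 0"
  proof (rule ccontr)
    define j where "j = ?M mod (d * r)"
    assume "?M mod (d * r) \<noteq> 0"
    hence j: "j > 0" "j < d * r" using dr by (simp_all add: j_def)
    have "x ^ (q ^ j) = x" if "x \<in> E" for x
    proof -
      have "x ^ (q ^ (d * r)) = x" "x ^ (q ^ ?M) = x" using that EM Er(1) by (auto simp: Fq_pow_def)
      have "q ^ ?M = (q ^ (d * r)) ^ (?M div (d * r)) * q ^ j"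
        unfolding j_def power_mult[symmetric] power_add[symmetric] mult_div_mod_eq ..
      hence "x = (x ^ ((q ^ (d * r)) ^ (?M div (d * r)))) ^ (q ^ j)"
        using \<open>x ^ (q ^ ?M) = x\<close> by (simp add: power_mult)
      thus ?thesis using power_fixed_iterate[OF \<open>x ^ (q ^ (d * r)) = x\<close>] by simp
    qed
    hence "E \<subseteq> {x. x ^ (q ^ j) = x}" by blast
    moreover have qj: "q ^ j \<ge> 2" using two_le_q j self_le_power[of q j] by linarith
    ultimately have "card E \<le> q ^ j"
      using card_fixed_power_le[OF qj, where ?'a = "'f alg_closure"] by (meson card_mono order_trans)
    moreover have "card E = q ^ (d * r)" using Er(1) Fq_pow_subfield(2)[OF pp card_f dr] by simp
    ultimately have "q ^ (d * r) \<le> q ^ j" by simp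
    thus False using j two_le_q by (simp add: power_increasing_iff)
  qed
  hence "d * r dvd d * (2 * m)" by (simp add: mult.left_commute dvd_eq_mod_eq_0)
  hence "r dvd 2 * m" using d_pos by simp
  then obtain t where t: "2 * m = r * t" by (elim dvdE)
  have \<tau>E: "\<tau> ^ (q ^ (d * r)) = \<tau>" using incl Er(1) by (auto simp: Fq_pow_def)
  have "odd t"
  proof
    assume "even t"
    then obtain i where "t = 2 * i" by (elim evenE)
    hence "m = r * i" using t by simp
    hence "\<tau> ^ (q ^ (d * m)) = \<tau>" using power_fixed_iterate[OF \<tau>E, of i] by (simp flip: power_mult add: mult.assoc)
    thus False using \<tau> by simp
  qed
  then obtain j where j: "t = 2 * j + 1" by (elim oddE)
  have "even (r * t)" using t by (metis dvd_triv_left)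
  hence "even r" using \<open>odd t\<close> by simp
  then obtain n where n: "r = 2 * n" by (elim evenE)
  have "m = n * (2 * j + 1)" using t n j by simp
  thus ?thesis using that[of n j] deg \<tau>E n by (simp add: E_def)
qed

end

section \<open>The kernel of the reduced map and the final count\<close>

lemma module_smult: "Modules.module (Polynomial.smult :: 'a::field \<Rightarrow> 'a poly \<Rightarrow> 'a poly)"
  by unfold_locales (simp_all add: smult_add_right smult_add_left)

lemma span_poly_singleton:
  "module.span Polynomial.smult {f :: 'a::field poly} = range (\<lambda>\<kappa>. Polynomial.smult \<kappa> f)"
  using Modules.module.span_singleton[OF module_smult] .

lemma span_smult_singleton:
  assumes "c \<noteq> 0"
  shows "module.span Polynomial.smult {Polynomial.smult c f} = module.span Polynomial.smult {f :: 'a::field poly}"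
  unfolding span_poly_singleton
proof
  show "range (\<lambda>\<kappa>. Polynomial.smult \<kappa> (Polynomial.smult c f)) \<subseteq> range (\<lambda>\<kappa>. Polynomial.smult \<kappa> f)" by auto
  show "range (\<lambda>\<kappa>. Polynomial.smult \<kappa> f) \<subseteq> range (\<lambda>\<kappa>. Polynomial.smult \<kappa> (Polynomial.smult c f))"
  proof
    fix g assume "g \<in> range (\<lambda>\<kappa>. Polynomial.smult \<kappa> f)"
    then obtain \<kappa> where "g = Polynomial.smult \<kappa> f" by blast
    hence "g = Polynomial.smult (\<kappa> / c) (Polynomial.smult c f)" using assms by simp
    thus "g \<in> range (\<lambda>\<kappa>. Polynomial.smult \<kappa> (Polynomial.smult c f))" by blast
  qed
qed

section \<open>The space \<open>V\<close> and the kernel condition\<close>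

lemma degree_V_space:
  assumes "f \<in> V_space q" shows "Polynomial.degree f \<le> q + 1"
proof -
  interpret M: Modules.module "Polynomial.smult :: 'a \<Rightarrow> 'a poly \<Rightarrow> 'a poly" by (rule module_smult)
  have "V_space q \<subseteq> {f :: 'a poly. Polynomial.degree f \<le> q + 1}"
    unfolding V_space_def
  proof (rule M.span_minimal)
    show "M.subspace {f :: 'a poly. Polynomial.degree f \<le> q + 1}"
      by (rule M.subspaceI) (auto intro: degree_add_le order_trans[OF degree_smult_le])
  qed (auto intro: order_trans[OF degree_monom_le])
  thus ?thesis using assms by blast
qed

lemma V_space_I:
  "Polynomial.monom a (q + 1) + Polynomial.monom b q + Polynomial.monom c 1 + Polynomial.monom e 0 \<in> V_space q"
proof -
  interpret M: Modules.module "Polynomial.smult :: 'a \<Rightarrow> 'a poly \<Rightarrow> 'a poly" by (rule module_smult)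
  have "Polynomial.monom a (q + 1) + Polynomial.monom b q + Polynomial.monom c 1 + Polynomial.monom e 0 =
    Polynomial.smult a (Polynomial.monom 1 (q + 1)) + Polynomial.smult b (Polynomial.monom 1 q) +
    Polynomial.smult c (Polynomial.monom 1 1) + Polynomial.smult e 1"
    by (simp add: smult_monom monom_0)
  also have "\<dots> \<in> V_space q"
    unfolding V_space_def by (intro M.span_add M.span_scale M.span_base) auto
  finally show ?thesis .
qed

text \<open>The polynomial assumed divisible by \<open>Q\<close> is the numerator of
  \<open>phi q H0 H1 f\<close> over the denominator \<open>H1\<close>, so the value is
  \<open>Q\<close> times an element of the localization.\<close>

lemma ker_phi_mod_I:
  fixes H0 H1 Q f :: "'a::field poly"
  assumes "f \<in> V_space q" and H1: "H1 \<noteq> 0"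
    and "Q dvd [:Polynomial.coeff f 0, Polynomial.coeff f 1:] * H1 + [:Polynomial.coeff f q, Polynomial.coeff f (q + 1):] * H0"
  shows "f \<in> ker_phi_mod q H0 H1 Q"
proof -
  define c where "c = Polynomial.coeff f"
  obtain B where B: "[:c 0, c 1:] * H1 + [:c q, c (q + 1):] * H0 = Q * B"
    using assms(3) unfolding c_def by (elim dvdE)
  have lin: "to_fract [:u, v:] = to_fract [:u:] + to_fract [:v:] * to_fract [:0, 1:]" for u v :: 'a
    by (simp flip: to_fract_add to_fract_mult)
  have "phi q H0 H1 f = to_fract [:c 0, c 1:] + to_fract [:c q, c (q + 1):] * Fract H0 H1"
    unfolding phi_def Let_def c_def lin[of "Polynomial.coeff f 0"] lin[of "Polynomial.coeff f q"]
    by (simp only: algebra_simps)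
  also have "\<dots> = Fract ([:c 0, c 1:] * H1 + [:c q, c (q + 1):] * H0) H1"
    using H1 by (simp add: to_fract_def)
  also have "\<dots> = to_fract Q * Fract B H1"
    unfolding B using H1 by (simp add: to_fract_def)
  finally have phi: "phi q H0 H1 f = to_fract Q * Fract B H1" .
  have loc: "Fract B H1 + r \<in> localization H1" "r - Fract B H1 \<in> localization H1" if "r \<in> localization H1" for r
  proof -
    from that obtain a i where r: "r = Fract a (H1 ^ i)" unfolding localization_def by blast
    have "Fract B H1 + r = Fract (B * H1 ^ i + a * H1) (H1 ^ Suc i)" using H1 by (simp add: r)
    thus "Fract B H1 + r \<in> localization H1" unfolding localization_def by blast
    have "r - Fract B H1 = Fract (a * H1 - B * H1 ^ i) (H1 ^ Suc i)" using H1 by (simp add: r mult.commute)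
    thus "r - Fract B H1 \<in> localization H1" unfolding localization_def by blast
  qed
  have "residue_class H1 Q (phi q H0 H1 f) = residue_class H1 Q 0"
    unfolding residue_class_def phi
  proof (intro equalityI subsetI)
    fix u assume "u \<in> {to_fract Q * Fract B H1 + to_fract Q * r |r. r \<in> localization H1}"
    then obtain r where "r \<in> localization H1" "u = 0 + to_fract Q * (Fract B H1 + r)"
      by (auto simp: algebra_simps)
    thus "u \<in> {0 + to_fract Q * r |r. r \<in> localization H1}" using loc(1) by blast
  next
    fix u assume "u \<in> {0 + to_fract Q * r |r. r \<in> localization H1}"
    then obtain r where "r \<in> localization H1" "u = to_fract Q * Fract B H1 + to_fract Q * (r - Fract B H1)"
      by (auto simp: algebra_simps)
    thus "u \<in> {to_fract Q * Fract B H1 + to_fract Q * r |r. r \<in> localization H1}" using loc(2) by blast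
  qed
  thus ?thesis using assms(1) by (simp add: ker_phi_mod_def phi_mod_def)
qed

text \<open>Finiteness matters because an infinite set has \<open>card\<close> zero. Up to a scalar,
  a completely split polynomial is a product of at most \<open>q + 1\<close> monic linear factors
  with roots in \<open>k\<close>.\<close>

lemma finite_splitting_points:
  fixes U :: "'a::alg_closed_field poly set"
  assumes "U \<subseteq> V_space q" and "finite k"
  shows "finite {L \<in> proj_space U. point_splits_completely q k L}"
proof -
  define prodL where "prodL xs = module.span Polynomial.smult {\<Prod>x\<in>#mset xs. [:- x, 1:]}" for xs :: "'a list"
  have "{L \<in> proj_space U. point_splits_completely q k L} \<subseteq> prodL ` {xs. set xs \<subseteq> k \<and> length xs \<le> q + 1}"
  proof
    fix L assume "L \<in> {L \<in> proj_space U. point_splits_completely q k L}"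
    then obtain f where f: "f \<in> U" "f \<noteq> 0" "L = module.span Polynomial.smult {f}" "point_splits_completely q k L"
      by (auto simp: proj_space_def)
    have "f \<in> L" unfolding f(3) span_poly_singleton by (rule range_eqI[of _ _ 1]) simp
    hence split: "splits_completely q k f" using f by (simp add: point_splits_completely_def)
    obtain M where M: "size M = Polynomial.degree f" "f = Polynomial.smult (Polynomial.lead_coeff f) (\<Prod>x\<in>#M. [:- x, 1:])"
      using alg_closed_imp_factorization[OF f(2)] by blast
    obtain xs where xs: "mset xs = M" by (metis ex_mset)
    have "set xs \<subseteq> k"
    proof
      fix x assume "x \<in> set xs"
      hence "x \<in># M" using xs by auto
      hence "[:- x, 1:] dvd (\<Prod>x\<in>#M. [:- x, 1:])" by (intro dvd_prod_mset) auto
      hence "[:- x, 1:] dvd f" by (subst M(2)) (rule dvd_smult)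
      hence "poly f x = 0" by (simp add: poly_eq_0_iff_dvd)
      hence "root_mult q f (Affine x) > 0" using f(2) by (simp add: order_root)
      hence "Affine x \<in> proj_line_over k" using split unfolding splits_completely_def by blast
      thus "x \<in> k" by (auto simp: proj_line_over_def)
    qed
    moreover have "length xs \<le> q + 1"
      using degree_V_space[of f q] f(1) assms(1) M(1) xs by (metis size_mset subsetD)
    moreover have "L = prodL xs"
    proof -
      have "L = module.span Polynomial.smult {Polynomial.smult (Polynomial.lead_coeff f) (\<Prod>x\<in>#M. [:- x, 1:])}"
        unfolding f(3) using M(2) by simp
      also have "\<dots> = prodL xs"
        unfolding prodL_def xs using f(2) by (intro span_smult_singleton) simp
      finally show ?thesis .
    qed
    ultimately show "L \<in> prodL ` {xs. set xs \<subseteq> k \<and> length xs \<le> q + 1}" by blast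
  qed
  thus ?thesis using finite_lists_length_le[OF assms(2)] finite_subset by blast
qed

section \<open>Quadratic polynomials and their roots\<close>

lemma irreducible_quadratic_no_root:
  assumes irr: "irreducible_over k Q" and deg: "Polynomial.degree Q = 2" and root: "poly Q \<tau> = 0"
    and k: "\<And>x y. x \<in> k \<Longrightarrow> y \<in> k \<Longrightarrow> x + y \<in> k" "\<And>x y. x \<in> k \<Longrightarrow> y \<in> k \<Longrightarrow> x * y \<in> k"
      "\<And>x. x \<in> k \<Longrightarrow> - x \<in> k" "0 \<in> k" "1 \<in> k"
  shows "\<tau> \<notin> k"
proof
  assume \<tau>: "\<tau> \<in> k"
  define c where "c = Polynomial.coeff Q"
  have ck: "c i \<in> k" for i using irr by (simp add: c_def irreducible_over_def polys_over_def)
  have Q: "Q = [:c 0, c 1, c 2:]"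
  proof (rule poly_eqI)
    fix i
    have "Polynomial.coeff Q i = 0" if "i > 2" using that deg by (simp add: coeff_eq_0)
    thus "Polynomial.coeff Q i = Polynomial.coeff [:c 0, c 1, c 2:] i"
      by (auto simp: c_def coeff_pCons split: nat.splits) (auto simp: numeral_2_eq_2)
  qed
  have "c 2 \<noteq> 0" using deg by (metis c_def leading_coeff_0_iff degree_0 zero_neq_numeral)
  have c0: "c 0 = - \<tau> * (c 1 + c 2 * \<tau>)"
    using root by (subst (asm) Q) (simp add: algebra_simps eq_neg_iff_add_eq_0)
  have "Q = [:- \<tau>, 1:] * [:c 1 + c 2 * \<tau>, c 2:]"
    by (subst Q) (simp add: c0 algebra_simps)
  moreover have "[:- \<tau>, 1:] \<in> polys_over k" "[:c 1 + c 2 * \<tau>, c 2:] \<in> polys_over k"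
    using k ck \<tau> by (auto simp: polys_over_def coeff_pCons split: nat.splits)
  ultimately have "[:- \<tau>, 1:] dvd 1 \<or> [:c 1 + c 2 * \<tau>, c 2:] dvd 1"
    using irr unfolding irreducible_over_def by blast
  thus False using \<open>c 2 \<noteq> 0\<close> by (auto simp: is_unit_iff_degree)
qed

lemma distinct_roots_dvd:
  fixes p :: "'a::field poly"
  assumes "poly p x = 0" "poly p y = 0" "x \<noteq> y"
  shows "[:- x, 1:] * [:- y, 1:] dvd p"
proof -
  obtain r where r: "p = [:- x, 1:] * r" using assms(1) by (metis poly_eq_0_iff_dvd dvdE)
  hence "poly r y = 0" using assms(2,3) by simp
  then obtain s where "r = [:- y, 1:] * s" by (metis poly_eq_0_iff_dvd dvdE)
  thus ?thesis using r by (metis dvd_triv_left mult.assoc)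
qed

lemma quadratic_dvd:
  fixes p Q :: "'a::field poly"
  assumes "Polynomial.degree Q = 2" "poly Q x = 0" "poly Q y = 0" "x \<noteq> y" "poly p x = 0" "poly p y = 0"
  shows "Q dvd p"
proof -
  let ?D = "[:- x, 1:] * [:- y, 1:]"
  obtain r where r: "Q = ?D * r" using distinct_roots_dvd[OF assms(2,3,4)] by (elim dvdE)
  have "Q \<noteq> 0" using assms(1) by auto
  hence "r \<noteq> 0" using r by auto
  have "Polynomial.degree Q = Polynomial.degree ?D + Polynomial.degree r"
    unfolding r using \<open>r \<noteq> 0\<close> by (intro degree_mult_eq) auto
  also have "Polynomial.degree ?D = 2" by simp
  finally have "Polynomial.degree r = 0" using assms(1) by simp
  then obtain c where c: "r = [:c:]" by (auto elim: degree_eq_zeroE)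
  hence "Q = Polynomial.smult c ?D" "c \<noteq> 0" using r \<open>r \<noteq> 0\<close> by (simp_all add: mult.commute)
  thus ?thesis using smult_dvd[OF distinct_roots_dvd[OF assms(5,6,4)]] by blast
qed

theorem theorem5p1:
  fixes q d m :: nat
    and h0 h1 :: "'f::finite_field poly"
    and k :: "'f alg_closure set"
    and Q :: "'f alg_closure poly"
  assumes "primepow q" and "d > 0" and "CARD('f) = q ^ d"
    and "Polynomial.degree h0 \<le> 2" and "Polynomial.degree h1 \<le> 2" and "coprime h0 h1"
    and "subfield k closure_ring" and "base_field \<subseteq> k" and "ext_degree k m"
    and "irreducible_over k Q" and "Polynomial.degree Q = 2" and "coprime Q (lift_poly h1)"
    and "good q d h0 h1 Q"
    and "d * m \<ge> 23"
  shows "real (card {P \<in> P1_Q q h0 h1 Q. point_splits_completely q k P}) \<ge>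
           real (card k) / (2 * real q ^ 3)"
proof -
  note pp = assms(1) and card_f = assms(3)
  note setting = assms(1-3)
  define N where "N = q ^ (d * m)"
  define H0 where "H0 = lift_poly h0"
  define H1 where "H1 = lift_poly h1"
  have m: "m > 0" and dm: "d * m > 0" using assms(14) by (auto intro: Nat.gr0I)
  have q2: "q \<ge> 2" by (rule two_le_q[OF setting])
  have k_eq: "k = Fq_pow q (d * m)"
    by (rule ext_degree_imp_Fq_pow(1)[OF setting assms(7,9)])
  interpret F: frobenius_plane k q N "d * m"
  proof
    show "(x + y :: 'f alg_closure) ^ q = x ^ q + y ^ q" for x y
      using frob_add_closure[OF setting, of x y 1] by simp
    show "k = {x. x ^ N = x}" by (simp add: k_eq Fq_pow_def N_def)
    show "card k = N" unfolding k_eq N_def by (rule Fq_pow_subfield(2)[OF pp card_f dm])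
    have "N * N = q ^ (2 * (d * m))" by (simp add: N_def mult_2 power_add)
    thus "card {x :: 'f alg_closure. x ^ (N * N) = x} = N * N"
      using Fq_pow_subfield(2)[OF pp card_f, of "2 * (d * m)"] dm by (simp add: Fq_pow_def)
  qed (use q2 dm in \<open>simp_all add: N_def\<close>)
  have NN: "N * N = q ^ (2 * (d * m))" by (simp add: N_def mult_2 power_add)
  have cj_poly: "F.cj (poly p x) = poly p (F.cj x)" if "\<And>i. Polynomial.coeff p i \<in> k" for p x
    unfolding F.cj_def using that frob_add_closure[OF setting] q2
    by (intro poly_power_additive) (simp_all add: N_def k_eq Fq_pow_def)
  have lift_coeff: "Polynomial.coeff (lift_poly h) i \<in> base_field" for h :: "'f poly" and i
    by (simp add: coeff_map_poly)
  obtain \<tau> where \<tau>: "poly Q \<tau> = 0" using alg_closed_imp_poly_has_root[of Q] assms(11) by auto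
  have "\<tau> \<notin> k"
    by (rule irreducible_quadratic_no_root[OF assms(10,11) \<tau>]) (auto intro: F.k_closed)
  hence \<tau>_cj: "F.cj \<tau> \<noteq> \<tau>" by (simp add: F.k_iff)
  have Qk: "Polynomial.coeff Q i \<in> k" for i
    using assms(10) by (simp add: irreducible_over_def polys_over_def)
  have \<tau>': "poly Q (F.cj \<tau>) = 0" using cj_poly[of Q \<tau>, OF Qk] \<tau> by simp
  hence \<tau>'': "poly Q (F.cj (F.cj \<tau>)) = 0" using cj_poly[of Q "F.cj \<tau>", OF Qk] by simp
  have Q0: "Q \<noteq> 0" using assms(11) by auto
  \<comment> \<open>Otherwise \<open>\<tau>\<close> and its two iterated conjugates would be three
    roots of a quadratic.\<close>
  have "F.cj (F.cj \<tau>) = \<tau>"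
  proof (rule ccontr)
    assume ne: "F.cj (F.cj \<tau>) \<noteq> \<tau>"
    have "F.cj (F.cj \<tau>) \<noteq> F.cj \<tau>" using \<tau>_cj by (simp add: F.cj_inj)
    hence "card {\<tau>, F.cj \<tau>, F.cj (F.cj \<tau>)} = 3" using ne \<tau>_cj by auto
    moreover have "card {\<tau>, F.cj \<tau>, F.cj (F.cj \<tau>)} \<le> card {x. poly Q x = 0}"
      using \<tau> \<tau>' \<tau>'' poly_roots_finite[OF Q0] by (intro card_mono) auto
    ultimately show False using card_poly_roots_bound[OF Q0] assms(11) by simp
  qed
  hence \<tau>\<Omega>: "\<tau> \<in> F.\<Omega>" using \<tau>_cj by (simp add: F.\<Omega>_iff)
  have no_common: "poly H1 x \<noteq> 0" if "poly Q x = 0" for x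
  proof
    assume "poly H1 x = 0"
    hence "[:- x, 1:] dvd 1"
      using that assms(12) by (intro coprime_common_divisor[of Q H1]) (simp_all add: H1_def poly_eq_0_iff_dvd)
    thus False by (simp add: is_unit_iff_degree)
  qed
  have "H1 \<noteq> 0" using no_common[OF \<tau>] by auto
  define s where "s = poly H0 \<tau> / poly H1 \<tau>"
  have sH: "s * poly H1 \<tau> = poly H0 \<tau>" using no_common[OF \<tau>] by (simp add: s_def)
  have Hk: "Polynomial.coeff H0 i \<in> k" "Polynomial.coeff H1 i \<in> k" for i
    using lift_coeff assms(8) unfolding H0_def H1_def by blast+
  have cj_H: "F.cj (poly H0 x) = poly H0 (F.cj x)" "F.cj (poly H1 x) = poly H1 (F.cj x)" for x
    using cj_poly Hk by blast+
  obtain n j where deg: "ext_degree (generate_field closure_ring (insert \<tau> base_field)) (2 * n)"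
    and mn: "m = n * (2 * j + 1)" and \<tau>n: "\<tau> ^ (q ^ (d * (2 * n))) = \<tau>"
  proof (rule ext_degree_of_quadratic[OF setting m])
    show "\<tau> ^ (q ^ (2 * (d * m))) = \<tau>" using \<open>F.cj (F.cj \<tau>) = \<tau>\<close> by (simp add: F.cj_cj_eq NN)
    show "\<tau> ^ (q ^ (d * m)) \<noteq> \<tau>" using \<tau>_cj unfolding F.cj_def by (simp add: N_def)
  qed
  \<comment> \<open>\<open>m\<close> is an odd multiple of \<open>n\<close>, so on these elements
    conjugation over \<open>k\<close> is the power map with the exponent that appears in
    \<open>trap_root\<close>.\<close>
  have cj_n: "F.cj x = x ^ (q ^ (d * n))" if "x ^ (q ^ (d * (2 * n))) = x" for x
  proof -
    have "d * m = d * (2 * n) * j + d * n" by (simp add: mn algebra_simps)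
    hence "F.cj x = (x ^ ((q ^ (d * (2 * n))) ^ j)) ^ (q ^ (d * n))"
      unfolding F.cj_def by (simp add: N_def power_add power_mult)
    thus ?thesis using power_fixed_iterate[OF that] by simp
  qed
  have H_n: "poly (lift_poly h) \<tau> ^ (q ^ (d * (2 * n))) = poly (lift_poly h) \<tau>" for h :: "'f poly"
  proof -
    have "x ^ (q ^ (d * (2 * n))) = x" if "x \<in> base_field" for x :: "'f alg_closure"
      using that power_fixed_iterate[of x "q ^ d" "2 * n"]
      unfolding base_field_eq[OF setting] by (simp add: Fq_pow_def power_mult)
    hence "poly (lift_poly h) \<tau> ^ (q ^ (d * (2 * n))) = poly (lift_poly h) (\<tau> ^ (q ^ (d * (2 * n))))"
      using frob_add_closure[OF setting] q2 lift_coeff by (intro poly_power_additive) simp_all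
    thus ?thesis by (simp only: \<tau>n)
  qed
  have sn: "s ^ (q ^ (d * (2 * n))) = s"
    unfolding s_def H0_def H1_def power_divide H_n ..
  have no_trap: "s \<notin> Fq_pow q (d * n)" "poly (H1 * Polynomial.monom 1 q - H0) \<tau> \<noteq> 0"
    "poly (H1 * Polynomial.monom 1 (q ^ (d * n + 1)) - H0) \<tau> \<noteq> 0"
    using assms(13) \<tau> deg no_common[OF \<tau>] unfolding good_def trap_root_def Let_def s_def H0_def H1_def by blast+
  have cross: "s \<noteq> y" if "poly (H1 * Polynomial.monom 1 i - H0) \<tau> \<noteq> 0" "y = \<tau> ^ i" for y i
    using that sH by (auto simp: poly_monom mult.commute)
  \<comment> \<open>Goodness now reads over \<open>k\<close>: \<open>s\<close> is moved by
    conjugation and is the \<open>q\<close>-th power neither of \<open>\<tau>\<close> nor of its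
    conjugate.\<close>
  have s1: "F.cj s \<noteq> s" using cj_n[OF sn] no_trap(1) by (simp add: Fq_pow_def)
  have s2: "s \<noteq> \<tau> ^ q" using cross[OF no_trap(2)] by simp
  have s3: "s \<noteq> F.cj \<tau> ^ q"
    using cross[OF no_trap(3)] by (simp add: cj_n[OF \<tau>n] mult.commute flip: power_mult)
  have "F.cj (F.cj s) = s"
    using \<open>F.cj (F.cj \<tau>) = \<tau>\<close> by (simp add: s_def F.cj_divide cj_H)
  hence "s \<in> F.\<Omega>" using s1 by (simp add: F.\<Omega>_iff)
  then obtain t where t: "t \<in> F.\<Omega>" "t ^ q = s"
    using permutes_image[OF F.frob_permutes] by (force simp: F.frob_def)
  \<comment> \<open>This excludes the degenerate distances \<open>0\<close> and \<open>1\<close>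
    between \<open>t\<close> and \<open>\<tau>\<close>.\<close>
  have "\<tau> \<noteq> t" "\<tau> \<noteq> F.cj t"
    using s2 s3 t \<open>F.cj (F.cj \<tau>) = \<tau>\<close> by (auto simp: F.\<Omega>_iff)
  moreover have "512 * q ^ 7 \<le> N"
  proof -
    \<comment> \<open>The exponent \<open>16\<close> is what \<open>d * m \<ge> 23\<close> leaves
      beside the factor \<open>q ^ 7\<close>.\<close>
    have "(512 :: nat) \<le> 2 ^ 16" by simp
    also have "\<dots> \<le> q ^ 16" using q2 by (intro power_mono) simp_all
    finally have "512 * q ^ 7 \<le> q ^ 16 * q ^ 7" by (rule mult_right_mono) simp
    also have "\<dots> = q ^ 23" by (simp flip: power_add)
    also have "\<dots> \<le> N" unfolding N_def using q2 assms(14) by (intro power_increasing) simp_all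
    finally show ?thesis .
  qed
  ultimately have count: "real N / (2 * real q ^ 3) \<le>
      card ((\<lambda>f. range (\<lambda>\<kappa>. Polynomial.smult \<kappa> f)) ` F.split_polys t \<tau>)"
    using F.card_split_polys_ge[OF t(1) \<tau>\<Omega>] by blast
  let ?S = "{P \<in> P1_Q q h0 h1 Q. point_splits_completely q k P}"
  have "(\<lambda>f. range (\<lambda>\<kappa>. Polynomial.smult \<kappa> f)) ` F.split_polys t \<tau> \<subseteq> ?S"
  proof
    fix L assume "L \<in> (\<lambda>f. range (\<lambda>\<kappa>. Polynomial.smult \<kappa> f)) ` F.split_polys t \<tau>"
    then obtain f where f: "f \<in> F.split_polys t \<tau>" "L = module.span Polynomial.smult {f}"
      by (auto simp: span_poly_singleton)
    then obtain a b c e where abk: "a \<in> k" "b \<in> k" "c \<in> k" "e \<in> k" "a * e - b * c \<noteq> 0"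
      and fe: "f = F.split_poly a b c e" and bil: "F.bilin a b c e \<tau> s = 0"
      by (auto simp: F.split_polys_def t(2))
    have "f \<noteq> 0" unfolding fe by (rule F.split_poly_nonzero[OF abk])
    define A where "A = [:Polynomial.coeff f 0, Polynomial.coeff f 1:] * H1 + [:Polynomial.coeff f q, Polynomial.coeff f (q + 1):] * H0"
    \<comment> \<open>\<open>A\<close> is the numerator of \<open>phi\<close> at \<open>f\<close>;
      substituting \<open>h0 / h1\<close> for the \<open>q\<close>-th power means, at
      \<open>\<tau>\<close>, evaluating \<open>bilin\<close> at \<open>s\<close>.\<close>
    have "poly A \<tau> = poly H1 \<tau> * F.bilin a b c e \<tau> s"
      unfolding A_def F.bilin_eq fe[symmetric] using sH[symmetric] by (simp add: algebra_simps)
    hence A1: "poly A \<tau> = 0" by (simp add: bil)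
    have fk: "Polynomial.coeff f 0 \<in> k" "Polynomial.coeff f 1 \<in> k" "Polynomial.coeff f q \<in> k" "Polynomial.coeff f (q + 1) \<in> k"
      unfolding fe F.coeff_split_poly using abk by (auto intro!: F.k_closed)
    \<comment> \<open>\<open>A\<close> has coefficients in \<open>k\<close>, so it vanishes at the
      conjugate root as well, and \<open>Q\<close> divides it.\<close>
    hence "F.cj (poly A \<tau>) = poly A (F.cj \<tau>)"
      by (simp add: A_def F.cj_simps cj_H F.k_iff)
    hence A2: "poly A (F.cj \<tau>) = 0" using A1 by simp
    have "Q dvd A" using quadratic_dvd[OF assms(11) \<tau> \<tau>' _ A1 A2] \<tau>_cj by metis
    moreover have "f \<in> V_space q" unfolding fe F.split_poly_def by (rule V_space_I)
    ultimately have "f \<in> ker_phi_mod q H0 H1 Q"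
      using \<open>H1 \<noteq> 0\<close> unfolding A_def by (intro ker_phi_mod_I)
    hence "L \<in> P1_Q q h0 h1 Q"
      unfolding P1_Q_def proj_space_def using f(2) \<open>f \<noteq> 0\<close> by (auto simp: H0_def H1_def)
    moreover have "point_splits_completely q k L"
      unfolding point_splits_completely_def
    proof
      fix g assume "g \<in> L - {0}"
      then obtain \<kappa> where g: "g = Polynomial.smult \<kappa> f" "\<kappa> \<noteq> 0" using f(2) by (auto simp: span_poly_singleton)
      \<comment> \<open>The point at infinity always belongs to the line over \<open>k\<close>, so
        only affine roots need an argument.\<close>
      have "P \<in> proj_line_over k" if "root_mult q g P > 0" for P
      proof (cases P)
        case (Affine x)
        hence "poly g x = 0" using that by (simp add: order_root)
        hence "poly f x = 0" using g by simp
        hence "x \<in> k" unfolding fe by (rule F.split_poly_root_k[OF abk])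
        thus ?thesis by (simp add: Affine proj_line_over_def)
      qed (simp add: proj_line_over_def)
      thus "splits_completely q k g" using g \<open>f \<noteq> 0\<close> by (auto simp: splits_completely_def)
    qed
    ultimately show "L \<in> ?S" by simp
  qed
  moreover have "finite ?S"
    unfolding P1_Q_def using F.finite_k
    by (intro finite_splitting_points) (auto simp: ker_phi_mod_def)
  ultimately have "card ((\<lambda>f. range (\<lambda>\<kappa>. Polynomial.smult \<kappa> f)) ` F.split_polys t \<tau>) \<le> card ?S"
    by (intro card_mono)
  hence "real (card ((\<lambda>f. range (\<lambda>\<kappa>. Polynomial.smult \<kappa> f)) ` F.split_polys t \<tau>)) \<le> real (card ?S)"
    by (simp only: of_nat_le_iff)
  with count show ?thesis unfolding F.card_k by (rule order_trans)
qed

end
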